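(* Let $\mathcal M\subseteq\mathbb R^d$ be a connected, properly embedded Riemannian manifold of intrinsic dimension $m$, and let $p$ be a smooth, strictly positive probability density on $\mathcal M$, stationary for the diffusion with generator $D_p$, that is centered and isotropic: $\mathbb E_{Z\sim p}[Z]=0$ and $\operatorname{Cov}_{Z\sim p}(Z)=c_pI_d$ with $c_p>0$. Assume that $-D_p$ is self-adjoint in $L^2(p)$ with discrete spectrum. Fix $t>0$ and let $\mathcal L_p$ be the alignment loss associated with the time-$t$ transition kernel $K_t$. Assume that the first non-constant eigenspace of $-D_p$ has eigenvalue $\lambda_1>0$ and dimension $d$. Suppose that $$\min_{\substack{h:\mathcal M\to\mathcal M\\ h_{\#}p=p}}\mathcal L_p(h)=2dc_p\left(1-e^{-\lambda_1 t}\right)$$ (in particular the minimum is attained), and that every minimizer $h$ of this problem is linear in the ambient coordinates, i.e. of the form $h(z)=Az$ (for $p$-almost every $z\in\mathcal M$) for some $A\in\mathbb R^{d\times d}$. Then $(\mathcal M,p)$ is linearly admissible at scale $\lambda_1$.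
   Context: $\mathcal M\subseteq\mathbb R^d$ carries the metric induced from $\mathbb R^d$; $z=(z_1,\dots,z_d)$ denotes the ambient position vector, whose components are viewed as functions on $\mathcal M$. The symbol $p$ denotes both a probability measure on $\mathcal M$ and its density with respect to Riemannian volume. The weighted Laplacian is $$D_p\phi=\Delta_{\mathcal M}\phi+\langle\nabla_{\mathcal M}\log p,\nabla_{\mathcal M}\phi\rangle_{\mathcal M}=\frac1p\operatorname{div}_{\mathcal M}(p\nabla_{\mathcal M}\phi),$$ the generator of the Langevin diffusion $dZ_s=\nabla_{\mathcal M}\log p(Z_s)\,ds+\sqrt2\,dB^{\mathcal M}_s$ on $\mathcal M$, where $B^{\mathcal M}$ is Brownian motion on $\mathcal M$ with generator $\frac12\Delta_{\mathcal M}$. $K_t(z,\cdot)$ is its time-$t$ transition kernel and $T_t=e^{tD_p}$ its transition operator, $(T_t\phi)(z)=\int\phi(z')\,K_t(z,dz')$. Alignment loss: for measurable $h:\mathcal M\to\mathcal M$, $$\mathcal L_p(h)=\mathbb E\big[\|h(Z')-h(Z)\|^2\big],\qquad Z\sim p,\quad Z'\mid Z=z\sim K_t(z,\cdot),$$ with $\|\cdot\|$ the Euclidean norm of $\mathbb R^d$. The condition $h_{\#}p=p$ means $h(Z)\sim p$ when $Z\sim p$ (distribution-preserving map). Maps are identified when equal $p$-almost everywhere. Linearly admissible: for $\lambda>0$, $(\mathcal M,p)$ is linearly admissible at scale $\lambda$ if (1) $p(z)\propto\exp(-\frac{\lambda}{2}\|z\|^2)$ for $z\in\mathcal M$; (2)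 $\Delta_{\mathcal M}z=-\lambda z^\perp$ on $\mathcal M$, where $\Delta_{\mathcal M}$ acts componentwise on the position vector and $z^\perp$ is the component of $z$ normal to $\mathcal M$; (3) the coordinate functions $z_1,\dots,z_d$ span the complete first non-constant eigenspace of $-D_p$ (the eigenspace of its smallest nonzero eigenvalue), and its eigenvalue is $\lambda$. *)

theory Defs
  imports "HOL-Probability.Probability"
begin

section \<open>Smoothness and embedded submanifolds\<close>

text \<open>For open \<open>S\<close>, \<open>Ck_on k S f\<close> means that \<open>f\<close> is of class \<open>C\<^sup>k\<close> on \<open>S\<close>.\<close>

primrec Ck_on :: "nat \<Rightarrow> 'a::euclidean_space set \<Rightarrow> ('a \<Rightarrow> 'b::real_normed_vector) \<Rightarrow> bool" where
  "Ck_on 0 S f \<longleftrightarrow> continuous_on S f"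
| "Ck_on (Suc k) S f \<longleftrightarrow>
     f differentiable_on S \<and> (\<forall>v. Ck_on k S (\<lambda>x. frechet_derivative f (at x) v))"

definition smooth_on :: "'a::euclidean_space set \<Rightarrow> ('a \<Rightarrow> 'b::real_normed_vector) \<Rightarrow> bool" where
  "smooth_on S f \<longleftrightarrow> (\<forall>k. Ck_on k S f)"

text \<open>A local parametrization of \<open>M\<close> is the inverse of a chart of \<open>M\<close>.\<close>

definition local_param ::
  "(real^'d) set \<Rightarrow> (real^'m) set \<Rightarrow> (real^'m \<Rightarrow> real^'d) \<Rightarrow> bool" where
  "local_param M U \<psi> \<longleftrightarrow>
     open U \<and> smooth_on U \<psi> \<and> openin (top_of_set M) (\<psi> ` U) \<and>
     (\<exists>\<phi>. homeomorphism U (\<psi> ` U) \<psi> \<phi>) \<and>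
     (\<forall>u\<in>U. inj (frechet_derivative \<psi> (at u)))"

text \<open>The dimension of the submanifold is the cardinality of the type \<open>'m\<close>.\<close>

definition embedded_submanifold :: "'m::finite itself \<Rightarrow> (real^'d) set \<Rightarrow> bool" where
  "embedded_submanifold TYPE('m) M \<longleftrightarrow>
     (\<forall>x\<in>M. \<exists>(U :: (real^'m) set) \<psi>. local_param M U \<psi> \<and> x \<in> \<psi> ` U)"

definition properly_embedded_submanifold :: "'m::finite itself \<Rightarrow> (real^'d) set \<Rightarrow> bool" where
  "properly_embedded_submanifold TYPE('m) M \<longleftrightarrow>
     embedded_submanifold TYPE('m) M \<and> proper_map (top_of_set M) euclidean (\<lambda>x. x)"

text \<open>Functions on \<open>M\<close> are represented by functions on the ambient space whose values
  outside \<open>M\<close> are irrelevant.\<close>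

definition smooth_function :: "(real^'d) set \<Rightarrow> (real^'d \<Rightarrow> real) \<Rightarrow> bool" where
  "smooth_function M f \<longleftrightarrow>
     (\<forall>x\<in>M. \<exists>U F. open U \<and> x \<in> U \<and> smooth_on U F \<and> (\<forall>y\<in>U \<inter> M. F y = f y))"

definition test_function :: "(real^'d) set \<Rightarrow> (real^'d \<Rightarrow> real) \<Rightarrow> bool" where
  "test_function M \<phi> \<longleftrightarrow>
     smooth_function M \<phi> \<and> (\<exists>C. compact C \<and> C \<subseteq> M \<and> (\<forall>x\<in>M - C. \<phi> x = 0))"

section \<open>Riemannian geometry of the induced metric\<close>

definition tangent_space :: "(real^'d) set \<Rightarrow> real^'d \<Rightarrow> (real^'d) set" where
  "tangent_space M x =
     {v. \<exists>(\<gamma> :: real \<Rightarrow> real^'d) \<epsilon>. \<epsilon> > 0 \<and> \<gamma> ` {-\<epsilon><..<\<epsilon>} \<subseteq> M \<and> smooth_on {-\<epsilon><..<\<epsilon>} \<gamma> \<and>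
           \<gamma> 0 = x \<and> (\<gamma> has_vector_derivative v) (at 0)}"

text \<open>On a subspace, the metric projection is the orthogonal projection.\<close>

definition tangent_part :: "(real^'d) set \<Rightarrow> real^'d \<Rightarrow> real^'d \<Rightarrow> real^'d" where
  "tangent_part M x v = closest_point (tangent_space M x) v"

definition normal_part :: "(real^'d) set \<Rightarrow> real^'d \<Rightarrow> real^'d \<Rightarrow> real^'d" where
  "normal_part M x v = v - tangent_part M x v"

text \<open>Derivatives are taken relative to \<open>M\<close> (\<open>at x within M\<close>). Such a derivative is determined
  only on the tangent space, so the gradient is unique once it is required to be tangential.\<close>

definition grad_on :: "(real^'d) set \<Rightarrow> (real^'d \<Rightarrow> real) \<Rightarrow> real^'d \<Rightarrow> real^'d" where
  "grad_on M f x =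
     (THE v. v \<in> tangent_space M x \<and> (f has_derivative (\<lambda>w. v \<bullet> w)) (at x within M))"

text \<open>The Levi-Civita derivative of the induced metric is the tangential part of the ambient
  derivative, so the divergence of a tangential field \<open>X\<close> is the trace of
  \<open>v \<mapsto> tangent_part (DX v)\<close> on the tangent space. With \<open>Q\<close> the orthogonal projection onto
  the tangent space, this is the trace of \<open>Q \<circ> DX \<circ> Q\<close> on the ambient space; it uses
  \<open>DX\<close> on tangent vectors only.\<close>

definition div_on :: "(real^'d) set \<Rightarrow> (real^'d \<Rightarrow> real^'d) \<Rightarrow> real^'d \<Rightarrow> real" where
  "div_on M X x =
     (\<Sum>b\<in>Basis. frechet_derivative X (at x within M) (tangent_part M x b) \<bullet> tangent_part M x b)"

definition laplace_beltrami :: "(real^'d) set \<Rightarrow> (real^'d \<Rightarrow> real) \<Rightarrow> real^'d \<Rightarrow> real" where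
  "laplace_beltrami M f x = div_on M (grad_on M f) x"

definition weighted_laplacian ::
  "(real^'d) set \<Rightarrow> (real^'d \<Rightarrow> real) \<Rightarrow> (real^'d \<Rightarrow> real) \<Rightarrow> real^'d \<Rightarrow> real" where
  "weighted_laplacian M p f x =
     laplace_beltrami M f x + grad_on M (\<lambda>y. ln (p y)) x \<bullet> grad_on M f x"

definition gram_matrix :: "(real^'m \<Rightarrow> real^'d) \<Rightarrow> real^'m \<Rightarrow> real^'m^'m" where
  "gram_matrix \<psi> u =
     (\<chi> i j. frechet_derivative \<psi> (at u) (axis i 1) \<bullet> frechet_derivative \<psi> (at u) (axis j 1))"

text \<open>The Riemannian volume is the Borel measure on \<open>M\<close> given by \<open>sqrt (det g)\<close> in every
  local parametrization; it is unique because countably many parametrizations cover \<open>M\<close>.\<close>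

definition riemannian_volume ::
  "'m::finite itself \<Rightarrow> (real^'d) set \<Rightarrow> (real^'d) measure \<Rightarrow> bool" where
  "riemannian_volume TYPE('m) M V \<longleftrightarrow>
     sets V = sets (restrict_space borel M) \<and>
     (\<forall>(U :: (real^'m) set) \<psi> A. local_param M U \<psi> \<and> A \<in> sets V \<and> A \<subseteq> \<psi> ` U \<longrightarrow>
        emeasure V A =
          (\<integral>\<^sup>+u\<in>{u\<in>U. \<psi> u \<in> A}. ennreal (sqrt (det (gram_matrix \<psi> u))) \<partial>lborel))"

text \<open>The probability measure with density \<open>p\<close> with respect to the volume \<open>V\<close>.\<close>

definition law :: "'a measure \<Rightarrow> ('a \<Rightarrow> real) \<Rightarrow> 'a measure" where
  "law V p = density V (\<lambda>z. ennreal (p z))"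

section \<open>Unbounded operators on real L2 spaces\<close>

text \<open>Elements of \<open>L\<^sup>2(P)\<close> are represented by functions, with almost everywhere equality made
  explicit. An operator is represented by its graph, a set of pairs of such functions.\<close>

definition l2 :: "'a measure \<Rightarrow> ('a \<Rightarrow> real) set" where
  "l2 P = {f \<in> borel_measurable P. integrable P (\<lambda>x. (f x)\<^sup>2)}"

definition l2_inner :: "'a measure \<Rightarrow> ('a \<Rightarrow> real) \<Rightarrow> ('a \<Rightarrow> real) \<Rightarrow> real" where
  "l2_inner P f g = (\<integral>x. f x * g x \<partial>P)"

definition l2_norm :: "'a measure \<Rightarrow> ('a \<Rightarrow> real) \<Rightarrow> real" where
  "l2_norm P f = sqrt (l2_inner P f f)"

type_synonym 'a l2_graph = "(('a \<Rightarrow> real) \<times> ('a \<Rightarrow> real)) set"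

definition l2_closure :: "'a measure \<Rightarrow> 'a l2_graph \<Rightarrow> 'a l2_graph" where
  "l2_closure P G =
     {(f, g). f \<in> l2 P \<and> g \<in> l2 P \<and>
        (\<exists>u v. (\<forall>n::nat. (u n, v n) \<in> G \<and> u n \<in> l2 P \<and> v n \<in> l2 P) \<and>
           (\<lambda>n. l2_norm P (\<lambda>x. u n x - f x)) \<longlonglongrightarrow> 0 \<and>
           (\<lambda>n. l2_norm P (\<lambda>x. v n x - g x)) \<longlonglongrightarrow> 0)}"

definition l2_adjoint :: "'a measure \<Rightarrow> 'a l2_graph \<Rightarrow> 'a l2_graph" where
  "l2_adjoint P G =
     {(f, g). f \<in> l2 P \<and> g \<in> l2 P \<and> (\<forall>(u, v)\<in>G. l2_inner P f v = l2_inner P g u)}"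

text \<open>The first conjunct says that the domain is dense.\<close>

definition self_adjoint :: "'a measure \<Rightarrow> 'a l2_graph \<Rightarrow> bool" where
  "self_adjoint P G \<longleftrightarrow>
     (\<forall>f\<in>l2 P. \<forall>\<epsilon>>0. \<exists>(u, v)\<in>G. l2_norm P (\<lambda>x. u x - f x) < \<epsilon>) \<and> l2_adjoint P G = G"

definition neg_op :: "'a l2_graph \<Rightarrow> 'a l2_graph" where
  "neg_op G = {(f, \<lambda>x. - g x) | f g. (f, g) \<in> G}"

definition eigenspace :: "'a l2_graph \<Rightarrow> real \<Rightarrow> ('a \<Rightarrow> real) set" where
  "eigenspace A \<mu> = {f. (f, \<lambda>x. \<mu> * f x) \<in> A}"

definition eigenvalue :: "'a measure \<Rightarrow> 'a l2_graph \<Rightarrow> real \<Rightarrow> bool" where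
  "eigenvalue P A \<mu> \<longleftrightarrow> (\<exists>f\<in>eigenspace A \<mu>. \<not> (AE x in P. f x = 0))"

definition smallest_nonzero_eigenvalue :: "'a measure \<Rightarrow> 'a l2_graph \<Rightarrow> real \<Rightarrow> bool" where
  "smallest_nonzero_eigenvalue P A \<mu> \<longleftrightarrow>
     eigenvalue P A \<mu> \<and> \<mu> \<noteq> 0 \<and> (\<forall>\<nu>. eigenvalue P A \<nu> \<and> \<nu> \<noteq> 0 \<longrightarrow> \<mu> \<le> \<nu>)"

text \<open>Span and dimension modulo almost everywhere equality.\<close>

definition ae_span :: "'a measure \<Rightarrow> 'i set \<Rightarrow> ('i \<Rightarrow> 'a \<Rightarrow> real) \<Rightarrow> ('a \<Rightarrow> real) set" where
  "ae_span P I b = {f \<in> l2 P. \<exists>a. AE x in P. f x = (\<Sum>i\<in>I. a i * b i x)}"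

definition has_ae_dim :: "'a measure \<Rightarrow> ('a \<Rightarrow> real) set \<Rightarrow> nat \<Rightarrow> bool" where
  "has_ae_dim P E n \<longleftrightarrow>
     (\<exists>b. (\<forall>i<n. b i \<in> l2 P) \<and>
          (\<forall>a. (AE x in P. (\<Sum>i<n. a i * b i x) = 0) \<longrightarrow> (\<forall>i<n. a i = 0)) \<and>
          E = ae_span P {..<n} b)"

text \<open>A number \<open>\<mu>\<close> is in the resolvent set if \<open>A - \<mu>\<close> is a bijection from the domain onto
  \<open>L\<^sup>2(P)\<close> with bounded inverse; \<open>(f, g + \<mu> f) \<in> A\<close> says \<open>(A - \<mu>) f = g\<close>. Only real \<open>\<mu>\<close> are
  considered: the spectrum of a self-adjoint operator is real.\<close>

definition resolvent_set :: "'a measure \<Rightarrow> 'a l2_graph \<Rightarrow> real set" where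
  "resolvent_set P A =
     {\<mu>. (\<forall>f\<in>eigenspace A \<mu>. AE x in P. f x = 0) \<and>
         (\<exists>C. \<forall>g\<in>l2 P. \<exists>f. (f, \<lambda>x. g x + \<mu> * f x) \<in> A \<and> l2_norm P f \<le> C * l2_norm P g)}"

definition spectrum :: "'a measure \<Rightarrow> 'a l2_graph \<Rightarrow> real set" where
  "spectrum P A = - resolvent_set P A"

definition discrete_spectrum :: "'a measure \<Rightarrow> 'a l2_graph \<Rightarrow> bool" where
  "discrete_spectrum P A \<longleftrightarrow>
     (\<forall>\<mu>\<in>spectrum P A. \<not> \<mu> islimpt spectrum P A \<and> eigenvalue P A \<mu> \<and>
        (\<exists>n. has_ae_dim P (eigenspace A \<mu>) n))"

text \<open>\<open>T s = e\<^sup>s\<^sup>G\<close>, that is, \<open>T\<close> is the strongly continuous semigroup with generator \<open>G\<close>.\<close>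

definition generates_semigroup ::
  "'a measure \<Rightarrow> 'a l2_graph \<Rightarrow> (real \<Rightarrow> ('a \<Rightarrow> real) \<Rightarrow> 'a \<Rightarrow> real) \<Rightarrow> bool" where
  "generates_semigroup P G T \<longleftrightarrow>
     (\<forall>s\<ge>0. \<exists>C. \<forall>f\<in>l2 P. T s f \<in> l2 P \<and> l2_norm P (T s f) \<le> C * l2_norm P f) \<and>
     (\<forall>s\<ge>0. \<forall>f\<in>l2 P. \<forall>g\<in>l2 P. \<forall>a b.
        AE x in P. T s (\<lambda>y. a * f y + b * g y) x = a * T s f x + b * T s g x) \<and>
     (\<forall>f\<in>l2 P. AE x in P. T 0 f x = f x) \<and>
     (\<forall>s\<ge>0. \<forall>r\<ge>0. \<forall>f\<in>l2 P. AE x in P. T (s + r) f x = T s (T r f) x) \<and>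
     (\<forall>f\<in>l2 P. ((\<lambda>s. l2_norm P (\<lambda>x. T s f x - f x)) \<longlongrightarrow> 0) (at_right 0)) \<and>
     G = {(f, g). f \<in> l2 P \<and> g \<in> l2 P \<and>
            ((\<lambda>s. l2_norm P (\<lambda>x. (T s f x - f x) / s - g x)) \<longlongrightarrow> 0) (at_right 0)}"

text \<open>The realization of \<open>D\<^sub>p\<close> in \<open>L\<^sup>2(p)\<close>: its closure from the compactly supported smooth
  functions.\<close>

definition weighted_laplacian_op ::
  "(real^'d) set \<Rightarrow> (real^'d) measure \<Rightarrow> (real^'d \<Rightarrow> real) \<Rightarrow> (real^'d) l2_graph" where
  "weighted_laplacian_op M V p =
     l2_closure (law V p) {(\<phi>, weighted_laplacian M p \<phi>) | \<phi>. test_function M \<phi>}"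

section \<open>The Langevin diffusion\<close>

definition path_space :: "(real^'d) set \<Rightarrow> (real \<Rightarrow> real^'d) set" where
  "path_space M = {\<omega>. continuous_on {0..} \<omega> \<and> \<omega> ` {0..} \<subseteq> M}"

definition path_events :: "(real^'d) set \<Rightarrow> real set \<Rightarrow> (real \<Rightarrow> real^'d) set set" where
  "path_events M I =
     sigma_sets (path_space M) {{\<omega> \<in> path_space M. \<omega> s \<in> A} | s A. s \<in> I \<and> A \<in> sets borel}"

definition dynkin_process ::
  "(real^'d) set \<Rightarrow> (real^'d \<Rightarrow> real) \<Rightarrow> (real^'d \<Rightarrow> real) \<Rightarrow> real \<Rightarrow> (real \<Rightarrow> real^'d) \<Rightarrow> real" where
  "dynkin_process M p \<phi> s \<omega> =
     \<phi> (\<omega> s) - \<phi> (\<omega> 0) - integral {0..s} (\<lambda>r. weighted_laplacian M p \<phi> (\<omega> r))"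

text \<open>\<open>Q\<close> is the path law of a weak solution of \<open>dZ = grad (log p)(Z) ds + sqrt 2 dB\<close> started
  at \<open>z\<close>, \<open>B\<close> being Brownian motion on \<open>M\<close>: the diffusion with generator \<open>D\<^sub>p\<close>, in the usual
  sense of the martingale problem on the path space of \<open>M\<close>.\<close>

definition langevin_path_law ::
  "(real^'d) set \<Rightarrow> (real^'d \<Rightarrow> real) \<Rightarrow> real^'d \<Rightarrow> (real \<Rightarrow> real^'d) measure \<Rightarrow> bool" where
  "langevin_path_law M p z Q \<longleftrightarrow>
     prob_space Q \<and> space Q = path_space M \<and> sets Q = path_events M {0..} \<and>
     (AE \<omega> in Q. \<omega> 0 = z) \<and>
     (\<forall>\<phi>. test_function M \<phi> \<longrightarrow>
        (\<forall>s\<ge>0. integrable Q (dynkin_process M p \<phi> s)) \<and>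
        (\<forall>r s. 0 \<le> r \<and> r \<le> s \<longrightarrow>
           (\<forall>F\<in>path_events M {0..r}.
              (\<integral>\<omega>\<in>F. dynkin_process M p \<phi> s \<omega> \<partial>Q) = (\<integral>\<omega>\<in>F. dynkin_process M p \<phi> r \<omega> \<partial>Q))))"

definition transition_operator ::
  "(real \<Rightarrow> 'a \<Rightarrow> 'a measure) \<Rightarrow> real \<Rightarrow> ('a \<Rightarrow> real) \<Rightarrow> 'a \<Rightarrow> real" where
  "transition_operator K s f z = (\<integral>z'. f z' \<partial>K s z)"

text \<open>\<open>K\<close> is the (Markov) family of transition kernels of the Langevin diffusion, and its
  transition operators are \<open>T\<^sub>s = exp (s D\<^sub>p)\<close> on \<open>L\<^sup>2(p)\<close>.\<close>

definition langevin_kernels ::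
  "(real^'d) set \<Rightarrow> (real^'d) measure \<Rightarrow> (real^'d \<Rightarrow> real) \<Rightarrow>
     (real \<Rightarrow> real^'d \<Rightarrow> (real^'d) measure) \<Rightarrow> bool" where
  "langevin_kernels M V p K \<longleftrightarrow>
     (\<forall>s\<ge>0. K s \<in> restrict_space borel M \<rightarrow>\<^sub>M prob_algebra (restrict_space borel M)) \<and>
     (\<forall>z\<in>M. \<exists>Q. langevin_path_law M p z Q \<and>
        (\<forall>s\<ge>0. K s z = distr Q (restrict_space borel M) (\<lambda>\<omega>. \<omega> s))) \<and>
     (\<forall>s\<ge>0. \<forall>r\<ge>0. \<forall>z\<in>M. K (s + r) z = K s z \<bind> K r) \<and>
     generates_semigroup (law V p) (weighted_laplacian_op M V p) (transition_operator K)"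

section \<open>Alignment loss and linear admissibility\<close>

text \<open>The expectation of a nonnegative variable is taken in the extended nonnegative reals.\<close>

definition alignment_loss ::
  "(real^'d) measure \<Rightarrow> (real^'d \<Rightarrow> (real^'d) measure) \<Rightarrow> (real^'d \<Rightarrow> real^'d) \<Rightarrow> ennreal" where
  "alignment_loss P \<kappa> h = (\<integral>\<^sup>+z. (\<integral>\<^sup>+z'. ennreal ((norm (h z' - h z))\<^sup>2) \<partial>\<kappa> z) \<partial>P)"

text \<open>For \<open>P\<close> a measure on \<open>M\<close>, measurability from \<open>P\<close> to \<open>P\<close> includes \<open>h ` M \<subseteq> M\<close>.\<close>

definition distribution_preserving :: "'a measure \<Rightarrow> ('a \<Rightarrow> 'a) \<Rightarrow> bool" where
  "distribution_preserving P h \<longleftrightarrow> h \<in> P \<rightarrow>\<^sub>M P \<and> distr P P h = P"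

definition mean_vector :: "(real^'d) measure \<Rightarrow> real^'d" where
  "mean_vector P = (\<integral>z. z \<partial>P)"

definition covariance_matrix :: "(real^'d) measure \<Rightarrow> real^'d^'d" where
  "covariance_matrix P =
     (\<chi> i j. (\<integral>z. (z $ i - mean_vector P $ i) * (z $ j - mean_vector P $ j) \<partial>P))"

definition linearly_admissible ::
  "(real^'d) set \<Rightarrow> (real^'d) measure \<Rightarrow> (real^'d \<Rightarrow> real) \<Rightarrow> real \<Rightarrow> bool" where
  "linearly_admissible M V p \<mu> \<longleftrightarrow>
     \<mu> > 0 \<and>
     (\<exists>C>0. \<forall>z\<in>M. p z = C * exp (- (\<mu> / 2) * (norm z)\<^sup>2)) \<and>
     (\<forall>z\<in>M. (\<chi> i. laplace_beltrami M (\<lambda>y. y $ i) z) = - \<mu> *\<^sub>R normal_part M z z) \<and>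
     smallest_nonzero_eigenvalue (law V p) (neg_op (weighted_laplacian_op M V p)) \<mu> \<and>
     eigenspace (neg_op (weighted_laplacian_op M V p)) \<mu> = ae_span (law V p) UNIV (\<lambda>i z. z $ i)"

end

theory Submission
  imports Defs
begin

text \<open>A linear minimizer preserves an isotropic law, hence is orthogonal, so the identity is a minimizer
  as well. Its loss is \<open>2 \<Sum>\<^sub>i \<langle>z\<^sub>i, (1 - T\<^sub>t) z\<^sub>i\<rangle>\<close>, and the spectral gap bounds every summand from below by
  \<open>c (1 - exp (- \<mu> t))\<close>; equality forces each coordinate to be an eigenfunction for \<open>\<mu>\<close>. The gap is
  obtained without the spectral theorem: a resolvent argument gives \<open>\<mu> \<langle>A f, f\<rangle> \<le> \<parallel>A f\<parallel>\<^sup>2\<close> for the negative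
  generator \<open>A\<close>, and following \<open>T\<^sub>s f\<close> in time turns this into \<open>\<mu> \<parallel>f\<parallel>\<^sup>2 \<le> \<langle>A f, f\<rangle>\<close> on the orthogonal
  complement of the kernel, which consists of constants because \<open>M\<close> is connected. Being smooth, the
  coordinates satisfy \<open>\<Delta>z + grad (ln p) = - \<mu> z\<close> pointwise. Since \<open>\<Delta>z\<close> is normal, the tangential part says
  that \<open>ln p + \<mu>/2 \<parallel>z\<parallel>\<^sup>2\<close> has zero gradient, and the normal part is the equation for \<open>\<Delta>z\<close>.\<close>

section \<open>Smooth functions and cutoffs\<close>

text \<open>The operator is only the closure of \<open>weighted_laplacian\<close> from test
  functions, and the coordinates need not be compactly supported, so at the start neither their
  membership in the domain nor a formula for their image is available. Membership comes out of the
  equality case of the decay estimate, the pointwise formula afterwards from duality with bumps.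
  Elements of the kernel are likewise mere L2 limits of test functions; in place of elliptic
  regularity, a translation estimate in charts makes them constant almost everywhere near each
  point, and positive mass of open sets glues the local constants. Discreteness of the spectrum
  places all of the interval from 0 to the first eigenvalue in the resolvent set. Contraction is not
  part of \<open>generates_semigroup\<close>: it comes from Jensen's inequality for the kernels and
  stationarity, while symmetry of the semigroup is derived from that of its generator. The geometry
  is computed in charts with a pseudoinverse of the Jacobian, because a derivative
  \<open>at x within M\<close> is determined on tangent vectors only.\<close>

lemma Ck_on_cong:
  fixes f g :: "'a::euclidean_space \<Rightarrow> 'b::real_normed_vector"
  assumes "open S" "Ck_on k S f" "\<And>x. x \<in> S \<Longrightarrow> f x = g x"
  shows "Ck_on k S g"
  using assms(2,3)
proof (induction k arbitrary: f g)
  case 0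
  then show ?case using continuous_on_cong by auto
next
  case (Suc k)
  have d: "(g has_derivative frechet_derivative f (at x)) (at x)" if "x \<in> S" for x
  proof -
    have "f differentiable at x"
      using Suc.prems(1) that assms(1) by (auto simp: differentiable_on_eq_differentiable_at)
    then have "(f has_derivative frechet_derivative f (at x)) (at x)"
      using frechet_derivative_works by blast
    then show ?thesis
      using has_derivative_transform_within_open[OF _ assms(1) that] Suc.prems(2) by blast
  qed
  have eq: "frechet_derivative f (at x) = frechet_derivative g (at x)" if "x \<in> S" for x
    using frechet_derivative_at[OF d[OF that]] .
  have "g differentiable_on S"
    using d assms(1) unfolding differentiable_on_eq_differentiable_at[OF assms(1)] differentiable_def by blast
  moreover have "Ck_on k S (\<lambda>x. frechet_derivative g (at x) v)" for v
    by (rule Suc.IH[of "\<lambda>x. frechet_derivative f (at x) v"]) (use Suc.prems(1) eq in simp_all)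
  ultimately show ?case by simp
qed

text \<open>The recursion in \<open>Ck_on\<close> refers to \<open>frechet_derivative\<close>; this
  rule accepts any explicit derivative \<open>f'\<close>, so each closure property becomes an
  induction on \<open>k\<close> driven by the matching derivative rule.\<close>

lemma Ck_on_SucI:
  fixes f :: "'a::euclidean_space \<Rightarrow> 'b::real_normed_vector"
  assumes "open S" "\<And>x. x \<in> S \<Longrightarrow> (f has_derivative f' x) (at x)" "\<And>v. Ck_on k S (\<lambda>x. f' x v)"
  shows "Ck_on (Suc k) S f"
proof -
  have "f differentiable_on S"
    using assms(2) unfolding differentiable_on_eq_differentiable_at[OF assms(1)] differentiable_def by blast
  moreover have "Ck_on k S (\<lambda>x. frechet_derivative f (at x) v)" for v
    by (rule Ck_on_cong[OF assms(1) assms(3)[of v]]) (simp add: frechet_derivative_at[OF assms(2), symmetric])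
  ultimately show ?thesis by simp
qed

lemma Ck_on_SucD:
  fixes f :: "'a::euclidean_space \<Rightarrow> 'b::real_normed_vector"
  assumes "open S" "Ck_on (Suc k) S f" "x \<in> S"
  shows "(f has_derivative frechet_derivative f (at x)) (at x)"
  using assms by (auto simp: differentiable_on_eq_differentiable_at frechet_derivative_works[symmetric])

lemma Ck_on_Suc_imp:
  fixes f :: "'a::euclidean_space \<Rightarrow> 'b::real_normed_vector"
  shows "Ck_on (Suc k) S f \<Longrightarrow> Ck_on k S f"
  by (induction k arbitrary: f) (auto intro: differentiable_imp_continuous_on)

lemma Ck_on_subset:
  fixes f :: "'a::euclidean_space \<Rightarrow> 'b::real_normed_vector"
  shows "Ck_on k S f \<Longrightarrow> T \<subseteq> S \<Longrightarrow> Ck_on k T f"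
  by (induction k arbitrary: f) (auto intro: continuous_on_subset differentiable_on_subset)

lemma Ck_on_local:
  fixes f :: "'a::euclidean_space \<Rightarrow> 'b::real_normed_vector"
  assumes "open S" "\<And>x. x \<in> S \<Longrightarrow> \<exists>T. open T \<and> x \<in> T \<and> Ck_on k T f"
  shows "Ck_on k S f"
  using assms(2)
proof (induction k arbitrary: f)
  case 0
  have "isCont f x" if "x \<in> S" for x
    using 0[OF that] by (auto simp: continuous_on_eq_continuous_at)
  then show ?case by (auto intro: continuous_at_imp_continuous_on)
next
  case (Suc k)
  have "f differentiable at x" if "x \<in> S" for x
    using Suc.prems[OF that] by (auto simp: differentiable_on_eq_differentiable_at)
  then have "f differentiable_on S"
    using assms(1) by (simp add: differentiable_on_eq_differentiable_at)
  moreover have "Ck_on k S (\<lambda>x. frechet_derivative f (at x) v)" for v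
    by (rule Suc.IH) (use Suc.prems in fastforce)
  ultimately show ?case by simp
qed

lemma Ck_on_const: "Ck_on k S (\<lambda>x::'a::euclidean_space. c::'b::real_normed_vector)"
  by (induction k arbitrary: c) auto

lemma (in bounded_linear) Ck_on_comp:
  fixes g :: "'c::euclidean_space \<Rightarrow> 'a"
  assumes "open S" "Ck_on k S g"
  shows "Ck_on k S (\<lambda>x. f (g x))"
  using assms(2)
proof (induction k arbitrary: g)
  case 0
  then show ?case by (simp add: continuous_on)
next
  case (Suc k)
  show ?case
    by (rule Ck_on_SucI[OF assms(1) has_derivative[OF Ck_on_SucD[OF assms(1) Suc.prems]]])
       (use Suc in auto)
qed

lemma Ck_on_id: "open S \<Longrightarrow> Ck_on k S (\<lambda>x::'a::euclidean_space. x)"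
proof (cases k)
  case (Suc n)
  assume "open S"
  then show ?thesis unfolding Suc by (rule Ck_on_SucI[OF _ has_derivative_ident Ck_on_const])
qed auto

lemma Ck_on_add:
  fixes f g :: "'a::euclidean_space \<Rightarrow> 'b::real_normed_vector"
  assumes "open S" "Ck_on k S f" "Ck_on k S g"
  shows "Ck_on k S (\<lambda>x. f x + g x)"
  using assms(2,3)
proof (induction k arbitrary: f g)
  case 0
  then show ?case by (simp add: continuous_on_add)
next
  case (Suc k)
  show ?case
    by (rule Ck_on_SucI[OF assms(1) has_derivative_add[OF Ck_on_SucD[OF assms(1) Suc.prems(1)] Ck_on_SucD[OF assms(1) Suc.prems(2)]]])
       (use Suc in auto)
qed

lemma Ck_on_sum:
  fixes f :: "'i \<Rightarrow> 'a::euclidean_space \<Rightarrow> 'b::real_normed_vector"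
  assumes "open S" "\<And>i. i \<in> I \<Longrightarrow> Ck_on k S (f i)"
  shows "Ck_on k S (\<lambda>x. \<Sum>i\<in>I. f i x)"
  using assms(2) by (induction I rule: infinite_finite_induct) (auto intro: Ck_on_const Ck_on_add[OF assms(1)])

text \<open>By the Leibniz rule the derivative is a sum of products with one differentiated and one
  undifferentiated factor. Both have order \<open>k\<close>, the latter by
  \<open>Ck_on_Suc_imp\<close>, so the induction hypothesis applies to each product.\<close>

lemma (in bounded_bilinear) Ck_on_prod:
  fixes f :: "'d::euclidean_space \<Rightarrow> 'a" and g :: "'d \<Rightarrow> 'b"
  assumes "open S" "Ck_on k S f" "Ck_on k S g"
  shows "Ck_on k S (\<lambda>x. prod (f x) (g x))"
  using assms(2,3)
proof (induction k arbitrary: f g)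
  case 0
  then show ?case by (simp add: continuous_on)
next
  case (Suc k)
  show ?case
  proof (rule Ck_on_SucI[OF assms(1) FDERIV[OF Ck_on_SucD[OF assms(1) Suc.prems(1)] Ck_on_SucD[OF assms(1) Suc.prems(2)]]])
    fix v
    show "Ck_on k S (\<lambda>x. prod (f x) (frechet_derivative g (at x) v) + prod (frechet_derivative f (at x) v) (g x))"
      by (intro Ck_on_add Suc.IH assms(1)) (use Suc.prems Ck_on_Suc_imp in auto)
  qed
qed

lemmas Ck_on_mult = bounded_bilinear.Ck_on_prod[OF bounded_bilinear_mult]
lemmas Ck_on_scaleR = bounded_bilinear.Ck_on_prod[OF bounded_bilinear_scaleR]
lemmas Ck_on_inner = bounded_bilinear.Ck_on_prod[OF bounded_bilinear_inner]

lemma Ck_on_prod_fun: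
  fixes f :: "'i \<Rightarrow> 'a::euclidean_space \<Rightarrow> real"
  assumes "open S" "\<And>i. i \<in> I \<Longrightarrow> Ck_on k S (f i)"
  shows "Ck_on k S (\<lambda>x. \<Prod>i\<in>I. f i x)"
  using assms(2) by (induction I rule: infinite_finite_induct) (auto intro: Ck_on_const Ck_on_mult[OF assms(1)])

text \<open>The derivative is a product that contains \<open>inverse (f x)\<close> itself, and the
  induction hypothesis covers that factor at order \<open>k\<close>.\<close>

lemma Ck_on_inverse:
  fixes f :: "'a::euclidean_space \<Rightarrow> real"
  assumes "open S" "Ck_on k S f" "\<And>x. x \<in> S \<Longrightarrow> f x \<noteq> 0"
  shows "Ck_on k S (\<lambda>x. inverse (f x))"
  using assms(2)
proof (induction k)
  case 0
  then show ?case using assms(3) by (auto intro: continuous_intros)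
next
  case (Suc k)
  have d: "((\<lambda>x. inverse (f x)) has_derivative (\<lambda>v. - (inverse (f x) * frechet_derivative f (at x) v * inverse (f x)))) (at x)"
    if "x \<in> S" for x
    using Deriv.has_derivative_inverse[OF assms(3)[OF that] Ck_on_SucD[OF assms(1) Suc.prems that]] .
  show ?case
  proof (rule Ck_on_SucI[OF assms(1) d])
    fix v
    have 1: "Ck_on k S (\<lambda>x. inverse (f x))" by (rule Suc.IH[OF Ck_on_Suc_imp[OF Suc.prems]])
    have 2: "Ck_on k S (\<lambda>x. frechet_derivative f (at x) v)" using Suc.prems by simp
    show "Ck_on k S (\<lambda>x. - (inverse (f x) * frechet_derivative f (at x) v * inverse (f x)))"
      by (rule bounded_linear.Ck_on_comp[OF bounded_linear_minus[OF bounded_linear_ident] assms(1)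
            Ck_on_mult[OF assms(1) Ck_on_mult[OF assms(1) 1 2] 1]])
  qed
qed

lemma Ck_on_divide:
  fixes f g :: "'a::euclidean_space \<Rightarrow> real"
  assumes "open S" "Ck_on k S f" "Ck_on k S g" "\<And>x. x \<in> S \<Longrightarrow> g x \<noteq> 0"
  shows "Ck_on k S (\<lambda>x. f x / g x)"
  unfolding divide_inverse by (intro Ck_on_mult Ck_on_inverse assms)

lemma Ck_on_compose:
  fixes f :: "'a::euclidean_space \<Rightarrow> 'b::euclidean_space" and g :: "'b \<Rightarrow> 'c::real_normed_vector"
  assumes "open S" "open T" "f ` S \<subseteq> T" "Ck_on k S f" "Ck_on k T g"
  shows "Ck_on k S (\<lambda>x. g (f x))"
  using assms(4,5)
proof (induction k arbitrary: g)
  case 0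
  then show ?case using assms(3) continuous_on_compose2 by auto
next
  case (Suc k)
  define G where "G y = frechet_derivative g (at y)" for y
  define F where "F x = frechet_derivative f (at x)" for x
  have dg: "(g has_derivative G y) (at y)" if "y \<in> T" for y
    using Ck_on_SucD[OF assms(2) Suc.prems(2) that] by (simp add: G_def)
  have df: "(f has_derivative F x) (at x)" if "x \<in> S" for x
    using Ck_on_SucD[OF assms(1) Suc.prems(1) that] by (simp add: F_def)
  have d: "((\<lambda>x. g (f x)) has_derivative (\<lambda>v. G (f x) (F x v))) (at x)" if "x \<in> S" for x
    using has_derivative_compose[OF df[OF that] dg] assms(3) that by blast
  show ?case
  proof (rule Ck_on_SucI[OF assms(1) d])
    fix v
    \<comment> \<open>In the chain rule the direction \<open>F x v\<close> varies with
      \<open>x\<close>, whereas \<open>Ck_on\<close> controls derivatives in fixed directions only;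
      the basis expansion separates smooth coefficients from fixed-direction derivatives of
      \<open>g\<close>.\<close>
    have eq: "(\<Sum>b\<in>Basis. (F x v \<bullet> b) *\<^sub>R G (f x) b) = G (f x) (F x v)" if "x \<in> S" for x
    proof -
      interpret G: bounded_linear "G (f x)"
        using has_derivative_bounded_linear[OF dg] that assms(3) by blast
      show ?thesis
        by (subst (2) euclidean_representation[symmetric, of "F x v"]) (simp add: G.sum G.scaleR)
    qed
    have "Ck_on k S (\<lambda>x. \<Sum>b\<in>Basis. (F x v \<bullet> b) *\<^sub>R G (f x) b)"
      by (intro Ck_on_sum Ck_on_scaleR Ck_on_inner Ck_on_const assms(1) Suc.IH)
         (use Suc.prems Ck_on_Suc_imp in \<open>auto simp: F_def G_def\<close>)
    then show "Ck_on k S (\<lambda>x. G (f x) (F x v))"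
      by (rule Ck_on_cong[OF assms(1)]) (rule eq)
  qed
qed

lemma Ck_on_ln: "Ck_on k {0<..} (ln :: real \<Rightarrow> real)"
proof (cases k)
  case (Suc n)
  have "Ck_on n {0<..} (\<lambda>x::real. inverse x * v)" for v
    by (intro Ck_on_mult Ck_on_inverse Ck_on_id Ck_on_const) auto
  moreover have "(ln has_derivative (\<lambda>v. inverse x * v)) (at x)" if "x \<in> {0<..}" for x :: real
    using DERIV_ln[of x] that by (simp add: has_field_derivative_def)
  ultimately show ?thesis unfolding Suc by (intro Ck_on_SucI[where f'="\<lambda>x v. inverse x * v"]) auto
qed (auto intro: continuous_intros)

lemma smooth_onD: "smooth_on S f \<Longrightarrow> Ck_on k S f"
  by (simp add: smooth_on_def)

lemma smooth_on_imp_continuous_on: "smooth_on S f \<Longrightarrow> continuous_on S f"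
  using smooth_onD[of S f 0] by simp

lemma smooth_on_has_derivative:
  "smooth_on S f \<Longrightarrow> open S \<Longrightarrow> x \<in> S \<Longrightarrow> (f has_derivative frechet_derivative f (at x)) (at x)"
  using Ck_on_SucD smooth_onD by blast

lemma smooth_on_frechet_derivative:
  "smooth_on S f \<Longrightarrow> smooth_on S (\<lambda>x. frechet_derivative f (at x) v)"
  unfolding smooth_on_def by (metis Ck_on.simps(2))

lemma smooth_on_cong:
  "open S \<Longrightarrow> smooth_on S f \<Longrightarrow> (\<And>x. x \<in> S \<Longrightarrow> f x = g x) \<Longrightarrow> smooth_on S g"
  unfolding smooth_on_def using Ck_on_cong by blast

lemma smooth_on_subset: "smooth_on S f \<Longrightarrow> T \<subseteq> S \<Longrightarrow> smooth_on T f"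
  unfolding smooth_on_def using Ck_on_subset by blast

lemma smooth_on_local:
  "open S \<Longrightarrow> (\<And>x. x \<in> S \<Longrightarrow> \<exists>T. open T \<and> x \<in> T \<and> smooth_on T f) \<Longrightarrow> smooth_on S f"
  unfolding smooth_on_def by (meson Ck_on_local)

lemma smooth_on_const: "smooth_on S (\<lambda>x. c)"
  by (simp add: smooth_on_def Ck_on_const)

lemma smooth_on_id: "open S \<Longrightarrow> smooth_on S (\<lambda>x. x)"
  by (simp add: smooth_on_def Ck_on_id)

lemma smooth_on_add: "open S \<Longrightarrow> smooth_on S f \<Longrightarrow> smooth_on S g \<Longrightarrow> smooth_on S (\<lambda>x. f x + g x)"
  by (simp add: smooth_on_def Ck_on_add)

lemma smooth_on_sum: "open S \<Longrightarrow> (\<And>i. i \<in> I \<Longrightarrow> smooth_on S (f i)) \<Longrightarrow> smooth_on S (\<lambda>x. \<Sum>i\<in>I. f i x)"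
  by (simp add: smooth_on_def Ck_on_sum)

lemma smooth_on_linear:
  "bounded_linear L \<Longrightarrow> open S \<Longrightarrow> smooth_on S f \<Longrightarrow> smooth_on S (\<lambda>x. L (f x))"
  by (simp add: smooth_on_def bounded_linear.Ck_on_comp)

lemma smooth_on_mult:
  fixes f g :: "'a::euclidean_space \<Rightarrow> real"
  shows "open S \<Longrightarrow> smooth_on S f \<Longrightarrow> smooth_on S g \<Longrightarrow> smooth_on S (\<lambda>x. f x * g x)"
  by (simp add: smooth_on_def Ck_on_mult)

lemma smooth_on_scaleR:
  "open S \<Longrightarrow> smooth_on S f \<Longrightarrow> smooth_on S g \<Longrightarrow> smooth_on S (\<lambda>x. f x *\<^sub>R g x)"
  by (simp add: smooth_on_def Ck_on_scaleR)

lemma smooth_on_inner: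
  fixes f g :: "'a::euclidean_space \<Rightarrow> 'b::real_inner"
  shows "open S \<Longrightarrow> smooth_on S f \<Longrightarrow> smooth_on S g \<Longrightarrow> smooth_on S (\<lambda>x. f x \<bullet> g x)"
  by (simp add: smooth_on_def Ck_on_inner)

lemma smooth_on_prod:
  fixes f :: "'i \<Rightarrow> 'a::euclidean_space \<Rightarrow> real"
  shows "open S \<Longrightarrow> (\<And>i. i \<in> I \<Longrightarrow> smooth_on S (f i)) \<Longrightarrow> smooth_on S (\<lambda>x. \<Prod>i\<in>I. f i x)"
  by (simp add: smooth_on_def Ck_on_prod_fun)

lemma smooth_on_divide:
  fixes f g :: "'a::euclidean_space \<Rightarrow> real"
  shows "open S \<Longrightarrow> smooth_on S f \<Longrightarrow> smooth_on S g \<Longrightarrow> (\<And>x. x \<in> S \<Longrightarrow> g x \<noteq> 0) \<Longrightarrow> smooth_on S (\<lambda>x. f x / g x)"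
  by (simp add: smooth_on_def Ck_on_divide)

lemma smooth_on_compose:
  fixes f :: "'a::euclidean_space \<Rightarrow> 'b::euclidean_space"
  shows "open S \<Longrightarrow> open T \<Longrightarrow> f ` S \<subseteq> T \<Longrightarrow> smooth_on S f \<Longrightarrow> smooth_on T g \<Longrightarrow> smooth_on S (\<lambda>x. g (f x))"
  by (simp add: smooth_on_def Ck_on_compose)

lemma smooth_on_ln:
  fixes f :: "'a::euclidean_space \<Rightarrow> real"
  assumes "open S" "smooth_on S f" "\<And>x. x \<in> S \<Longrightarrow> f x > 0"
  shows "smooth_on S (\<lambda>x. ln (f x))"
  by (rule smooth_on_compose[where f=f and g=ln, OF assms(1) open_greaterThan[of 0]])
     (use assms in \<open>auto simp: smooth_on_def Ck_on_ln\<close>)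

text \<open>This class of functions is closed under differentiation, so smoothness at \<open>0\<close> follows for all
  \<open>q\<close> at once.\<close>

definition flat_exp :: "real poly \<Rightarrow> real \<Rightarrow> real" where
  "flat_exp q x = (if x > 0 then poly q (inverse x) * exp (- inverse x) else 0)"

lemma poly_exp_tendsto_0:
  fixes q :: "real poly"
  shows "((\<lambda>y. poly q y * exp (- y)) \<longlongrightarrow> 0) at_top"
proof -
  have "((\<lambda>y. \<Sum>i\<le>degree q. coeff q i * (y ^ i / exp y)) \<longlongrightarrow> (\<Sum>i\<le>degree q. coeff q i * 0)) at_top"
    by (intro tendsto_sum tendsto_mult tendsto_const tendsto_power_div_exp_0)
  then show ?thesis
    by (simp add: poly_altdef sum_distrib_right exp_minus divide_inverse mult.assoc)
qed

text \<open>For positive \<open>x\<close>, differentiating in the variable \<open>1 / x\<close>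
  gives \<open>q - pderiv q\<close>, and the inner derivative contributes the square of
  \<open>1 / x\<close>, hence the factor \<open>[:0, 0, 1:]\<close>. At 0 the exponential beats the
  extra power of \<open>1 / h\<close> in the difference quotient.\<close>

lemma flat_exp_has_real_derivative:
  "(flat_exp q has_real_derivative flat_exp ([:0, 0, 1:] * (q - pderiv q)) x) (at x)"
proof -
  define q' where "q' = [:0, 0, 1:] * (q - pderiv q)"
  consider "x > 0" | "x < 0" | "x = 0" by linarith
  then show ?thesis
  proof cases
    case 1
    have i: "(inverse has_real_derivative - (inverse x ^ 2)) (at x)"
      using DERIV_inverse[of x UNIV] 1 by (simp add: numeral_2_eq_2)
    have "((\<lambda>x. poly q (inverse x) * exp (- inverse x)) has_real_derivative
        (poly (pderiv q) (inverse x) * (- (inverse x ^ 2))) * exp (- inverse x)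
        + (exp (- inverse x) * - (- (inverse x ^ 2))) * poly q (inverse x)) (at x)"
      by (rule DERIV_mult[OF DERIV_chain2[OF poly_DERIV i] DERIV_chain2[OF DERIV_exp DERIV_minus[OF i]]])
    also have "(poly (pderiv q) (inverse x) * (- (inverse x ^ 2))) * exp (- inverse x)
        + (exp (- inverse x) * - (- (inverse x ^ 2))) * poly q (inverse x) = flat_exp q' x"
      using 1 by (simp add: flat_exp_def q'_def algebra_simps power2_eq_square)
    finally have "((\<lambda>x. poly q (inverse x) * exp (- inverse x)) has_real_derivative flat_exp q' x) (at x)" .
    then show ?thesis unfolding q'_def
      by (rule has_field_derivative_transform_within_open[where S="{0<..}"])
         (use 1 in \<open>auto simp: flat_exp_def\<close>)
  next
    case 2
    have "((\<lambda>x. 0) has_real_derivative flat_exp q' x) (at x)"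
      using 2 by (simp add: flat_exp_def)
    then show ?thesis unfolding q'_def
      by (rule has_field_derivative_transform_within_open[where S="{..<0}"])
         (use 2 in \<open>auto simp: flat_exp_def\<close>)
  next
    case 3
    have "((\<lambda>h. (flat_exp q (0 + h) - flat_exp q 0) / h) \<longlongrightarrow> 0) (at 0)"
    proof (rule filterlim_split_at)
      show "((\<lambda>h. (flat_exp q (0 + h) - flat_exp q 0) / h) \<longlongrightarrow> 0) (at_left 0)"
        by (rule tendsto_eventually, rule eventually_at_leftI[of "-1"]) (auto simp: flat_exp_def)
      have "((\<lambda>h. poly ([:0, 1:] * q) (inverse h) * exp (- inverse h)) \<longlongrightarrow> 0) (at_right (0::real))"
        by (rule filterlim_compose[OF poly_exp_tendsto_0 filterlim_inverse_at_top_right])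
      then show "((\<lambda>h. (flat_exp q (0 + h) - flat_exp q 0) / h) \<longlongrightarrow> 0) (at_right 0)"
        by (rule Lim_transform_eventually)
           (rule eventually_at_rightI[of 0 1], auto simp: flat_exp_def field_simps)
    qed
    moreover have "flat_exp q' x = 0" using 3 by (simp add: flat_exp_def)
    ultimately show ?thesis using 3 unfolding q'_def DERIV_def by simp
  qed
qed

lemma smooth_on_flat_exp: "smooth_on UNIV (flat_exp q)"
  unfolding smooth_on_def
proof
  fix k show "Ck_on k UNIV (flat_exp q)"
  proof (induction k arbitrary: q)
    case 0
    then show ?case
      using DERIV_isCont[OF flat_exp_has_real_derivative] by (simp add: continuous_at_imp_continuous_on)
  next
    case (Suc k)
    show ?case
      by (rule Ck_on_SucI[OF open_UNIV flat_exp_has_real_derivative[unfolded has_field_derivative_def]])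
         (intro Ck_on_mult Suc Ck_on_const open_UNIV)
  qed
qed

definition bump :: "real \<Rightarrow> real" where "bump = flat_exp 1"

lemma bump_pos_iff: "bump x > 0 \<longleftrightarrow> x > 0" and bump_nonneg: "bump x \<ge> 0" and bump_eq_0: "x \<le> 0 \<Longrightarrow> bump x = 0"
  by (auto simp: bump_def flat_exp_def)

lemma smooth_on_bump:
  assumes "open S" "smooth_on S f"
  shows "smooth_on S (\<lambda>x. bump (f x))"
  unfolding bump_def by (rule smooth_on_compose[where f=f and g="flat_exp 1", OF assms(1) open_UNIV _ assms(2) smooth_on_flat_exp]) auto

text \<open>The quotient \<open>a / (a + b)\<close> of two bumps, one positive inside radius
  \<open>2 * R\<close>, the other outside radius \<open>R\<close>. Their positivity sets cover the
  space, so the denominator never vanishes; squared norms keep the arguments smooth at the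
  origin.\<close>

lemma smooth_cutoff:
  fixes R :: real
  assumes "R > 0"
  obtains cutoff :: "'a::euclidean_space \<Rightarrow> real"
  where "smooth_on UNIV cutoff" "\<And>x. norm x \<le> R \<Longrightarrow> cutoff x = 1" "\<And>x. norm x \<ge> 2 * R \<Longrightarrow> cutoff x = 0"
proof
  define a b where "a x = bump ((2 * R)\<^sup>2 + (-1) * (x \<bullet> x))" and "b x = bump (x \<bullet> x + - R\<^sup>2)" for x :: 'a
  have pos: "a x + b x > 0" for x
  proof (cases "x \<bullet> x > R\<^sup>2")
    case True
    then have "b x > 0" by (simp add: b_def bump_pos_iff)
    then show ?thesis using bump_nonneg by (simp add: a_def add_nonneg_pos)
  next
    case False
    moreover have "(2 * R)\<^sup>2 > R\<^sup>2" using assms by (simp add: power2_eq_square)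
    ultimately have "x \<bullet> x < (2 * R)\<^sup>2" by linarith
    then have "a x > 0" by (simp add: a_def bump_pos_iff)
    then show ?thesis using bump_nonneg by (simp add: b_def add_pos_nonneg)
  qed
  have sa: "smooth_on UNIV a" and sb: "smooth_on UNIV b"
    unfolding a_def[abs_def] b_def[abs_def]
    by (rule smooth_on_bump[OF open_UNIV smooth_on_add[OF open_UNIV smooth_on_const smooth_on_mult[OF open_UNIV smooth_on_const
          smooth_on_inner[OF open_UNIV smooth_on_id[OF open_UNIV] smooth_on_id[OF open_UNIV]]]]],
        rule smooth_on_bump[OF open_UNIV smooth_on_add[OF open_UNIV 
          smooth_on_inner[OF open_UNIV smooth_on_id[OF open_UNIV] smooth_on_id[OF open_UNIV]] smooth_on_const]])
  show "smooth_on UNIV (\<lambda>x. a x / (a x + b x))"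
    by (intro smooth_on_divide smooth_on_add sa sb open_UNIV) (use pos in \<open>simp add: less_imp_neq[symmetric]\<close>)
  show "a x / (a x + b x) = 1" if "norm x \<le> R" for x
  proof -
    have "x \<bullet> x \<le> R\<^sup>2" using that by (simp add: power2_norm_eq_inner[symmetric] power_mono)
    then have "b x = 0" by (simp add: b_def bump_eq_0)
    then show ?thesis using pos[of x] by simp
  qed
  show "a x / (a x + b x) = 0" if "norm x \<ge> 2 * R" for x
  proof -
    have "(2 * R)\<^sup>2 \<le> x \<bullet> x"
      unfolding power2_norm_eq_inner[symmetric] by (rule power_mono) (use that assms in auto)
    then show ?thesis by (simp add: a_def bump_eq_0)
  qed
qed

section \<open>Charts of an embedded submanifold\<close>

lemma smooth_on_vec:
  fixes f :: "'a::euclidean_space \<Rightarrow> real^'n"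
  assumes "open S" "\<And>k. smooth_on S (\<lambda>x. f x $ k)"
  shows "smooth_on S f"
proof -
  have "smooth_on S (\<lambda>x. \<Sum>k\<in>UNIV. (f x $ k) *\<^sub>R axis k (1::real))"
    by (intro smooth_on_sum smooth_on_scaleR smooth_on_const assms)
  moreover have "(\<lambda>x. \<Sum>k\<in>UNIV. (f x $ k) *\<^sub>R axis k 1) = f"
    by (simp only: scalar_mult_eq_scaleR[symmetric] basis_expansion)
  ultimately show ?thesis by simp
qed

lemma smooth_on_vec_nth:
  "open S \<Longrightarrow> smooth_on S f \<Longrightarrow> smooth_on S (\<lambda>x. (f x :: real^'n) $ k)"
  by (rule smooth_on_linear[OF bounded_linear_vec_nth])

lemma smooth_on_det:
  fixes A :: "'a::euclidean_space \<Rightarrow> real^'n^'n"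
  assumes "open S" "\<And>i j. smooth_on S (\<lambda>x. A x $ i $ j)"
  shows "smooth_on S (\<lambda>x. det (A x))"
  unfolding det_def by (intro smooth_on_sum smooth_on_mult smooth_on_const smooth_on_prod assms)

lemma smooth_on_frechet_derivative_apply:
  fixes f :: "'a::euclidean_space \<Rightarrow> 'b::real_normed_vector"
  assumes "open S" "smooth_on S f" "smooth_on S w"
  shows "smooth_on S (\<lambda>x. frechet_derivative f (at x) (w x))"
proof -
  have eq: "(\<Sum>b\<in>Basis. (w x \<bullet> b) *\<^sub>R frechet_derivative f (at x) b) = frechet_derivative f (at x) (w x)" if "x \<in> S" for x
  proof -
    interpret G: bounded_linear "frechet_derivative f (at x)"
      using has_derivative_bounded_linear[OF smooth_on_has_derivative[OF assms(2,1) that]] .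
    show ?thesis
      by (subst (2) euclidean_representation[symmetric, of "w x"]) (simp add: G.sum G.scaleR)
  qed
  have "smooth_on S (\<lambda>x. \<Sum>b\<in>Basis. (w x \<bullet> b) *\<^sub>R frechet_derivative f (at x) b)"
    by (intro smooth_on_sum smooth_on_scaleR smooth_on_inner smooth_on_const smooth_on_frechet_derivative assms)
  then show ?thesis by (rule smooth_on_cong[OF assms(1)]) (rule eq)
qed

locale chart =
  fixes M :: "(real^'d) set" and U :: "(real^'m) set" and \<psi> :: "real^'m \<Rightarrow> real^'d"
  assumes lp: "local_param M U \<psi>"
begin

abbreviation J :: "real^'m \<Rightarrow> real^'m \<Rightarrow> real^'d" where "J u \<equiv> frechet_derivative \<psi> (at u)"

text \<open>Cramer's rule for \<open>(J\<^sup>T J) w = J\<^sup>T b\<close>, a form in which smoothness in \<open>u\<close> is visible; \<open>J \<circ> pinv\<close> is the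
  orthogonal projection onto the range of \<open>J\<close>.\<close>

definition pinv :: "real^'m \<Rightarrow> real^'d \<Rightarrow> real^'m" where
  "pinv u b = (\<chi> k. det (\<chi> i j. if j = k then J u (axis i 1) \<bullet> b else gram_matrix \<psi> u $ i $ j)
                 / det (gram_matrix \<psi> u))"

lemma open_U: "open U" and smooth_psi: "smooth_on U \<psi>" and openin_image: "openin (top_of_set M) (\<psi> ` U)"
  and inj_J: "u \<in> U \<Longrightarrow> inj (J u)"
  using lp by (auto simp: local_param_def)

lemma image_subset: "\<psi> ` U \<subseteq> M"
  using openin_image by (auto simp: openin_subtopology)

lemma psi_in_M: "u \<in> U \<Longrightarrow> \<psi> u \<in> M"
  using image_subset by blast

lemma psi_deriv: "u \<in> U \<Longrightarrow> (\<psi> has_derivative J u) (at u)"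
  by (rule smooth_on_has_derivative[OF smooth_psi open_U])

lemma bounded_linear_J: "u \<in> U \<Longrightarrow> bounded_linear (J u)"
  using has_derivative_bounded_linear psi_deriv by blast

lemma linear_J: "u \<in> U \<Longrightarrow> linear (J u)"
  using bounded_linear_J bounded_linear.linear by blast

lemma J_expand: "u \<in> U \<Longrightarrow> J u w = (\<Sum>k\<in>UNIV. (w $ k) *\<^sub>R J u (axis k 1))"
  using linear_J[of u]
  by (subst basis_expansion[of w, symmetric])
     (simp add: linear_sum scalar_mult_eq_scaleR linear_cmul[OF linear_J])

lemma gram_mult_nth: "u \<in> U \<Longrightarrow> (gram_matrix \<psi> u *v w) $ i = J u (axis i 1) \<bullet> J u w"
  by (subst J_expand[of u w])
     (auto simp: matrix_vector_mult_def gram_matrix_def inner_sum_right mult.commute)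

lemma inner_gram: "u \<in> U \<Longrightarrow> w \<bullet> (gram_matrix \<psi> u *v w') = J u w \<bullet> J u w'"
  by (subst J_expand[of u w]) (auto simp: inner_vec_def[of w] gram_mult_nth inner_sum_left)

lemma J_eq_0_iff: "u \<in> U \<Longrightarrow> J u w = 0 \<longleftrightarrow> w = 0"
  using inj_J[of u] linear_J[of u] linear_0[OF linear_J[of u]] by (metis injD)

lemma gram_mult_cancel:
  assumes "u \<in> U" "gram_matrix \<psi> u *v w = gram_matrix \<psi> u *v w'"
  shows "w = w'"
proof -
  have "gram_matrix \<psi> u *v (w - w') = 0" using assms(2) by (simp add: matrix_vector_mult_diff_distrib)
  then have "J u (w - w') \<bullet> J u (w - w') = 0" using inner_gram[OF assms(1), of "w - w'" "w - w'"] by simp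
  then show ?thesis using J_eq_0_iff[OF assms(1)] by simp
qed

text \<open>The segment from the identity to the Gram matrix consists of positive definite, hence
  invertible, matrices, so the determinant keeps the sign it has at the identity.\<close>

lemma det_gram_pos:
  assumes u: "u \<in> U"
  shows "det (gram_matrix \<psi> u) > 0"
proof -
  define A where "A t = (\<chi> i j. t * gram_matrix \<psi> u $ i $ j + (1 - t) * mat 1 $ i $ j)" for t :: real
  have mult: "A t *v w = t *\<^sub>R (gram_matrix \<psi> u *v w) + (1 - t) *\<^sub>R w" for t w
  proof -
    have "A t = t *\<^sub>R gram_matrix \<psi> u + (1 - t) *\<^sub>R mat 1" by (simp add: A_def vec_eq_iff)
    then show ?thesis
      by (simp add: matrix_vector_mult_add_rdistrib scaleR_matrix_vector_assoc[symmetric])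
  qed
  have ne: "det (A t) \<noteq> 0" if "0 \<le> t" "t \<le> 1" for t
  proof -
    have "w = 0" if "A t *v w = 0" for w
    proof -
      have "0 = w \<bullet> (A t *v w)" using that by simp
      also have "\<dots> = t * (norm (J u w))\<^sup>2 + (1 - t) * (norm w)\<^sup>2"
        by (simp add: mult inner_add_right inner_gram[OF u] power2_norm_eq_inner)
      finally have s: "t * (norm (J u w))\<^sup>2 + (1 - t) * (norm w)\<^sup>2 = 0" by simp
      have nn: "t * (norm (J u w))\<^sup>2 \<ge> 0" "(1 - t) * (norm w)\<^sup>2 \<ge> 0" using \<open>0 \<le> t\<close> \<open>t \<le> 1\<close> by auto
      then have "t * (norm (J u w))\<^sup>2 = 0" "(1 - t) * (norm w)\<^sup>2 = 0" using s by linarith+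
      then show ?thesis using J_eq_0_iff[OF u, of w] by (cases "t = 1") auto
    qed
    then show ?thesis
      unfolding invertible_det_nz[symmetric] invertible_left_inverse matrix_left_invertible_ker by blast
  qed
  have cont: "continuous_on {0..1} (\<lambda>t. det (A t))"
    unfolding det_def A_def by (intro continuous_intros)
  have "A 0 = mat 1" "A 1 = gram_matrix \<psi> u" by (auto simp: A_def vec_eq_iff)
  then have "det (A 0) = 1" "det (A 1) = det (gram_matrix \<psi> u)" by (auto simp: det_I)
  moreover have "\<not> det (A 1) \<le> 0"
    using IVT2'[of "\<lambda>t. det (A t)" 1 0 0] ne cont calculation(1) by auto
  ultimately show ?thesis by simp
qed

lemma gram_pinv: "u \<in> U \<Longrightarrow> gram_matrix \<psi> u *v pinv u b = (\<chi> i. J u (axis i 1) \<bullet> b)"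
  using det_gram_pos[of u]
  by (subst cramer) (auto simp: pinv_def vec_eq_iff intro!: arg_cong[where f=det] arg_cong[where f="\<lambda>x. x / _"])

lemma pinv_eqI:
  assumes "u \<in> U" "\<And>i. J u (axis i 1) \<bullet> J u w = J u (axis i 1) \<bullet> b"
  shows "pinv u b = w"
  by (rule gram_mult_cancel[OF assms(1)]) (simp add: vec_eq_iff gram_pinv assms gram_mult_nth)

text \<open>These are the normal equations: \<open>gram_pinv\<close> paired with \<open>w\<close>
  says that \<open>b - J u (pinv u b)\<close> is orthogonal to the range of
  \<open>J u\<close>.\<close>

lemma J_inner_proj: "u \<in> U \<Longrightarrow> J u w \<bullet> J u (pinv u b) = J u w \<bullet> b"
  using inner_gram[of u w "pinv u b"]
  by (subst (3) J_expand) (auto simp: gram_pinv inner_vec_def[of w] inner_sum_left)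

lemma pinv_J: "u \<in> U \<Longrightarrow> pinv u (J u w) = w"
  by (rule pinv_eqI) auto

lemma linear_pinv: "u \<in> U \<Longrightarrow> linear (pinv u)"
  by (rule linearI; rule pinv_eqI)
     (auto simp: linear_add[OF linear_J] linear_cmul[OF linear_J] inner_add_right J_inner_proj)

lemma bounded_linear_pinv: "u \<in> U \<Longrightarrow> bounded_linear (pinv u)"
  using linear_pinv linear_conv_bounded_linear by blast

lemma smooth_gram: "smooth_on U (\<lambda>u. gram_matrix \<psi> u $ i $ j)"
  unfolding gram_matrix_def
  by (simp, intro smooth_on_inner smooth_on_frechet_derivative open_U smooth_psi)

lemma smooth_pinv:
  assumes "smooth_on U b"
  shows "smooth_on U (\<lambda>u. pinv u (b u))"
proof (rule smooth_on_vec[OF open_U])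
  fix k
  have 2: "smooth_on U (\<lambda>u. J u (axis i 1) \<bullet> b u)" for i
    by (intro smooth_on_inner smooth_on_frechet_derivative open_U smooth_psi assms)
  show "smooth_on U (\<lambda>u. pinv u (b u) $ k)"
    unfolding pinv_def vec_lambda_beta
  proof (intro smooth_on_divide smooth_on_det open_U smooth_gram)
    show "smooth_on U (\<lambda>x. (\<chi> i j. if j = k then J x (axis i 1) \<bullet> b x else gram_matrix \<psi> x $ i $ j) $ i $ j)" for i j
      using smooth_gram 2 by (cases "j = k") simp_all
  qed (use det_gram_pos in force)
qed

lemma smooth_J: "smooth_on U w \<Longrightarrow> smooth_on U (\<lambda>u. J u (w u))"
  by (rule smooth_on_frechet_derivative_apply[OF open_U smooth_psi])

lemma at_within_image: "u \<in> U \<Longrightarrow> at (\<psi> u) within M = at (\<psi> u) within (\<psi> ` U)"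
proof -
  assume u: "u \<in> U"
  obtain T where "open T" "\<psi> ` U = T \<inter> M" using openin_image by (auto simp: openin_subtopology)
  then show ?thesis using u by (intro at_within_nhd[of _ T]) auto
qed

text \<open>\<open>homeomorphism\<close> provides only continuity of the inverse chart. Since
  \<open>pinv u\<close> is a left inverse of \<open>J u\<close>, applying it to the first order
  expansion of \<open>\<psi>\<close> recovers the increment of \<open>\<phi>\<close> up to a small
  error.\<close>

lemma inverse_has_derivative:
  assumes hom: "homeomorphism U (\<psi> ` U) \<psi> \<phi>" and u: "u \<in> U"
  shows "(\<phi> has_derivative pinv u) (at (\<psi> u) within M)"
proof -
  have \<phi>\<psi>: "\<phi> (\<psi> x) = x" if "x \<in> U" for x using hom that by (auto simp: homeomorphism_def)
  obtain N where N: "N > 0" "\<And>b. norm (pinv u b) \<le> norm b * N"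
    using bounded_linear.pos_bounded[OF bounded_linear_pinv[OF u]] by blast
  have "\<forall>\<^sub>F y in at (\<psi> u) within \<psi> ` U. norm (\<phi> y - \<phi> (\<psi> u) - pinv u (y - \<psi> u)) \<le> e * norm (y - \<psi> u)" if e: "e > 0" for e
  proof -
    \<comment> \<open>The bound \<open>\<epsilon> * N \<le> 1 / 2\<close> lets the error be
      absorbed, giving \<open>norm (u' - u) \<le> 2 * N * norm (y - \<psi> u)\<close>; the second
      bound then turns the error into \<open>e * norm (y - \<psi> u)\<close>.\<close>
    define \<epsilon> where "\<epsilon> = min (1 / (2 * N)) (e / (2 * N * N))"
    have eps: "\<epsilon> > 0" "\<epsilon> * N \<le> 1 / 2" "\<epsilon> * N * (2 * N) \<le> e"
      using e N(1) by (auto simp: \<epsilon>_def field_simps min_def)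
    obtain \<delta> where d: "\<delta> > 0" "\<And>u'. norm (u' - u) < \<delta> \<Longrightarrow> norm (\<psi> u' - \<psi> u - J u (u' - u)) \<le> \<epsilon> * norm (u' - u)"
      using psi_deriv[OF u] eps(1) unfolding has_derivative_at_alt by blast
    have "continuous_on (\<psi> ` U) \<phi>" using hom by (simp add: homeomorphism_def)
    then have "(\<phi> \<longlongrightarrow> \<phi> (\<psi> u)) (at (\<psi> u) within \<psi> ` U)" using u by (auto simp: continuous_on_def)
    then have "\<forall>\<^sub>F y in at (\<psi> u) within \<psi> ` U. dist (\<phi> y) (\<phi> (\<psi> u)) < \<delta>" using d(1) by (rule tendstoD)
    moreover have "\<forall>\<^sub>F y in at (\<psi> u) within \<psi> ` U. y \<in> \<psi> ` U" by (simp add: eventually_at_filter)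
    ultimately show ?thesis
    proof eventually_elim
      case (elim y)
      then obtain u' where u': "u' \<in> U" "y = \<psi> u'" by blast
      then have "norm (u' - u) < \<delta>" using elim \<phi>\<psi> u by (simp add: dist_norm)
      then have "norm (\<psi> u' - \<psi> u - J u (u' - u)) \<le> \<epsilon> * norm (u' - u)" by (rule d)
      moreover have "pinv u (\<psi> u' - \<psi> u - J u (u' - u)) = pinv u (y - \<psi> u) - (u' - u)"
        using u' by (simp add: linear_diff[OF linear_pinv[OF u]] pinv_J[OF u])
      ultimately have A: "norm (pinv u (y - \<psi> u) - (u' - u)) \<le> \<epsilon> * norm (u' - u) * N"
        using N(2)[of "\<psi> u' - \<psi> u - J u (u' - u)"] N(1)
        by (smt (verit) mult_right_mono)
      also have "\<dots> = (\<epsilon> * N) * norm (u' - u)" by simp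
      also have "\<dots> \<le> norm (u' - u) / 2" using mult_right_mono[OF eps(2), of "norm (u' - u)"] by simp
      finally have "norm (u' - u) \<le> 2 * norm (pinv u (y - \<psi> u))"
        using norm_triangle_ineq2[of "u' - u" "pinv u (y - \<psi> u)"] by (simp add: norm_minus_commute)
      also have "\<dots> \<le> 2 * N * norm (y - \<psi> u)" using N(2)[of "y - \<psi> u"] by (simp add: mult.commute mult.left_commute)
      finally have "(\<epsilon> * N) * norm (u' - u) \<le> (\<epsilon> * N) * (2 * N * norm (y - \<psi> u))"
        using eps(1) N(1) by (intro mult_left_mono) auto
      also have "\<dots> \<le> e * norm (y - \<psi> u)" using mult_right_mono[OF eps(3), of "norm (y - \<psi> u)"] by (simp add: ac_simps)
      finally have "norm (pinv u (y - \<psi> u) - (u' - u)) \<le> e * norm (y - \<psi> u)" using A by (simp add: ac_simps)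
      then show ?case using u' u \<phi>\<psi> by (simp add: norm_minus_commute)
    qed
  qed
  then show ?thesis
    unfolding at_within_image[OF u] has_derivative_within_alt2 using bounded_linear_pinv[OF u] by blast
qed

text \<open>The chain rule through the inverse chart. The result is one admissible derivative within
  \<open>M\<close>, namely the one that vanishes on normal vectors; only its values on tangent
  vectors are determined.\<close>

lemma push_derivative:
  assumes u: "u \<in> U" and D: "((\<lambda>u. f (\<psi> u)) has_derivative D) (at u)"
  shows "(f has_derivative (\<lambda>b. D (pinv u b))) (at (\<psi> u) within M)"
proof -
  obtain \<phi> where hom: "homeomorphism U (\<psi> ` U) \<psi> \<phi>" using lp by (auto simp: local_param_def)
  then have inv: "\<phi> (\<psi> x) = x" if "x \<in> U" for x using that by (auto simp: homeomorphism_def)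
  have "((\<lambda>y. f (\<psi> (\<phi> y))) has_derivative (\<lambda>b. D (pinv u b))) (at (\<psi> u) within \<psi> ` U)"
    by (rule has_derivative_compose[OF inverse_has_derivative[OF hom u, unfolded at_within_image[OF u]]])
       (use D u inv in simp)
  then show ?thesis unfolding at_within_image[OF u]
    by (rule has_derivative_transform[rotated 2]) (use u inv in auto)
qed

lemma pull_derivative:
  assumes u: "u \<in> U" and L: "(f has_derivative L) (at (\<psi> u) within M)"
  shows "((\<lambda>u. f (\<psi> u)) has_derivative (\<lambda>w. L (J u w))) (at u)"
proof -
  have "((\<lambda>u. f (\<psi> u)) has_derivative (\<lambda>w. L (J u w))) (at u within U)"
    by (rule has_derivative_in_compose[OF has_derivative_at_withinI[OF psi_deriv[OF u]]])
       (use L at_within_image[OF u] in simp)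
  then show ?thesis using at_within_open[OF u open_U] by simp
qed

text \<open>Images of straight lines in the chart realize every vector of the range. Conversely the
  identity has derivative \<open>J u \<circ> pinv u\<close> within \<open>M\<close>, so the velocity
  of any curve in \<open>M\<close> is fixed by this projection.\<close>

lemma tangent_space_eq:
  assumes u: "u \<in> U"
  shows "tangent_space M (\<psi> u) = range (J u)"
proof (intro equalityI subsetI)
  fix v assume "v \<in> range (J u)"
  then obtain w where w: "v = J u w" by blast
  obtain r where r: "r > 0" "ball u r \<subseteq> U" using open_U u open_contains_ball by blast
  define \<epsilon> where "\<epsilon> = r / (norm w + 1)"
  have "norm w + 1 > 0" by (simp add: add_nonneg_pos)
  then have eps: "\<epsilon> > 0" using r by (simp add: \<epsilon>_def)
  have sub: "(\<lambda>s. u + s *\<^sub>R w) ` {-\<epsilon><..<\<epsilon>} \<subseteq> U"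
  proof (clarify)
    fix s assume "s \<in> {-\<epsilon><..<\<epsilon>}"
    then have "\<bar>s\<bar> < \<epsilon>" by auto
    have "\<bar>s\<bar> * norm w \<le> \<bar>s\<bar> * (norm w + 1)" by (simp add: mult_left_mono)
    also have "\<dots> < \<epsilon> * (norm w + 1)" using \<open>\<bar>s\<bar> < \<epsilon>\<close> \<open>norm w + 1 > 0\<close> by simp
    also have "\<dots> = r" using \<open>norm w + 1 > 0\<close> by (simp add: \<epsilon>_def)
    finally show "u + s *\<^sub>R w \<in> U" using r(2) by (auto simp: dist_norm)
  qed
  have "smooth_on {-\<epsilon><..<\<epsilon>} (\<lambda>s. \<psi> (u + s *\<^sub>R w))"
    by (rule smooth_on_compose[OF _ open_U sub _ smooth_psi])
       (auto intro!: smooth_on_add smooth_on_scaleR smooth_on_const smooth_on_id)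
  moreover have "((\<lambda>s. \<psi> (u + s *\<^sub>R w)) has_vector_derivative v) (at 0)"
  proof -
    have "((\<lambda>s. u + s *\<^sub>R w) has_derivative (\<lambda>s. s *\<^sub>R w)) (at 0)"
      by (auto intro!: derivative_eq_intros)
    from has_derivative_compose[OF this, of \<psi> "J u"] psi_deriv[OF u]
    show ?thesis by (simp add: has_vector_derivative_def w linear_cmul[OF linear_J[OF u]])
  qed
  moreover have "(\<lambda>s. \<psi> (u + s *\<^sub>R w)) ` {-\<epsilon><..<\<epsilon>} \<subseteq> M" using sub psi_in_M by blast
  ultimately show "v \<in> tangent_space M (\<psi> u)"
    unfolding tangent_space_def using eps by (auto intro!: exI[of _ "\<lambda>s. \<psi> (u + s *\<^sub>R w)"] exI[of _ \<epsilon>])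
next
  fix v assume "v \<in> tangent_space M (\<psi> u)"
  then obtain \<gamma> \<epsilon> where g: "\<epsilon> > 0" "\<gamma> ` {-\<epsilon><..<\<epsilon>} \<subseteq> M" "\<gamma> 0 = \<psi> u" "(\<gamma> has_vector_derivative v) (at 0)"
    unfolding tangent_space_def by blast
  have "((\<lambda>u. (\<lambda>x. x) (\<psi> u)) has_derivative J u) (at u)" using psi_deriv[OF u] by simp
  from push_derivative[OF u this]
  have "((\<lambda>x. x) has_derivative (\<lambda>b. J u (pinv u b))) (at (\<gamma> 0) within \<gamma> ` {-\<epsilon><..<\<epsilon>})"
    using g(2,3) has_derivative_subset by metis
  moreover have "(\<gamma> has_derivative (\<lambda>s. s *\<^sub>R v)) (at 0 within {-\<epsilon><..<\<epsilon>})"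
    using g(4) has_derivative_at_withinI by (auto simp: has_vector_derivative_def)
  ultimately have "((\<lambda>s. \<gamma> s) has_derivative (\<lambda>s. J u (pinv u (s *\<^sub>R v)))) (at 0 within {-\<epsilon><..<\<epsilon>})"
    by (rule has_derivative_in_compose[rotated])
  then have "(\<gamma> has_derivative (\<lambda>s. J u (pinv u (s *\<^sub>R v)))) (at 0)"
    using at_within_open[of 0 "{-\<epsilon><..<\<epsilon>}"] g(1) by auto
  from has_derivative_unique[OF this g(4)[unfolded has_vector_derivative_def]]
  have "J u (pinv u (1 *\<^sub>R v)) = 1 *\<^sub>R v" by metis
  then show "v \<in> range (J u)" by (metis rangeI scaleR_one)
qed

lemma tangent_part_eq:
  assumes u: "u \<in> U"
  shows "tangent_part M (\<psi> u) b = J u (pinv u b)"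
proof -
  have sub: "subspace (range (J u))" using linear_subspace_image[OF linear_J[OF u] subspace_UNIV] .
  have "J u (pinv u b) = closest_point (range (J u)) b"
  proof (rule closest_point_unique[OF subspace_imp_convex[OF sub] closed_subspace[OF sub]])
    show "J u (pinv u b) \<in> range (J u)" by simp
    show "\<forall>z\<in>range (J u). dist b (J u (pinv u b)) \<le> dist b z"
    proof clarify
      fix w
      have d: "J u (pinv u b) - J u w = J u (pinv u b - w)" by (simp add: linear_diff[OF linear_J[OF u]])
      have "orthogonal (b - J u (pinv u b)) (J u (pinv u b) - J u w)"
        unfolding d orthogonal_def using J_inner_proj[OF u, of "pinv u b - w" b]
        by (simp add: inner_diff_right inner_commute[of _ "J u (pinv u b - w)"])
      from norm_add_Pythagorean[OF this]
      have "(norm (b - J u w))\<^sup>2 = (norm (b - J u (pinv u b)))\<^sup>2 + (norm (J u (pinv u b) - J u w))\<^sup>2" by simp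
      then have "(norm (b - J u (pinv u b)))\<^sup>2 \<le> (norm (b - J u w))\<^sup>2" by simp
      then show "dist b (J u (pinv u b)) \<le> dist b (J u w)" unfolding dist_norm by (rule power2_le_imp_le) simp
    qed
  qed
  then show ?thesis by (simp add: tangent_part_def tangent_space_eq[OF u])
qed

text \<open>The vector representing the functional \<open>Df \<circ> pinv u\<close> in the ambient
  inner product: the Riemannian gradient, in a form whose smoothness in \<open>u\<close> is
  visible.\<close>

definition cgrad :: "(real^'m \<Rightarrow> real) \<Rightarrow> real^'m \<Rightarrow> real^'d" where
  "cgrad f u = (\<Sum>b\<in>Basis. frechet_derivative f (at u) (pinv u b) *\<^sub>R b)"

lemma cgrad_inner:
  assumes u: "u \<in> U" and f: "smooth_on U f"
  shows "cgrad f u \<bullet> x = frechet_derivative f (at u) (pinv u x)"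
proof -
  interpret L: bounded_linear "\<lambda>x. frechet_derivative f (at u) (pinv u x)"
    using bounded_linear_compose[OF has_derivative_bounded_linear[OF smooth_on_has_derivative[OF f open_U u]] bounded_linear_pinv[OF u]] .
  show ?thesis
    by (subst (2) euclidean_representation[symmetric, of x])
       (simp add: cgrad_def inner_sum_left L.sum L.scaleR inner_commute[of x] mult.commute)
qed

lemma cgrad_inner_J: "u \<in> U \<Longrightarrow> smooth_on U f \<Longrightarrow> cgrad f u \<bullet> J u w = frechet_derivative f (at u) w"
  by (simp add: cgrad_inner pinv_J)

lemma cgrad_tangential: 
  assumes u: "u \<in> U" and f: "smooth_on U f"
  shows "J u (pinv u (cgrad f u)) = cgrad f u"
proof -
  have "x \<bullet> J u (pinv u (cgrad f u)) = x \<bullet> cgrad f u" for x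
  proof -
    have "x \<bullet> J u (pinv u (cgrad f u)) = J u (pinv u x) \<bullet> J u (pinv u (cgrad f u))"
      using J_inner_proj[OF u, of "pinv u (cgrad f u)" x] by (simp add: inner_commute)
    also have "\<dots> = cgrad f u \<bullet> J u (pinv u x)" using J_inner_proj[OF u] by (simp add: inner_commute)
    also have "\<dots> = x \<bullet> cgrad f u" by (simp add: inner_commute[of x] pinv_J[OF u] cgrad_inner[OF u f])
    finally show ?thesis .
  qed
  then show ?thesis using vector_eq_rdot by (metis inner_commute)
qed

lemma grad_on_eq:
  assumes u: "u \<in> U" and f: "smooth_on U (\<lambda>u. f (\<psi> u))"
  shows "grad_on M f (\<psi> u) = cgrad (\<lambda>u. f (\<psi> u)) u"
  unfolding grad_on_def
proof (rule the_equality)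
  let ?c = "cgrad (\<lambda>u. f (\<psi> u)) u"
  have "(f has_derivative (\<lambda>w. ?c \<bullet> w)) (at (\<psi> u) within M)"
    using push_derivative[OF u smooth_on_has_derivative[OF f open_U u]] by (simp add: cgrad_inner[OF u f])
  then show "?c \<in> tangent_space M (\<psi> u) \<and> (f has_derivative (\<lambda>w. ?c \<bullet> w)) (at (\<psi> u) within M)"
    using cgrad_tangential[OF u f] by (auto simp: tangent_space_eq[OF u]) (metis rangeI)
next
  let ?c = "cgrad (\<lambda>u. f (\<psi> u)) u"
  fix v assume v: "v \<in> tangent_space M (\<psi> u) \<and> (f has_derivative (\<lambda>w. v \<bullet> w)) (at (\<psi> u) within M)"
  then obtain a where a: "v = J u a" by (auto simp: tangent_space_eq[OF u])
  have "(\<lambda>w. v \<bullet> J u w) = frechet_derivative (\<lambda>u. f (\<psi> u)) (at u)"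
    using has_derivative_unique[OF pull_derivative[OF u] smooth_on_has_derivative[OF f open_U u]] v by blast
  then have eq: "v \<bullet> J u w = ?c \<bullet> J u w" for w using cgrad_inner_J[OF u f] by metis
  \<comment> \<open>The difference of two candidates is tangential and orthogonal to all tangent
    vectors, hence orthogonal to itself.\<close>
  define k where "k = a - pinv u ?c"
  have vk: "v - ?c = J u k" using a cgrad_tangential[OF u f] by (simp add: k_def linear_diff[OF linear_J[OF u]])
  have "(v - ?c) \<bullet> J u k = 0" using eq[of k] unfolding inner_diff_left by simp
  then have "(v - ?c) \<bullet> (v - ?c) = 0" unfolding vk .
  then show "v = ?c" by simp
qed

lemma smooth_cgrad:
  assumes "smooth_on U f"
  shows "smooth_on U (cgrad f)"
  unfolding cgrad_def
  by (intro smooth_on_sum smooth_on_scaleR smooth_on_const open_U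
      smooth_on_frechet_derivative_apply[OF open_U assms] smooth_pinv)

text \<open>The derivative within \<open>M\<close> that \<open>frechet_derivative\<close> selects is
  arbitrary in normal directions, but \<open>div_on\<close> evaluates it on tangential parts only,
  where pulling back along \<open>\<psi>\<close> identifies it.\<close>

lemma div_on_eq:
  assumes u: "u \<in> U" and X: "((\<lambda>u. X (\<psi> u)) has_derivative D) (at u)"
  shows "div_on M X (\<psi> u) = (\<Sum>b\<in>Basis. D (pinv u b) \<bullet> J u (pinv u b))"
proof -
  have "(X has_derivative (\<lambda>b. D (pinv u b))) (at (\<psi> u) within M)" by (rule push_derivative[OF u X])
  then have "(X has_derivative frechet_derivative X (at (\<psi> u) within M)) (at (\<psi> u) within M)"
    using frechet_derivative_works differentiable_def by blast
  from has_derivative_unique[OF pull_derivative[OF u this] X]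
  have "frechet_derivative X (at (\<psi> u) within M) (J u w) = D w" for w by metis
  then show ?thesis by (simp add: div_on_def tangent_part_eq[OF u])
qed

lemma smooth_function_chart:
  assumes "smooth_function M f"
  shows "smooth_on U (\<lambda>u. f (\<psi> u))"
proof (rule smooth_on_local[OF open_U])
  fix u assume u: "u \<in> U"
  have "\<exists>W F. open W \<and> \<psi> u \<in> W \<and> smooth_on W F \<and> (\<forall>y\<in>W \<inter> M. F y = f y)"
    using assms psi_in_M[OF u] unfolding smooth_function_def by (rule bspec)
  then obtain W F where W: "open W" "\<psi> u \<in> W" "smooth_on W F" "\<forall>y\<in>W \<inter> M. F y = f y"
    by (elim exE conjE)
  have o: "open (U \<inter> \<psi> -` W)"
    using continuous_open_preimage[OF smooth_on_imp_continuous_on[OF smooth_psi] open_U W(1)] .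
  have "smooth_on (U \<inter> \<psi> -` W) (\<lambda>u. F (\<psi> u))"
    by (rule smooth_on_compose[OF o W(1) _ smooth_on_subset[OF smooth_psi] W(3)]) auto
  then have "smooth_on (U \<inter> \<psi> -` W) (\<lambda>u. f (\<psi> u))"
    by (rule smooth_on_cong[OF o]) (use W(4) psi_in_M in auto)
  then show "\<exists>T. open T \<and> u \<in> T \<and> smooth_on T (\<lambda>u. f (\<psi> u))" using o u W(2) by blast
qed

definition cdiv :: "(real^'m \<Rightarrow> real^'d) \<Rightarrow> real^'m \<Rightarrow> real" where
  "cdiv Y u = (\<Sum>b\<in>Basis. frechet_derivative Y (at u) (pinv u b) \<bullet> J u (pinv u b))"

lemma smooth_cdiv: "smooth_on U Y \<Longrightarrow> smooth_on U (cdiv Y)"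
  unfolding cdiv_def
  by (intro smooth_on_sum smooth_on_inner smooth_on_const open_U
      smooth_on_frechet_derivative_apply[OF open_U] smooth_pinv smooth_J)

lemma laplace_beltrami_eq:
  assumes u: "u \<in> U" and f: "smooth_on U (\<lambda>u. f (\<psi> u))"
  shows "laplace_beltrami M f (\<psi> u) = cdiv (cgrad (\<lambda>u. f (\<psi> u))) u"
proof -
  have "smooth_on U (\<lambda>u. grad_on M f (\<psi> u))"
    by (rule smooth_on_cong[OF open_U smooth_cgrad[OF f]]) (simp add: grad_on_eq f)
  note d = smooth_on_has_derivative[OF this open_U u]
  have "(cgrad (\<lambda>u. f (\<psi> u)) has_derivative frechet_derivative (\<lambda>u. grad_on M f (\<psi> u)) (at u)) (at u)"
    by (rule has_derivative_transform_within_open[OF d open_U u]) (simp add: grad_on_eq f)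
  then have "frechet_derivative (cgrad (\<lambda>u. f (\<psi> u))) (at u) = frechet_derivative (\<lambda>u. grad_on M f (\<psi> u)) (at u)"
    using frechet_derivative_at by metis
  then show ?thesis
    unfolding laplace_beltrami_def div_on_eq[OF u d] cdiv_def by simp
qed

end

section \<open>The weighted Laplacian in a chart, and normality of the Laplacian of the position
  vector\<close>

context chart begin

lemma continuous_on_image:
  assumes "continuous_on U (\<lambda>u. g (\<psi> u))"
  shows "continuous_on (\<psi> ` U) g"
proof -
  obtain \<phi> where hom: "homeomorphism U (\<psi> ` U) \<psi> \<phi>" using lp by (auto simp: local_param_def)
  then have *: "continuous_on (\<psi> ` U) \<phi>" "\<phi> ` (\<psi> ` U) = U" "\<And>u. u \<in> U \<Longrightarrow> \<phi> (\<psi> u) = u"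
    by (auto simp: homeomorphism_def)
  have "continuous_on (\<psi> ` U) (\<lambda>x. g (\<psi> (\<phi> x)))"
    by (rule continuous_on_compose2[OF assms *(1)]) (use *(2) in simp)
  then show ?thesis
    by (rule continuous_on_cong[THEN iffD1, OF refl, rotated]) (use *(3) in auto)
qed

lemma open_vimage: "open W \<Longrightarrow> open (U \<inter> \<psi> -` W)"
  by (rule continuous_open_preimage[OF smooth_on_imp_continuous_on[OF smooth_psi] open_U])

lemma cgrad_cong:
  assumes "open T" "u \<in> T" "smooth_on T f" "\<And>x. x \<in> T \<Longrightarrow> f x = g x"
  shows "cgrad f u = cgrad g u"
proof -
  have "(g has_derivative frechet_derivative f (at u)) (at u)"
    by (rule has_derivative_transform_within_open[OF smooth_on_has_derivative[OF assms(3,1,2)] assms(1,2)]) (rule assms(4))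
  from frechet_derivative_at[OF this] show ?thesis by (simp add: cgrad_def)
qed

lemma cdiv_cong:
  assumes "open T" "u \<in> T" "smooth_on T f" "\<And>x. x \<in> T \<Longrightarrow> f x = g x"
  shows "cdiv f u = cdiv g u"
proof -
  have "(g has_derivative frechet_derivative f (at u)) (at u)"
    by (rule has_derivative_transform_within_open[OF smooth_on_has_derivative[OF assms(3,1,2)] assms(1,2)]) (rule assms(4))
  from frechet_derivative_at[OF this] show ?thesis by (simp add: cdiv_def)
qed

lemma smooth_ln_density:
  assumes "smooth_function M p" "\<forall>z\<in>M. p z > 0"
  shows "smooth_on U (\<lambda>u. ln (p (\<psi> u)))"
  by (rule smooth_on_ln[where f="\<lambda>u. p (\<psi> u)", OF open_U smooth_function_chart[OF assms(1)]]) (simp add: assms(2) psi_in_M)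

lemma weighted_laplacian_eq:
  assumes p: "smooth_function M p" "\<forall>z\<in>M. p z > 0" and f: "smooth_on U (\<lambda>u. f (\<psi> u))" and u: "u \<in> U"
  shows "weighted_laplacian M p f (\<psi> u) = cdiv (cgrad (\<lambda>u. f (\<psi> u))) u
      + cgrad (\<lambda>u. ln (p (\<psi> u))) u \<bullet> cgrad (\<lambda>u. f (\<psi> u)) u"
  unfolding weighted_laplacian_def
  by (simp add: laplace_beltrami_eq[OF u f] grad_on_eq[OF u f] grad_on_eq[where f="\<lambda>x. ln (p x)", OF u smooth_ln_density[OF p]])

lemma smooth_weighted_laplacian:
  assumes p: "smooth_function M p" "\<forall>z\<in>M. p z > 0" and f: "smooth_on U (\<lambda>u. f (\<psi> u))"
  shows "smooth_on U (\<lambda>u. weighted_laplacian M p f (\<psi> u))"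
  by (rule smooth_on_cong[OF open_U smooth_on_add[OF open_U smooth_cdiv[OF smooth_cgrad[OF f]]
        smooth_on_inner[OF open_U smooth_cgrad[OF smooth_ln_density[OF p]] smooth_cgrad[OF f]]]])
     (simp add: weighted_laplacian_eq[OF p f])

lemma cgrad_square:
  assumes "smooth_on U f" "u \<in> U"
  shows "cgrad (\<lambda>u. f u * f u) u = (2 * f u) *\<^sub>R cgrad f u"
proof -
  have "((\<lambda>u. f u * f u) has_derivative (\<lambda>v. f u * frechet_derivative f (at u) v + frechet_derivative f (at u) v * f u)) (at u)"
    using smooth_on_has_derivative[OF assms(1) open_U assms(2)] by (intro has_derivative_mult)
  note fd = frechet_derivative_at[OF this, symmetric]
  show ?thesis
    unfolding cgrad_def fd by (auto simp: scaleR_sum_right algebra_simps intro!: sum.cong)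
qed

lemma cdiv_cgrad_square:
  assumes f: "smooth_on U f" and u: "u \<in> U"
  shows "cdiv (cgrad (\<lambda>u. f u * f u)) u = 2 * f u * cdiv (cgrad f) u + 2 * (cgrad f u \<bullet> cgrad f u)"
proof -
  define D where "D = frechet_derivative f (at u)"
  define E where "E = frechet_derivative (cgrad f) (at u)"
  have "((\<lambda>u. (2 * f u) *\<^sub>R cgrad f u) has_derivative (\<lambda>v. (2 * f u) *\<^sub>R E v + (2 * D v) *\<^sub>R cgrad f u)) (at u)"
    unfolding D_def E_def
    by (intro has_derivative_scaleR has_derivative_mult_right smooth_on_has_derivative[OF _ open_U u] f smooth_cgrad)
  then have "(cgrad (\<lambda>u. f u * f u) has_derivative (\<lambda>v. (2 * f u) *\<^sub>R E v + (2 * D v) *\<^sub>R cgrad f u)) (at u)"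
    by (rule has_derivative_transform_within_open[OF _ open_U u]) (simp add: cgrad_square[OF f])
  note fd = frechet_derivative_at[OF this, symmetric]
  have "(\<Sum>b\<in>Basis. D (pinv u b) * (cgrad f u \<bullet> J u (pinv u b))) = cgrad f u \<bullet> cgrad f u"
  proof -
    have "cgrad f u \<bullet> J u (pinv u b) = cgrad f u \<bullet> b" for b
      using cgrad_inner_J[OF u f] cgrad_inner[OF u f] by simp
    moreover have "D (pinv u b) = cgrad f u \<bullet> b" for b by (simp add: D_def cgrad_inner[OF u f])
    ultimately show ?thesis by (simp add: euclidean_inner[of "cgrad f u" "cgrad f u"])
  qed
  then show ?thesis
    unfolding cdiv_def fd
    by (simp add: E_def inner_add_left sum.distrib sum_distrib_left[symmetric] mult.assoc)
qed

text \<open>The vector is the mean curvature vector. The gradient of the \<open>i\<close>-th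
  coordinate is the projection of the \<open>i\<close>-th axis, so the Laplacian is a trace of
  derivatives of the projection field \<open>P\<close>. Differentiating the relation
  \<open>P \<circ> P = P\<close> shows that derivatives of \<open>P\<close> send tangent vectors to
  normal ones, so pairing with a tangent vector gives zero.\<close>

lemma laplace_coords_normal:
  assumes u: "u \<in> U"
  shows "tangent_part M (\<psi> u) (\<chi> i. laplace_beltrami M (\<lambda>y. y $ i) (\<psi> u)) = 0"
proof -
  define P where "P b u = J u (pinv u b)" for b u
  define L where "L = (\<chi> i. laplace_beltrami M (\<lambda>y. y $ i) (\<psi> u))"
  define DP where "DP b = frechet_derivative (P b) (at u)" for b
  have sP: "smooth_on U (P b)" for b unfolding P_def[abs_def] by (intro smooth_J smooth_pinv smooth_on_const)
  have dP: "(P b has_derivative DP b) (at u)" for b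
    unfolding DP_def by (rule smooth_on_has_derivative[OF sP open_U u])
  have sc: "smooth_on U (\<lambda>u. \<psi> u $ i)" for i by (rule smooth_on_vec_nth[OF open_U smooth_psi])
  have sym: "x \<bullet> P b u = P x u \<bullet> P b u" if "u \<in> U" for x b u
    unfolding P_def using J_inner_proj[OF that, of "pinv u b" x] by (simp add: inner_commute)
  have cg: "cgrad (\<lambda>u. \<psi> u $ i) u = P (axis i 1) u" if u: "u \<in> U" for i u
  proof -
    have fd: "frechet_derivative (\<lambda>u. \<psi> u $ i) (at u) = (\<lambda>w. J u w $ i)"
      by (rule frechet_derivative_at[symmetric])
         (rule bounded_linear.has_derivative[OF bounded_linear_vec_nth psi_deriv[OF u]])
    have "cgrad (\<lambda>u. \<psi> u $ i) u \<bullet> x = P (axis i 1) u \<bullet> x" for x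
    proof -
      have "cgrad (\<lambda>u. \<psi> u $ i) u \<bullet> x = P x u \<bullet> axis i 1"
        by (simp add: cgrad_inner[OF u sc] fd P_def inner_axis)
      also have "\<dots> = P (axis i 1) u \<bullet> x" using sym[OF u] by (metis inner_commute)
      finally show ?thesis .
    qed
    then show ?thesis using vector_eq_rdot by blast
  qed
  have L: "L $ i = (\<Sum>b\<in>Basis. DP (axis i 1) (pinv u b) \<bullet> P b u)" for i
  proof -
    have "L $ i = cdiv (cgrad (\<lambda>u. \<psi> u $ i)) u"
      unfolding L_def by (simp add: laplace_beltrami_eq[OF u sc])
    also have "\<dots> = cdiv (P (axis i 1)) u"
      by (rule cdiv_cong[OF open_U u smooth_cgrad[OF sc] cg])
    finally show ?thesis by (simp add: cdiv_def DP_def P_def)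
  qed
  have lin: "(\<Sum>i\<in>UNIV. (t $ i) *\<^sub>R DP (axis i 1) v) = DP t v" for t v
  proof -
    have "((\<lambda>u. \<Sum>i\<in>UNIV. (t $ i) *\<^sub>R P (axis i 1) u) has_derivative (\<lambda>v. \<Sum>i\<in>UNIV. (t $ i) *\<^sub>R DP (axis i 1) v)) (at u)"
      by (intro has_derivative_sum has_derivative_scaleR_right dP)
    then have "(P t has_derivative (\<lambda>v. \<Sum>i\<in>UNIV. (t $ i) *\<^sub>R DP (axis i 1) v)) (at u)"
    proof (rule has_derivative_transform_within_open[OF _ open_U u])
      fix x assume x: "x \<in> U"
      have l: "linear (\<lambda>b. P b x)" unfolding P_def using linear_compose[OF linear_pinv[OF x] linear_J[OF x]] by (simp add: o_def)
      have "P (\<Sum>i\<in>UNIV. (t $ i) *\<^sub>R axis i 1) x = (\<Sum>i\<in>UNIV. (t $ i) *\<^sub>R P (axis i 1) x)"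
        using linear_sum[OF l, of "\<lambda>i. (t $ i) *\<^sub>R axis i 1" UNIV] linear_cmul[OF l] by simp
      then show "(\<Sum>i\<in>UNIV. (t $ i) *\<^sub>R P (axis i 1) x) = P t x"
        by (simp only: scalar_mult_eq_scaleR[symmetric] basis_expansion)
    qed
    from has_derivative_unique[OF this dP] show ?thesis by metis
  qed
  \<comment> \<open>With \<open>S\<close> and \<open>T\<close> frozen,
    \<open>P T \<bullet> S\<close> and \<open>P T \<bullet> P S\<close> are the same function on
    \<open>U\<close>, since \<open>P\<close> is a symmetric idempotent. Comparing their derivatives
    at \<open>u\<close>, where \<open>P S u = S\<close>, leaves the claim.\<close>
  have normal: "P t u \<bullet> DP (P s u) v = 0" for s t v
  proof -
    have idem: "P (P a u) u = P a u" for a unfolding P_def using pinv_J[OF u] by simp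
    define S T where "S = P s u" and "T = P t u"
    have "((\<lambda>u. P T u \<bullet> S) has_derivative (\<lambda>v. DP T v \<bullet> S)) (at u)"
      by (rule has_derivative_inner_left[OF dP])
    then have 1: "((\<lambda>u. P T u \<bullet> P S u) has_derivative (\<lambda>v. DP T v \<bullet> S)) (at u)"
    proof (rule has_derivative_transform_within_open[OF _ open_U u])
      fix x assume x: "x \<in> U"
      show "P T x \<bullet> S = P T x \<bullet> P S x" using sym[OF x] by (metis inner_commute)
    qed
    have 2: "((\<lambda>u. P T u \<bullet> P S u) has_derivative (\<lambda>v. P T u \<bullet> DP S v + DP T v \<bullet> P S u)) (at u)"
      by (rule has_derivative_inner[OF dP dP])
    have "DP T v \<bullet> S = P T u \<bullet> DP S v + DP T v \<bullet> P S u" using has_derivative_unique[OF 1 2] by metis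
    then show ?thesis by (simp add: S_def T_def idem)
  qed
  have "x \<bullet> P L u = 0" for x
  proof -
    have "x \<bullet> P L u = P x u \<bullet> L" using sym[OF u] by (metis inner_commute)
    also have "\<dots> = (\<Sum>i\<in>UNIV. P x u $ i * (\<Sum>b\<in>Basis. DP (axis i 1) (pinv u b) \<bullet> P b u))"
      by (simp add: inner_vec_def L)
    also have "\<dots> = (\<Sum>b\<in>Basis. \<Sum>i\<in>UNIV. (P x u $ i *\<^sub>R DP (axis i 1) (pinv u b)) \<bullet> P b u)"
      by (subst sum.swap) (simp add: sum_distrib_left)
    also have "\<dots> = (\<Sum>b\<in>Basis. DP (P x u) (pinv u b) \<bullet> P b u)"
      by (simp add: inner_sum_left[symmetric] lin del: inner_scaleR_left)
    also have "\<dots> = 0" by (rule sum.neutral) (use normal in \<open>metis inner_commute\<close>)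
    finally show ?thesis .
  qed
  from this[of "P L u"] have "P L u = 0" by simp
  then show ?thesis by (simp add: tangent_part_eq[OF u] P_def L_def)
qed

lemma grad_coord: 
  assumes u: "u \<in> U"
  shows "grad_on M (\<lambda>y. y $ i) (\<psi> u) \<bullet> x = tangent_part M (\<psi> u) x $ i"
proof -
  have sc: "smooth_on U (\<lambda>u. \<psi> u $ i)" by (rule smooth_on_vec_nth[OF open_U smooth_psi])
  have fd: "frechet_derivative (\<lambda>u. \<psi> u $ i) (at u) = (\<lambda>w. J u w $ i)"
    by (rule frechet_derivative_at[symmetric])
       (rule bounded_linear.has_derivative[OF bounded_linear_vec_nth psi_deriv[OF u]])
  show ?thesis
    by (subst grad_on_eq[OF u sc]) (simp add: cgrad_inner[OF u sc] fd tangent_part_eq[OF u])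
qed

lemma grad_tangential:
  assumes u: "u \<in> U" and f: "smooth_on U (\<lambda>u. f (\<psi> u))"
  shows "tangent_part M (\<psi> u) (grad_on M f (\<psi> u)) = grad_on M f (\<psi> u)"
  by (simp add: grad_on_eq[OF u f] tangent_part_eq[OF u] cgrad_tangential[OF u f])

lemma linear_tangent_part: "u \<in> U \<Longrightarrow> linear (tangent_part M (\<psi> u))"
proof -
  assume u: "u \<in> U"
  have "J u \<circ> pinv u = tangent_part M (\<psi> u)" by (rule ext) (simp add: tangent_part_eq[OF u])
  then show ?thesis using linear_compose[OF linear_pinv[OF u] linear_J[OF u]] by simp
qed

end

section \<open>From charts to the submanifold: continuity, locality and the equations for the
  density\<close>

lemma chart_at:
  assumes "embedded_submanifold TYPE('m::finite) M" "x \<in> M"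
  obtains U :: "(real^'m) set" and \<psi> u where "chart M U \<psi>" "u \<in> U" "x = \<psi> u"
  using assms unfolding embedded_submanifold_def chart_def by blast

lemma continuous_on_charts:
  fixes M :: "(real^'d) set" and g :: "real^'d \<Rightarrow> 'b::topological_space"
  assumes M: "embedded_submanifold TYPE('m::finite) M"
    and g: "\<And>(U :: (real^'m) set) \<psi>. chart M U \<psi> \<Longrightarrow> continuous_on U (\<lambda>u. g (\<psi> u))"
  shows "continuous_on M g"
  unfolding continuous_on_def
proof
  fix x assume "x \<in> M"
  from chart_at[OF M this] obtain U :: "(real^'m) set" and \<psi> u where c: "chart M U \<psi>" "u \<in> U" "x = \<psi> u" .
  interpret chart M U \<psi> by (rule c(1))
  have "(g \<longlongrightarrow> g x) (at x within \<psi> ` U)"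
    using continuous_on_image[OF g[OF c(1)]] c(2,3) unfolding continuous_on_def by blast
  then show "(g \<longlongrightarrow> g x) (at x within M)" using at_within_image[OF c(2)] c(3) by simp
qed

lemma smooth_function_ambient:
  assumes "smooth_on UNIV F"
  shows "smooth_function M F"
  unfolding smooth_function_def
  by (intro ballI exI[of _ UNIV] exI[of _ F]) (use assms in auto)

lemma smooth_function_mult:
  assumes "smooth_function M f" "smooth_function M g"
  shows "smooth_function M (\<lambda>x. f x * g x)"
  unfolding smooth_function_def
proof
  fix x assume x: "x \<in> M"
  from bspec[OF assms(1)[unfolded smooth_function_def] x]
  obtain U F where U: "open U" "x \<in> U" "smooth_on U F" "\<forall>y\<in>U \<inter> M. F y = f y" by (elim exE conjE)
  from bspec[OF assms(2)[unfolded smooth_function_def] x]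
  obtain W G where W: "open W" "x \<in> W" "smooth_on W G" "\<forall>y\<in>W \<inter> M. G y = g y" by (elim exE conjE)
  have "smooth_on (U \<inter> W) (\<lambda>y. F y * G y)"
    by (intro smooth_on_mult open_Int U(1) W(1) smooth_on_subset[OF U(3)] smooth_on_subset[OF W(3)]) auto
  then show "\<exists>U F. open U \<and> x \<in> U \<and> smooth_on U F \<and> (\<forall>y\<in>U \<inter> M. F y = f y * g y)"
    using U W by (intro exI[of _ "U \<inter> W"] exI[of _ "\<lambda>y. F y * G y"]) auto
qed

locale weighted_manifold =
  fixes M :: "(real^'d) set" and p :: "real^'d \<Rightarrow> real" and mtype :: "'m::finite itself"
  assumes emb: "embedded_submanifold TYPE('m) M" and p_smooth: "smooth_function M p" and p_pos: "\<forall>z\<in>M. p z > 0"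
begin

lemma continuous_smooth_function:
  assumes "smooth_function M f" shows "continuous_on M f"
proof (rule continuous_on_charts[OF emb])
  fix U :: "(real^'m) set" and \<psi> assume c: "chart M U \<psi>"
  show "continuous_on U (\<lambda>u. f (\<psi> u))"
    by (rule smooth_on_imp_continuous_on[OF chart.smooth_function_chart[OF c assms]])
qed

lemma continuous_weighted_laplacian:
  assumes "smooth_function M f" shows "continuous_on M (weighted_laplacian M p f)"
proof (rule continuous_on_charts[OF emb])
  fix U :: "(real^'m) set" and \<psi> assume c: "chart M U \<psi>"
  show "continuous_on U (\<lambda>u. weighted_laplacian M p f (\<psi> u))"
    by (rule smooth_on_imp_continuous_on[OF chart.smooth_weighted_laplacian[OF c p_smooth p_pos chart.smooth_function_chart[OF c assms]]])
qed

lemma continuous_grad_on: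
  assumes "smooth_function M f" shows "continuous_on M (grad_on M f)"
proof (rule continuous_on_charts[OF emb])
  fix U :: "(real^'m) set" and \<psi> assume c: "chart M U \<psi>"
  interpret chart M U \<psi> by (rule c)
  show "continuous_on U (\<lambda>u. grad_on M f (\<psi> u))"
    using smooth_on_imp_continuous_on[OF smooth_cgrad[OF smooth_function_chart[OF assms]]]
    by (rule continuous_on_cong[THEN iffD1, OF refl, rotated]) (simp add: grad_on_eq smooth_function_chart[OF assms])
qed

text \<open>In a chart the expression is built from derivatives at the point, so agreement on a
  relative neighbourhood suffices. This allows functions to be cut off far away.\<close>

lemma weighted_laplacian_local:
  assumes f: "smooth_function M f" and g: "smooth_function M g" and W: "open W" "x \<in> M" "x \<in> W"
    and eq: "\<And>y. y \<in> M \<Longrightarrow> y \<in> W \<Longrightarrow> f y = g y"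
  shows "weighted_laplacian M p f x = weighted_laplacian M p g x"
proof -
  from chart_at[OF emb W(2)] obtain U :: "(real^'m) set" and \<psi> u where c: "chart M U \<psi>" "u \<in> U" "x = \<psi> u" .
  interpret chart M U \<psi> by (rule c(1))
  let ?T = "U \<inter> \<psi> -` W"
  have T: "open ?T" "u \<in> ?T" using open_vimage[OF W(1)] c W by auto
  have f': "smooth_on U (\<lambda>u. f (\<psi> u))" and g': "smooth_on U (\<lambda>u. g (\<psi> u))"
    using smooth_function_chart f g by auto
  have cg: "cgrad (\<lambda>u. f (\<psi> u)) v = cgrad (\<lambda>u. g (\<psi> u)) v" if "v \<in> ?T" for v
    by (rule cgrad_cong[OF T(1) that smooth_on_subset[OF f']]) (use eq psi_in_M in auto)
  have "cdiv (cgrad (\<lambda>u. f (\<psi> u))) u = cdiv (cgrad (\<lambda>u. g (\<psi> u))) u"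
    by (rule cdiv_cong[OF T smooth_on_subset[OF smooth_cgrad[OF f']] cg]) auto
  then show ?thesis
    unfolding c(3) weighted_laplacian_eq[OF p_smooth p_pos f' c(2)] weighted_laplacian_eq[OF p_smooth p_pos g' c(2)]
    using cg[OF T(2)] by simp
qed

lemma weighted_laplacian_const:
  assumes "x \<in> M"
  shows "weighted_laplacian M p (\<lambda>_. a) x = 0"
proof -
  from chart_at[OF emb assms] obtain U :: "(real^'m) set" and \<psi> u where c: "chart M U \<psi>" "u \<in> U" "x = \<psi> u" .
  interpret chart M U \<psi> by (rule c(1))
  have cg: "cgrad (\<lambda>u. a) = (\<lambda>u. 0)" by (rule ext) (simp add: cgrad_def)
  have "cdiv (\<lambda>u. 0) u = 0" by (simp add: cdiv_def)
  then show ?thesis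
    unfolding c(3) weighted_laplacian_eq[where f="\<lambda>_. a", OF p_smooth p_pos smooth_on_const c(2)] by (simp add: cg)
qed

text \<open>The carre du champ identity: the drift acts as a derivation, and the squared gradient is
  the cross term in the divergence of \<open>2 f grad f\<close>.\<close>

lemma weighted_laplacian_square:
  assumes f: "smooth_function M f" and x: "x \<in> M"
  shows "weighted_laplacian M p (\<lambda>x. f x * f x) x = 2 * f x * weighted_laplacian M p f x + 2 * (norm (grad_on M f x))\<^sup>2"
proof -
  from chart_at[OF emb x] obtain U :: "(real^'m) set" and \<psi> u where c: "chart M U \<psi>" "u \<in> U" "x = \<psi> u" .
  interpret chart M U \<psi> by (rule c(1))
  note f' = smooth_function_chart[OF f]
  note ff = smooth_on_mult[OF open_U f' f']
  show ?thesis
    unfolding c(3) weighted_laplacian_eq[OF p_smooth p_pos f' c(2)] power2_norm_eq_inner grad_on_eq[OF c(2) f']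
      weighted_laplacian_eq[where f="\<lambda>x. f x * f x", OF p_smooth p_pos ff c(2)]
    by (simp add: cdiv_cgrad_square[OF f' c(2)] cgrad_square[OF f' c(2)] algebra_simps)
qed

text \<open>Since \<open>\<Delta>z\<close> is normal, these are the two parts of the vector identity \<open>\<Delta>z + grad (ln p) = - \<mu> z\<close>.\<close>

lemma laplacian_coords_split:
  assumes eig: "\<And>i. weighted_laplacian M p (\<lambda>y. y $ i) x = - \<mu> * x $ i" and x: "x \<in> M"
  shows "grad_on M (\<lambda>y. ln (p y)) x = - \<mu> *\<^sub>R tangent_part M x x"
    and "(\<chi> i. laplace_beltrami M (\<lambda>y. y $ i) x) = - \<mu> *\<^sub>R normal_part M x x"
proof -
  from chart_at[OF emb x] obtain U :: "(real^'m) set" and \<psi> u where c: "chart M U \<psi>" "u \<in> U" "x = \<psi> u" .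
  interpret chart M U \<psi> by (rule c(1))
  let ?L = "\<chi> i. laplace_beltrami M (\<lambda>y. y $ i) x" and ?g = "grad_on M (\<lambda>y. ln (p y)) x"
  have tg: "tangent_part M x ?g = ?g"
    unfolding c(3) by (rule grad_tangential[OF c(2) smooth_ln_density[OF p_smooth p_pos]])
  have "?g \<bullet> grad_on M (\<lambda>y. y $ i) x = ?g $ i" for i
    using grad_coord[OF c(2), of i ?g] tg c(3) by (simp add: inner_commute)
  then have sum: "?L + ?g = - \<mu> *\<^sub>R x"
    using eig by (simp add: vec_eq_iff weighted_laplacian_def)
  note lin = linear_tangent_part[OF c(2), folded c(3)]
  have "tangent_part M x (?L + ?g) = ?g"
    using laplace_coords_normal[OF c(2), folded c(3)] tg by (simp add: linear_add[OF lin] c(3)[symmetric])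
  then show g: "?g = - \<mu> *\<^sub>R tangent_part M x x" unfolding sum by (simp add: linear_cmul[OF lin] linear_neg[OF lin])
  have "?L = - \<mu> *\<^sub>R x - ?g" using sum by (metis add_diff_cancel_right')
  then show "?L = - \<mu> *\<^sub>R normal_part M x x" by (simp add: g normal_part_def scaleR_diff_right)
qed

lemma density_gaussian:
  assumes g: "\<And>x. x \<in> M \<Longrightarrow> grad_on M (\<lambda>y. ln (p y)) x = - \<mu> *\<^sub>R tangent_part M x x"
    and conn: "connected M"
  shows "\<exists>C>0. \<forall>z\<in>M. p z = C * exp (- (\<mu> / 2) * (norm z)\<^sup>2)"
proof -
  define q where "q y = ln (p y) + (\<mu> / 2) * (y \<bullet> y)" for y
  have "\<exists>a. \<forall>z\<in>M. q z = a"
  proof (cases "M = {}")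
    case False
    have "q constant_on M"
    proof (rule locally_constant_imp_constant[OF conn])
      fix x assume x: "x \<in> M"
      from chart_at[OF emb x] obtain U :: "(real^'m) set" and \<psi> u where c: "chart M U \<psi>" "u \<in> U" "x = \<psi> u" .
      interpret chart M U \<psi> by (rule c(1))
      obtain r where r: "r > 0" "ball u r \<subseteq> U" using open_U c(2) open_contains_ball by blast
      have d: "((\<lambda>u. q (\<psi> u)) has_derivative (\<lambda>w. 0)) (at v)" if v: "v \<in> U" for v
      proof -
        note sl = smooth_ln_density[OF p_smooth p_pos]
        \<comment> \<open>Paired with the tangent vector \<open>J v w\<close>, the tangential part
          of \<open>\<psi> v\<close> may be replaced by \<open>\<psi> v\<close> itself, so this
          derivative cancels that of the quadratic term.\<close>
        have "frechet_derivative (\<lambda>u. ln (p (\<psi> u))) (at v) w = - \<mu> * (\<psi> v \<bullet> J v w)" for w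
        proof -
          have "frechet_derivative (\<lambda>u. ln (p (\<psi> u))) (at v) w = grad_on M (\<lambda>y. ln (p y)) (\<psi> v) \<bullet> J v w"
            by (subst grad_on_eq[where f="\<lambda>y. ln (p y)", OF v sl]) (simp add: cgrad_inner_J[OF v sl])
          also have "\<dots> = - \<mu> * (J v w \<bullet> J v (pinv v (\<psi> v)))"
            by (simp add: g[OF psi_in_M[OF v]] tangent_part_eq[OF v] inner_commute)
          finally show ?thesis by (simp add: J_inner_proj[OF v] inner_commute)
        qed
        moreover have "((\<lambda>u. q (\<psi> u)) has_derivative (\<lambda>w. frechet_derivative (\<lambda>u. ln (p (\<psi> u))) (at v) w
             + (\<mu> / 2) * (\<psi> v \<bullet> J v w + J v w \<bullet> \<psi> v))) (at v)"
          unfolding q_def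
          by (intro has_derivative_add has_derivative_mult_right has_derivative_inner
              smooth_on_has_derivative[OF sl open_U v] psi_deriv[OF v])
        moreover have "- \<mu> * (\<psi> v \<bullet> J v w) + (\<mu> / 2) * (\<psi> v \<bullet> J v w + J v w \<bullet> \<psi> v) = 0" for w
          by (simp add: inner_commute[of "J v w"])
        ultimately show ?thesis by (simp only:)
      qed
      have const: "q (\<psi> v) = q (\<psi> u)" if "v \<in> ball u r" for v
      proof -
        have "((\<lambda>u. q (\<psi> u)) has_derivative (\<lambda>w. 0)) (at x within ball u r)" if "x \<in> ball u r" for x
          using has_derivative_at_withinI[OF d[of x]] r(2) that by blast
        from has_derivative_zero_unique[OF convex_ball this, of v u] show ?thesis using r(1) that by simp
      qed
      obtain \<phi> where hom: "homeomorphism U (\<psi> ` U) \<psi> \<phi>" using lp by (auto simp: local_param_def)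
      have "openin (top_of_set U) (ball u r)" using r(2) open_U by (simp add: openin_open_eq)
      from homeomorphism_imp_open_map[OF hom this]
      have "openin (top_of_set (\<psi> ` U)) (\<psi> ` ball u r)" .
      then have "openin (top_of_set M) (\<psi> ` ball u r)" using openin_trans openin_image by blast
      then show "\<exists>T. openin (top_of_set M) T \<and> x \<in> T \<and> (\<forall>y\<in>T. q y = q x)"
      proof (intro exI[of _ "\<psi> ` ball u r"] conjI ballI)
        show "x \<in> \<psi> ` ball u r" using c(3) r(1) by simp
        show "q y = q x" if "y \<in> \<psi> ` ball u r" for y using that const unfolding c(3) by blast
      qed
    qed
    then show ?thesis by (simp add: constant_on_def)
  qed auto
  then obtain a where a: "\<And>z. z \<in> M \<Longrightarrow> q z = a" by blast
  have "p z = exp a * exp (- (\<mu> / 2) * (norm z)\<^sup>2)" if "z \<in> M" for z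
  proof -
    have "ln (p z) = a + - (\<mu> / 2) * (norm z)\<^sup>2" using a[OF that] by (simp add: q_def power2_norm_eq_inner)
    then show ?thesis using exp_ln[of "p z"] p_pos that unfolding exp_add[symmetric] by metis
  qed
  then show ?thesis by (intro exI[of _ "exp a"] conjI ballI) simp_all
qed

end

section \<open>Real L2 spaces\<close>

context
  fixes P :: "'a measure"
begin

lemma l2_measurable: "f \<in> l2 P \<Longrightarrow> f \<in> borel_measurable P"
  and l2_integrable_square: "f \<in> l2 P \<Longrightarrow> integrable P (\<lambda>x. (f x)\<^sup>2)"
  by (auto simp: l2_def)

lemma l2_integrable_mult:
  assumes "f \<in> l2 P" "g \<in> l2 P"
  shows "integrable P (\<lambda>x. f x * g x)"
proof (rule Bochner_Integration.integrable_bound)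
  show "integrable P (\<lambda>x. (f x)\<^sup>2 + (g x)\<^sup>2)"
    using assms by (simp add: l2_integrable_square)
  show "(\<lambda>x. f x * g x) \<in> borel_measurable P" using assms l2_measurable by measurable
  have "\<bar>f x * g x\<bar> \<le> (f x)\<^sup>2 + (g x)\<^sup>2" for x
  proof -
    have "0 \<le> (\<bar>f x\<bar> - \<bar>g x\<bar>)\<^sup>2" "0 \<le> (f x)\<^sup>2 + (g x)\<^sup>2" by simp_all
    then have "\<bar>f x\<bar> * \<bar>g x\<bar> \<le> (f x)\<^sup>2 + (g x)\<^sup>2" unfolding power2_diff power2_abs by linarith
    then show ?thesis by (simp add: abs_mult)
  qed
  then show "AE x in P. norm (f x * g x) \<le> norm ((f x)\<^sup>2 + (g x)\<^sup>2)" by simp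
qed

lemma l2_lincomb:
  assumes "f \<in> l2 P" "g \<in> l2 P"
  shows "(\<lambda>x. a * f x + b * g x) \<in> l2 P"
proof -
  have "integrable P (\<lambda>x. a\<^sup>2 * (f x)\<^sup>2 + 2 * a * b * (f x * g x) + b\<^sup>2 * (g x)\<^sup>2)"
    using assms by (simp add: l2_integrable_mult l2_integrable_square)
  moreover have "a\<^sup>2 * (f x)\<^sup>2 + 2 * a * b * (f x * g x) + b\<^sup>2 * (g x)\<^sup>2 = (a * f x + b * g x)\<^sup>2" for x
    by (simp add: power2_eq_square algebra_simps)
  moreover have "(\<lambda>x. a * f x + b * g x) \<in> borel_measurable P"
    using assms l2_measurable by measurable
  ultimately show ?thesis by (simp add: l2_def)
qed

lemma l2_add: "f \<in> l2 P \<Longrightarrow> g \<in> l2 P \<Longrightarrow> (\<lambda>x. f x + g x) \<in> l2 P"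
  using l2_lincomb[of f g 1 1] by simp

lemma l2_diff: "f \<in> l2 P \<Longrightarrow> g \<in> l2 P \<Longrightarrow> (\<lambda>x. f x - g x) \<in> l2 P"
  using l2_lincomb[of f g 1 "-1"] by simp

lemma l2_cmult: "f \<in> l2 P \<Longrightarrow> (\<lambda>x. a * f x) \<in> l2 P"
  using l2_lincomb[of f f a 0] by simp

lemma l2_uminus: "f \<in> l2 P \<Longrightarrow> (\<lambda>x. - f x) \<in> l2 P"
  using l2_cmult[of f "-1"] by simp

lemma l2_inner_commute: "l2_inner P f g = l2_inner P g f"
  by (simp add: l2_inner_def mult.commute)

lemma l2_inner_lincomb:
  assumes "f \<in> l2 P" "g \<in> l2 P" "h \<in> l2 P"
  shows "l2_inner P (\<lambda>x. a * f x + b * g x) h = a * l2_inner P f h + b * l2_inner P g h"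
proof -
  have "l2_inner P (\<lambda>x. a * f x + b * g x) h = (\<integral>x. a * (f x * h x) + b * (g x * h x) \<partial>P)"
    by (simp add: l2_inner_def algebra_simps)
  then show ?thesis using assms by (simp add: l2_inner_def l2_integrable_mult)
qed

lemma l2_inner_diff_left:
  "f \<in> l2 P \<Longrightarrow> g \<in> l2 P \<Longrightarrow> h \<in> l2 P \<Longrightarrow> l2_inner P (\<lambda>x. f x - g x) h = l2_inner P f h - l2_inner P g h"
  using l2_inner_lincomb[of f g h 1 "-1"] by simp

lemma l2_inner_diff_right:
  "f \<in> l2 P \<Longrightarrow> g \<in> l2 P \<Longrightarrow> h \<in> l2 P \<Longrightarrow> l2_inner P h (\<lambda>x. f x - g x) = l2_inner P h f - l2_inner P h g"
  using l2_inner_diff_left[of f g h] by (simp add: l2_inner_commute[of h])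

lemma l2_inner_add_left:
  "f \<in> l2 P \<Longrightarrow> g \<in> l2 P \<Longrightarrow> h \<in> l2 P \<Longrightarrow> l2_inner P (\<lambda>x. f x + g x) h = l2_inner P f h + l2_inner P g h"
  using l2_inner_lincomb[of f g h 1 1] by simp

lemma l2_inner_cmult_left: "l2_inner P (\<lambda>x. a * f x) g = a * l2_inner P f g"
  by (simp add: l2_inner_def mult.assoc)

lemma l2_inner_cmult_right: "l2_inner P f (\<lambda>x. a * g x) = a * l2_inner P f g"
  by (simp add: l2_inner_def mult.left_commute)

lemma l2_inner_uminus: "l2_inner P (\<lambda>x. - f x) g = - l2_inner P f g" "l2_inner P f (\<lambda>x. - g x) = - l2_inner P f g"
  by (simp_all add: l2_inner_def)

lemma l2_inner_cong_AE:
  assumes "AE x in P. f x = f' x" "AE x in P. g x = g' x"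
    "f \<in> borel_measurable P" "f' \<in> borel_measurable P" "g \<in> borel_measurable P" "g' \<in> borel_measurable P"
  shows "l2_inner P f g = l2_inner P f' g'"
  unfolding l2_inner_def using assms by (intro integral_cong_AE) auto

lemma l2_norm_cong_AE:
  assumes "AE x in P. f x = f' x" "f \<in> borel_measurable P" "f' \<in> borel_measurable P"
  shows "l2_norm P f = l2_norm P f'"
  unfolding l2_norm_def using l2_inner_cong_AE[OF assms(1,1,2,3,2,3)] by simp

lemma l2_inner_nonneg: "l2_inner P f f \<ge> 0"
  by (simp add: l2_inner_def)

lemma l2_norm_nonneg: "l2_norm P f \<ge> 0"
  by (simp add: l2_norm_def l2_inner_nonneg)

lemma l2_norm_square: "(l2_norm P f)\<^sup>2 = l2_inner P f f"
  by (simp add: l2_norm_def l2_inner_nonneg)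

lemma l2_norm_cmult: "l2_norm P (\<lambda>x. a * f x) = \<bar>a\<bar> * l2_norm P f"
  by (simp add: l2_norm_def l2_inner_cmult_left l2_inner_cmult_right real_sqrt_mult mult.assoc[symmetric])

lemma l2_norm_uminus: "l2_norm P (\<lambda>x. - f x) = l2_norm P f"
  by (simp add: l2_norm_def l2_inner_uminus)

lemma l2_norm_minus_commute: "l2_norm P (\<lambda>x. f x - g x) = l2_norm P (\<lambda>x. g x - f x)"
  using l2_norm_uminus[of "\<lambda>x. f x - g x"] by simp

lemma l2_norm_eq_0_iff:
  assumes "f \<in> l2 P" shows "l2_norm P f = 0 \<longleftrightarrow> (AE x in P. f x = 0)"
proof -
  have "l2_norm P f = 0 \<longleftrightarrow> (\<integral>x. (f x)\<^sup>2 \<partial>P) = 0"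
    by (simp add: l2_norm_def l2_inner_def power2_eq_square)
  also have "\<dots> \<longleftrightarrow> (AE x in P. (f x)\<^sup>2 = 0)"
    using l2_integrable_square[OF assms] by (intro integral_nonneg_eq_0_iff_AE) auto
  finally show ?thesis by simp
qed

lemma l2_norm_square_diff:
  assumes "f \<in> l2 P" "g \<in> l2 P"
  shows "(l2_norm P (\<lambda>x. f x - a * g x))\<^sup>2 = (l2_norm P f)\<^sup>2 - 2 * a * l2_inner P f g + a\<^sup>2 * (l2_norm P g)\<^sup>2"
  unfolding l2_norm_square using assms
  by (simp add: l2_inner_diff_left l2_inner_diff_right l2_cmult l2_diff
      l2_inner_cmult_left l2_inner_cmult_right l2_inner_commute[of g f] power2_eq_square algebra_simps)

lemma l2_Cauchy_Schwarz:
  assumes "f \<in> l2 P" "g \<in> l2 P"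
  shows "\<bar>l2_inner P f g\<bar> \<le> l2_norm P f * l2_norm P g"
proof (cases "l2_norm P g = 0")
  case True
  then have "AE x in P. g x = 0" using l2_norm_eq_0_iff[OF assms(2)] by simp
  then have "l2_inner P f g = l2_inner P f (\<lambda>x. 0)"
    using assms l2_measurable by (intro l2_inner_cong_AE) auto
  then show ?thesis using True by (simp add: l2_inner_def)
next
  case False
  then have pos: "(l2_norm P g)\<^sup>2 > 0" by simp
  define a where "a = l2_inner P f g / (l2_norm P g)\<^sup>2"
  have "0 \<le> (l2_norm P (\<lambda>x. f x - a * g x))\<^sup>2" by simp
  also have "\<dots> = (l2_norm P f)\<^sup>2 - (l2_inner P f g)\<^sup>2 / (l2_norm P g)\<^sup>2"
    unfolding l2_norm_square_diff[OF assms] using pos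
    by (simp add: a_def field_simps power2_eq_square)
  finally have "(l2_inner P f g)\<^sup>2 \<le> (l2_norm P f * l2_norm P g)\<^sup>2"
    using pos by (simp add: field_simps power_mult_distrib)
  then show ?thesis
    using abs_le_square_iff[of "l2_inner P f g" "l2_norm P f * l2_norm P g"] l2_norm_nonneg by simp
qed

lemma l2_norm_triangle:
  assumes "f \<in> l2 P" "g \<in> l2 P"
  shows "l2_norm P (\<lambda>x. f x + g x) \<le> l2_norm P f + l2_norm P g"
proof (rule power2_le_imp_le)
  have "(l2_norm P (\<lambda>x. f x + g x))\<^sup>2 = (l2_norm P f)\<^sup>2 + 2 * l2_inner P f g + (l2_norm P g)\<^sup>2"
    using l2_norm_square_diff[OF assms, of "-1"] by simp
  also have "\<dots> \<le> (l2_norm P f + l2_norm P g)\<^sup>2"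
    using l2_Cauchy_Schwarz[OF assms] by (simp add: power2_sum)
  finally show "(l2_norm P (\<lambda>x. f x + g x))\<^sup>2 \<le> (l2_norm P f + l2_norm P g)\<^sup>2" .
qed (simp add: l2_norm_nonneg)

lemma l2_norm_diff_triangle:
  assumes "f \<in> l2 P" "g \<in> l2 P" "h \<in> l2 P"
  shows "l2_norm P (\<lambda>x. f x - h x) \<le> l2_norm P (\<lambda>x. f x - g x) + l2_norm P (\<lambda>x. g x - h x)"
  using l2_norm_triangle[OF l2_diff[OF assms(1,2)] l2_diff[OF assms(2,3)]] by simp

lemma l2_norm_le_diff:
  assumes "f \<in> l2 P" "g \<in> l2 P"
  shows "l2_norm P f \<le> l2_norm P (\<lambda>x. f x - g x) + l2_norm P g"
  using l2_norm_triangle[OF l2_diff[OF assms] assms(2)] by simp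

lemma l2_tendsto_inner:
  assumes "\<And>n. f n \<in> l2 P" "g \<in> l2 P" "h \<in> l2 P" "((\<lambda>n. l2_norm P (\<lambda>x. f n x - g x)) \<longlongrightarrow> 0) F"
  shows "((\<lambda>n. l2_inner P (f n) h) \<longlongrightarrow> l2_inner P g h) F"
proof -
  have "((\<lambda>n. l2_inner P (f n) h - l2_inner P g h) \<longlongrightarrow> 0) F"
  proof (rule Lim_null_comparison)
    show "\<forall>\<^sub>F n in F. norm (l2_inner P (f n) h - l2_inner P g h) \<le> l2_norm P (\<lambda>x. f n x - g x) * l2_norm P h"
      using l2_Cauchy_Schwarz[OF l2_diff[OF assms(1,2)] assms(3)] l2_inner_diff_left[OF assms(1,2,3)] by simp
    show "((\<lambda>n. l2_norm P (\<lambda>x. f n x - g x) * l2_norm P h) \<longlongrightarrow> 0) F"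
      by (rule tendsto_mult_left_zero[OF assms(4)])
  qed
  then show ?thesis by (rule LIM_zero_cancel)
qed

text \<open>Along a rapidly convergent subsequence the increments are summable in the norm, hence
  almost everywhere, and Fatou's lemma identifies the pointwise limit as the limit in the norm.\<close>

lemma l2_complete:
  assumes f: "\<And>n. f n \<in> l2 P"
    and Cauchy: "\<And>e. e > 0 \<Longrightarrow> \<exists>N. \<forall>m\<ge>N. \<forall>n\<ge>N. l2_norm P (\<lambda>x. f m x - f n x) < e"
  obtains g where "g \<in> l2 P" "(\<lambda>n. l2_norm P (\<lambda>x. f n x - g x)) \<longlonglongrightarrow> 0"
proof -
  have nn: "(\<integral>\<^sup>+x. ennreal ((h x)\<^sup>2) \<partial>P) = ennreal ((l2_norm P h)\<^sup>2)" if "h \<in> l2 P" for h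
    using nn_integral_eq_integral[OF l2_integrable_square[OF that]]
    unfolding l2_norm_square by (simp add: l2_inner_def power2_eq_square)
  have "\<exists>N. \<forall>m\<ge>N. \<forall>n\<ge>N. l2_norm P (\<lambda>x. f m x - f n x) < (1/4) ^ k" for k :: nat
    by (rule Cauchy) simp
  then obtain N where N: "\<And>k m n. m \<ge> N k \<Longrightarrow> n \<ge> N k \<Longrightarrow> l2_norm P (\<lambda>x. f m x - f n x) < (1/4) ^ k"
    by metis
  define r where "r k = (\<Sum>j\<le>k. N j)" for k
  have r: "r k \<ge> N k" "r k \<le> r (Suc k)" for k by (auto simp: r_def member_le_sum)
  have mono: "r j \<le> r k" if "j \<le> k" for j k using r(2) that lift_Suc_mono_le[of r] by blast
  have meas[measurable]: "f n \<in> borel_measurable P" for n using f l2_measurable by blast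
  define d where "d k x = \<bar>f (r (Suc k)) x - f (r k) x\<bar>" for k x
  have d_l2: "d k \<in> l2 P" for k
    using l2_diff[OF f f, of "r (Suc k)" "r k"] unfolding l2_def d_def by simp
  have small: "AE x in P. \<exists>K. \<forall>k\<ge>K. d k x \<le> (1/2) ^ k"
  proof -
    \<comment> \<open>The weight \<open>2 ^ k\<close> uses up only part of the decay
      \<open>(1/4) ^ k\<close> of the norms: the squared norms stay summable, and finiteness of the
      weighted sum at a point forces \<open>d k x \<le> (1/2) ^ k\<close> eventually.\<close>
    have "(\<Sum>k. \<integral>\<^sup>+x. ennreal ((2 ^ k * d k x)\<^sup>2) \<partial>P) \<le> (\<Sum>k. ennreal ((1/4) ^ k))"
    proof (intro suminf_le allI summableI)
      fix k
      have "l2_norm P (d k) = l2_norm P (\<lambda>x. f (r (Suc k)) x - f (r k) x)"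
        by (simp add: l2_norm_def l2_inner_def d_def)
      also have "\<dots> \<le> (1/4) ^ k" using N[of k "r (Suc k)" "r k"] r[of k] by simp
      finally have "l2_norm P (\<lambda>x. 2 ^ k * d k x) \<le> 2 ^ k * (1/4) ^ k"
        by (simp add: l2_norm_cmult)
      also have "\<dots> = (1/2) ^ k" by (simp add: power_mult_distrib[symmetric])
      finally have "(l2_norm P (\<lambda>x. 2 ^ k * d k x))\<^sup>2 \<le> ((1/2) ^ k)\<^sup>2"
        by (intro power_mono l2_norm_nonneg)
      also have "\<dots> = (1/4) ^ k" by (simp add: power2_eq_square power_mult_distrib[symmetric])
      finally show "(\<integral>\<^sup>+x. ennreal ((2 ^ k * d k x)\<^sup>2) \<partial>P) \<le> ennreal ((1/4) ^ k)"
        by (simp add: nn[OF l2_cmult[OF d_l2]] ennreal_leI)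
    qed
    also have "\<dots> < \<infinity>" by (subst suminf_ennreal2) (auto intro: summable_geometric)
    finally have "(\<integral>\<^sup>+x. (\<Sum>k. ennreal ((2 ^ k * d k x)\<^sup>2)) \<partial>P) < \<infinity>"
      by (subst nn_integral_suminf) (auto simp: d_def)
    then have "AE x in P. (\<Sum>k. ennreal ((2 ^ k * d k x)\<^sup>2)) \<noteq> \<infinity>"
      by (intro nn_integral_PInf_AE) (auto simp: d_def)
    then show ?thesis
    proof eventually_elim
      case (elim x)
      then have "summable (\<lambda>k. (2 ^ k * d k x)\<^sup>2)"
        by (intro summable_suminf_not_top) (auto simp: infinity_ennreal_def)
      then have "(\<lambda>k. (2 ^ k * d k x)\<^sup>2) \<longlonglongrightarrow> 0" by (rule summable_LIMSEQ_zero)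
      then have "\<forall>\<^sub>F k in sequentially. (2 ^ k * d k x)\<^sup>2 < 1" by (rule order_tendstoD(2)) simp
      then obtain K where K: "\<And>k. k \<ge> K \<Longrightarrow> (2 ^ k * d k x)\<^sup>2 < 1"
        unfolding eventually_sequentially by blast
      have "d k x \<le> (1/2) ^ k" if "k \<ge> K" for k
      proof -
        have "2 ^ k * d k x < 1" using K[OF that] by (simp add: power_less_one_iff abs_square_less_1)
        then show ?thesis by (simp add: field_simps power_one_over)
      qed
      then show ?case by blast
    qed
  qed
  define g where "g x = lim (\<lambda>k. f (r k) x)" for x
  have g_meas[measurable]: "g \<in> borel_measurable P"
    unfolding g_def by (rule borel_measurable_lim_metric) simp
  have conv: "AE x in P. (\<lambda>k. f (r k) x) \<longlonglongrightarrow> g x"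
    using small
  proof eventually_elim
    case (elim x)
    then obtain K where K: "\<And>k. k \<ge> K \<Longrightarrow> d k x \<le> (1/2) ^ k" by blast
    have "summable (\<lambda>k. f (r (Suc k)) x - f (r k) x)"
      by (rule summable_comparison_test[of _ "\<lambda>k. (1/2) ^ k"])
         (use K in \<open>auto simp: d_def intro!: exI[of _ K] summable_geometric\<close>)
    then have "convergent (\<lambda>n. \<Sum>k<n. f (r (Suc k)) x - f (r k) x)" by (simp add: summable_iff_convergent)
    then have "convergent (\<lambda>n. f (r n) x - f (r 0) x)" by (simp only: sum_lessThan_telescope[of "\<lambda>k. f (r k) x"])
    then have "convergent (\<lambda>n. f (r n) x)"
      using convergent_add_const_right_iff[of "\<lambda>n. f (r n) x" "- f (r 0) x"] by simp
    then show ?case unfolding g_def by (simp add: convergent_LIMSEQ_iff)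
  qed
  have fatou: "(\<integral>\<^sup>+x. ennreal ((f n x - g x)\<^sup>2) \<partial>P) \<le> ennreal (((1/4) ^ k)\<^sup>2)" if n: "n \<ge> N k" for n k
  proof -
    have "(\<integral>\<^sup>+x. ennreal ((f n x - g x)\<^sup>2) \<partial>P) = (\<integral>\<^sup>+x. liminf (\<lambda>j. ennreal ((f n x - f (r j) x)\<^sup>2)) \<partial>P)"
    proof (rule nn_integral_cong_AE, use conv in eventually_elim)
      fix x assume "(\<lambda>k. f (r k) x) \<longlonglongrightarrow> g x"
      then have "(\<lambda>j. ennreal ((f n x - f (r j) x)\<^sup>2)) \<longlonglongrightarrow> ennreal ((f n x - g x)\<^sup>2)"
        by (intro tendsto_intros)
      then show "ennreal ((f n x - g x)\<^sup>2) = liminf (\<lambda>j. ennreal ((f n x - f (r j) x)\<^sup>2))"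
        using lim_imp_Liminf[OF sequentially_bot] by metis
    qed
    also have "\<dots> \<le> liminf (\<lambda>j. \<integral>\<^sup>+x. ennreal ((f n x - f (r j) x)\<^sup>2) \<partial>P)"
      by (rule nn_integral_liminf) simp
    also have "\<dots> = liminf (\<lambda>j. ennreal ((l2_norm P (\<lambda>x. f n x - f (r j) x))\<^sup>2))"
      by (simp add: nn l2_diff f)
    also have "\<dots> \<le> ennreal (((1/4) ^ k)\<^sup>2)"
    proof (rule Liminf_le)
      show "\<forall>\<^sub>F j in sequentially. ennreal ((l2_norm P (\<lambda>x. f n x - f (r j) x))\<^sup>2) \<le> ennreal (((1/4) ^ k)\<^sup>2)"
      proof (rule eventually_sequentiallyI[of k])
        fix j assume "k \<le> j"
        then have "r j \<ge> N k" using r(1)[of k] mono[of k j] by linarith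
        then have "l2_norm P (\<lambda>x. f n x - f (r j) x) \<le> (1/4) ^ k" using N[OF n] less_imp_le by blast
        then show "ennreal ((l2_norm P (\<lambda>x. f n x - f (r j) x))\<^sup>2) \<le> ennreal (((1/4) ^ k)\<^sup>2)"
          by (intro ennreal_leI power_mono l2_norm_nonneg)
      qed
    qed simp
    finally show ?thesis .
  qed
  have diff_l2: "(\<lambda>x. f n x - g x) \<in> l2 P" if "n \<ge> N 0" for n
  proof -
    have "integrable P (\<lambda>x. (f n x - g x)\<^sup>2)"
      by (rule integrableI_bounded) (use le_less_trans[OF fatou[OF that] ennreal_less_top] in auto)
    then show ?thesis by (simp add: l2_def)
  qed
  have g_l2: "g \<in> l2 P"
    using l2_diff[OF f diff_l2[OF order_refl], of "N 0"] by simp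
  have "(\<lambda>n. l2_norm P (\<lambda>x. f n x - g x)) \<longlonglongrightarrow> 0"
  proof (rule LIMSEQ_I)
    fix e :: real assume "e > 0"
    then obtain k where k: "(1/4::real) ^ k < e" using real_arch_pow_inv[of e "1/4"] by auto
    have "l2_norm P (\<lambda>x. f n x - g x) \<le> (1/4) ^ k" if n: "n \<ge> N k" for n
    proof -
      have "ennreal ((l2_norm P (\<lambda>x. f n x - g x))\<^sup>2) \<le> ennreal (((1/4) ^ k)\<^sup>2)"
        using fatou[OF n] nn[OF l2_diff[OF f g_l2]] by simp
      then have "(l2_norm P (\<lambda>x. f n x - g x))\<^sup>2 \<le> ((1/4) ^ k)\<^sup>2" by (simp add: ennreal_le_iff)
      then show ?thesis by (rule power2_le_imp_le) simp
    qed
    then show "\<exists>no. \<forall>n\<ge>no. norm (l2_norm P (\<lambda>x. f n x - g x) - 0) < e"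
      using k l2_norm_nonneg by (intro exI[of _ "N k"]) (auto intro: le_less_trans)
  qed
  with g_l2 show ?thesis by (rule that)
qed

end

section \<open>Self-adjoint contraction semigroups and the spectral gap\<close>

text \<open>Contraction and preservation of constants are what a Markov semigroup with invariant law
  \<open>P\<close> provides beyond \<open>generates_semigroup\<close>. Symmetry of
  \<open>T s\<close> is not assumed; it is derived from self-adjointness of the generator.\<close>

locale selfadjoint_semigroup =
  fixes P :: "'a measure" and G :: "'a l2_graph" and T :: "real \<Rightarrow> ('a \<Rightarrow> real) \<Rightarrow> 'a \<Rightarrow> real"
  assumes prob: "prob_space P"
    and gen: "generates_semigroup P G T"
    and sa: "self_adjoint P (neg_op G)"
    and contraction: "\<And>s f. s \<ge> 0 \<Longrightarrow> f \<in> l2 P \<Longrightarrow> l2_norm P (T s f) \<le> l2_norm P f"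
    and T_one: "\<And>s. s \<ge> 0 \<Longrightarrow> AE x in P. T s (\<lambda>_. 1) x = 1"
begin

abbreviation inn ("\<langle>_, _\<rangle>") where "inn f g \<equiv> l2_inner P f g"
abbreviation nrm ("\<parallel>_\<parallel>") where "nrm f \<equiv> l2_norm P f"

lemma const_l2: "(\<lambda>_. c) \<in> l2 P"
proof -
  interpret prob_space P by (rule prob)
  show ?thesis by (simp add: l2_def)
qed

lemma T_l2: "s \<ge> 0 \<Longrightarrow> f \<in> l2 P \<Longrightarrow> T s f \<in> l2 P"
  using gen unfolding generates_semigroup_def by blast

lemma T_lincomb: "s \<ge> 0 \<Longrightarrow> f \<in> l2 P \<Longrightarrow> g \<in> l2 P \<Longrightarrow>
    AE x in P. T s (\<lambda>y. a * f y + b * g y) x = a * T s f x + b * T s g x"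
  using gen unfolding generates_semigroup_def by blast

lemma T_zero: "f \<in> l2 P \<Longrightarrow> AE x in P. T 0 f x = f x"
  using gen unfolding generates_semigroup_def by blast

lemma T_add: "s \<ge> 0 \<Longrightarrow> r \<ge> 0 \<Longrightarrow> f \<in> l2 P \<Longrightarrow> AE x in P. T (s + r) f x = T s (T r f) x"
  using gen unfolding generates_semigroup_def by blast

lemma T_continuous: "f \<in> l2 P \<Longrightarrow> ((\<lambda>s. \<parallel>\<lambda>x. T s f x - f x\<parallel>) \<longlongrightarrow> 0) (at_right 0)"
  using gen unfolding generates_semigroup_def by blast

lemma generator_iff: "(f, g) \<in> G \<longleftrightarrow> f \<in> l2 P \<and> g \<in> l2 P \<and>
    ((\<lambda>s. \<parallel>\<lambda>x. (T s f x - f x) / s - g x\<parallel>) \<longlongrightarrow> 0) (at_right 0)"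
  using gen unfolding generates_semigroup_def by blast

lemma generator_l2: "(f, g) \<in> G \<Longrightarrow> f \<in> l2 P" "(f, g) \<in> G \<Longrightarrow> g \<in> l2 P"
  by (auto simp: generator_iff)

lemma neg_op_iff: "(f, g) \<in> neg_op G \<longleftrightarrow> (f, \<lambda>x. - g x) \<in> G"
proof
  show "(f, \<lambda>x. - g x) \<in> G" if "(f, g) \<in> neg_op G"
    using that by (auto simp: neg_op_def)
  show "(f, g) \<in> neg_op G" if "(f, \<lambda>x. - g x) \<in> G"
    using that by (auto simp: neg_op_def intro!: exI[of _ "\<lambda>x. - g x"])
qed

text \<open>Self-adjointness as a membership test for the graph: the adjoint relation against all of
  \<open>G\<close> suffices. The two sign changes hidden in \<open>neg_op\<close> cancel.\<close>

lemma adjoint_iff: "(f, g) \<in> G \<longleftrightarrow> f \<in> l2 P \<and> g \<in> l2 P \<and> (\<forall>u v. (u, v) \<in> G \<longrightarrow> \<langle>f, v\<rangle> = \<langle>g, u\<rangle>)"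
proof -
  have "(f, g) \<in> G \<longleftrightarrow> (f, \<lambda>x. - g x) \<in> l2_adjoint P (neg_op G)"
    using sa by (simp add: self_adjoint_def neg_op_iff)
  also have "\<dots> \<longleftrightarrow> f \<in> l2 P \<and> g \<in> l2 P \<and> (\<forall>u v. (u, \<lambda>x. - v x) \<in> G \<longrightarrow> \<langle>f, v\<rangle> = - \<langle>g, u\<rangle>)"
    using l2_uminus[of g P] l2_uminus[of "\<lambda>x. - g x" P]
    by (auto simp: l2_adjoint_def neg_op_iff l2_inner_uminus Ball_def split_paired_All)
  also have "(\<forall>u v. (u, \<lambda>x. - v x) \<in> G \<longrightarrow> \<langle>f, v\<rangle> = - \<langle>g, u\<rangle>) \<longleftrightarrow> (\<forall>u v. (u, v) \<in> G \<longrightarrow> \<langle>f, v\<rangle> = \<langle>g, u\<rangle>)"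
  proof (intro iffI allI impI)
    fix u v assume *: "\<forall>u v. (u, \<lambda>x. - v x) \<in> G \<longrightarrow> \<langle>f, v\<rangle> = - \<langle>g, u\<rangle>" "(u, v) \<in> G"
    from *(1)[rule_format, of u "\<lambda>x. - v x"] *(2) show "\<langle>f, v\<rangle> = \<langle>g, u\<rangle>" by (simp add: l2_inner_uminus)
  next
    fix u v assume *: "\<forall>u v. (u, v) \<in> G \<longrightarrow> \<langle>f, v\<rangle> = \<langle>g, u\<rangle>" "(u, \<lambda>x. - v x) \<in> G"
    from *(1)[rule_format, OF *(2)] show "\<langle>f, v\<rangle> = - \<langle>g, u\<rangle>" by (simp add: l2_inner_uminus)
  qed
  finally show ?thesis .
qed

lemma generator_symmetric: "(f, g) \<in> G \<Longrightarrow> (u, v) \<in> G \<Longrightarrow> \<langle>f, v\<rangle> = \<langle>g, u\<rangle>"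
  using adjoint_iff by blast

text \<open>\<open>T s\<close> is linear only up to null sets, so this is read off the adjoint
  relation, where bilinearity of the inner product suffices.\<close>

lemma generator_lincomb:
  assumes "(f, g) \<in> G" "(f', g') \<in> G"
  shows "(\<lambda>x. a * f x + b * f' x, \<lambda>x. a * g x + b * g' x) \<in> G"
proof -
  have "\<langle>\<lambda>x. a * f x + b * f' x, v\<rangle> = \<langle>\<lambda>x. a * g x + b * g' x, u\<rangle>" if "(u, v) \<in> G" for u v
    using that assms generator_l2 by (simp add: l2_inner_lincomb generator_symmetric[of _ _ u v])
  then show ?thesis using assms generator_l2 by (subst adjoint_iff) (auto intro: l2_lincomb)
qed

lemma generator_dense:
  assumes "f \<in> l2 P" "e > 0"
  obtains u v where "(u, v) \<in> G" "\<parallel>\<lambda>x. u x - f x\<parallel> < e"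
proof -
  obtain u v where "(u, v) \<in> neg_op G" "\<parallel>\<lambda>x. u x - f x\<parallel> < e"
    using sa assms unfolding self_adjoint_def by blast
  then show ?thesis using that neg_op_iff by blast
qed

section \<open>Contraction estimates and differentiation in time\<close>

lemma T_diff:
  assumes "s \<ge> 0" "f \<in> l2 P" "g \<in> l2 P"
  shows "AE x in P. T s (\<lambda>y. f y - g y) x = T s f x - T s g x"
  using T_lincomb[OF assms, of 1 "-1"] by simp

lemma T_diff_norm:
  assumes "s \<ge> 0" "f \<in> l2 P" "g \<in> l2 P"
  shows "\<parallel>\<lambda>x. T s f x - T s g x\<parallel> \<le> \<parallel>\<lambda>x. f x - g x\<parallel>"
proof -
  have "\<parallel>\<lambda>x. T s f x - T s g x\<parallel> = \<parallel>T s (\<lambda>y. f y - g y)\<parallel>"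
    using T_diff[OF assms] assms by (intro l2_norm_cong_AE) (auto intro!: l2_measurable T_l2 l2_diff)
  then show ?thesis using contraction[OF assms(1) l2_diff[OF assms(2,3)]] by simp
qed

lemma T_add_norm:
  assumes "s \<ge> 0" "r \<ge> 0" "f \<in> l2 P"
  shows "\<parallel>T (s + r) f\<parallel> = \<parallel>T s (T r f)\<parallel>"
  using T_add[OF assms] assms by (intro l2_norm_cong_AE) (auto intro!: l2_measurable T_l2)

lemma T_increment:
  assumes "s \<ge> 0" "d \<ge> 0" "f \<in> l2 P"
  shows "\<parallel>\<lambda>x. T (s + d) f x - T s f x\<parallel> \<le> \<parallel>\<lambda>x. T d f x - f x\<parallel>"
proof -
  have "\<parallel>\<lambda>x. T (s + d) f x - T s f x\<parallel> = \<parallel>\<lambda>x. T s (T d f) x - T s f x\<parallel>"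
    using T_add[OF assms] assms by (intro l2_norm_cong_AE) (auto intro!: l2_measurable T_l2 l2_diff)
  then show ?thesis using T_diff_norm[OF assms(1) T_l2[OF assms(2,3)] assms(3)] by simp
qed

text \<open>\<open>T s\<close> commutes with difference quotients and contracts, so convergence at
  time 0 is inherited uniformly in \<open>s\<close>. That uniformity yields derivatives at all
  positive times and the partition argument for symmetry.\<close>

lemma T_quotient_norm:
  assumes "s \<ge> 0" "d > 0" "f \<in> l2 P" "g \<in> l2 P"
  shows "\<parallel>\<lambda>x. (T (s + d) f x - T s f x) / d - T s g x\<parallel> \<le> \<parallel>\<lambda>x. (T d f x - f x) / d - g x\<parallel>"
proof -
  note Td = T_l2[OF less_imp_le[OF assms(2)] assms(3)]
  have q: "(\<lambda>x. (T d f x - f x) / d) \<in> l2 P"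
    using l2_cmult[OF l2_diff[OF Td assms(3)], of "1 / d"] by simp
  have "AE x in P. T s (\<lambda>x. (1 / d) * T d f x + (- 1 / d) * f x) x = (1 / d) * T s (T d f) x + (- 1 / d) * T s f x"
    by (rule T_lincomb[OF assms(1) Td assms(3)])
  then have "AE x in P. (T (s + d) f x - T s f x) / d = T s (\<lambda>x. (T d f x - f x) / d) x"
    using T_add[OF assms(1) less_imp_le[OF assms(2)] assms(3)]
  proof eventually_elim
    case (elim x)
    then show ?case by (simp add: diff_divide_distrib)
  qed
  then have "\<parallel>\<lambda>x. (T (s + d) f x - T s f x) / d - T s g x\<parallel> = \<parallel>\<lambda>x. T s (\<lambda>x. (T d f x - f x) / d) x - T s g x\<parallel>"
    using assms q T_l2 l2_measurable l2_diff by (intro l2_norm_cong_AE) (auto intro!: borel_measurable_diff borel_measurable_divide)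
  then show ?thesis using T_diff_norm[OF assms(1) q assms(4)] by simp
qed

lemma T_generator:
  assumes "s \<ge> 0" "(f, g) \<in> G"
  shows "(T s f, T s g) \<in> G"
proof -
  note fg = generator_l2[OF assms(2)]
  have "((\<lambda>d. \<parallel>\<lambda>x. (T d (T s f) x - T s f x) / d - T s g x\<parallel>) \<longlongrightarrow> 0) (at_right 0)"
  proof (rule Lim_null_comparison)
    show "((\<lambda>d. \<parallel>\<lambda>x. (T d f x - f x) / d - g x\<parallel>) \<longlongrightarrow> 0) (at_right 0)"
      using assms(2) generator_iff by blast
    have "norm \<parallel>\<lambda>x. (T d (T s f) x - T s f x) / d - T s g x\<parallel> \<le> \<parallel>\<lambda>x. (T d f x - f x) / d - g x\<parallel>" if d: "d > 0" for d
    proof -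
      have "\<parallel>\<lambda>x. (T d (T s f) x - T s f x) / d - T s g x\<parallel> = \<parallel>\<lambda>x. (T (s + d) f x - T s f x) / d - T s g x\<parallel>"
        using T_add[of d s f] assms(1) d fg T_l2 l2_measurable
        by (intro l2_norm_cong_AE) (auto simp: add.commute intro!: borel_measurable_diff borel_measurable_divide)
      then show ?thesis using T_quotient_norm[OF assms(1) d fg] by (simp add: l2_norm_nonneg)
    qed
    then show "\<forall>\<^sub>F d in at_right 0. norm \<parallel>\<lambda>x. (T d (T s f) x - T s f x) / d - T s g x\<parallel> \<le> \<parallel>\<lambda>x. (T d f x - f x) / d - g x\<parallel>"
      by (intro eventually_at_rightI[of 0 1]) auto
  qed
  then show ?thesis using fg assms(1) T_l2 generator_iff by blast
qed

lemma T_inner_increment: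
  assumes "a \<ge> 0" "b \<ge> 0" "f \<in> l2 P" "h \<in> l2 P"
  shows "\<bar>\<langle>T a f, h\<rangle> - \<langle>T b f, h\<rangle>\<bar> \<le> \<parallel>\<lambda>x. T \<bar>a - b\<bar> f x - f x\<parallel> * \<parallel>h\<parallel>"
proof -
  have *: "\<bar>\<langle>T (s + d) f, h\<rangle> - \<langle>T s f, h\<rangle>\<bar> \<le> \<parallel>\<lambda>x. T d f x - f x\<parallel> * \<parallel>h\<parallel>" if "s \<ge> 0" "d \<ge> 0" for s d
  proof -
    have "\<bar>\<langle>T (s + d) f, h\<rangle> - \<langle>T s f, h\<rangle>\<bar> = \<bar>\<langle>\<lambda>x. T (s + d) f x - T s f x, h\<rangle>\<bar>"
      using that assms by (simp add: l2_inner_diff_left T_l2)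
    also have "\<dots> \<le> \<parallel>\<lambda>x. T (s + d) f x - T s f x\<parallel> * \<parallel>h\<parallel>"
      using that assms by (intro l2_Cauchy_Schwarz l2_diff T_l2) auto
    also have "\<dots> \<le> \<parallel>\<lambda>x. T d f x - f x\<parallel> * \<parallel>h\<parallel>"
      by (intro mult_right_mono T_increment that assms l2_norm_nonneg)
    finally show ?thesis .
  qed
  show ?thesis
  proof (cases "a \<le> b")
    case True
    then show ?thesis using *[of a "b - a"] assms by (simp add: abs_minus_commute)
  next
    case False
    then show ?thesis using *[of b "a - b"] assms by simp
  qed
qed

lemma small_at_right:
  fixes E :: "real \<Rightarrow> real"
  assumes "((\<lambda>s. E s) \<longlongrightarrow> (0::real)) (at_right 0)" "e > 0"
  obtains d where "d > 0" "\<And>s. 0 < s \<Longrightarrow> s < d \<Longrightarrow> \<bar>E s\<bar> < e"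
proof -
  have "\<forall>\<^sub>F s in at_right 0. \<bar>E s\<bar> < e" using tendstoD[OF assms] by simp
  then show ?thesis using that unfolding eventually_at_right_field by blast
qed

lemma continuous_T_inner:
  assumes "f \<in> l2 P" "h \<in> l2 P"
  shows "continuous_on {0..} (\<lambda>s. \<langle>T s f, h\<rangle>)"
proof (rule continuous_onI)
  fix s e :: real assume s: "s \<in> {0..}" and e: "e > 0"
  have "((\<lambda>d. \<parallel>\<lambda>x. T d f x - f x\<parallel> * \<parallel>h\<parallel>) \<longlongrightarrow> 0) (at_right 0)"
    by (rule tendsto_mult_left_zero[OF T_continuous[OF assms(1)]])
  then obtain d where d: "d > 0" "\<And>s. 0 < s \<Longrightarrow> s < d \<Longrightarrow> \<bar>\<parallel>\<lambda>x. T s f x - f x\<parallel> * \<parallel>h\<parallel>\<bar> < e"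
    using small_at_right[OF _ e] by blast
  show "\<exists>d>0. \<forall>s'\<in>{0..}. dist s' s < d \<longrightarrow> dist \<langle>T s' f, h\<rangle> \<langle>T s f, h\<rangle> \<le> e"
  proof (intro exI[of _ d] conjI ballI impI d(1))
    fix s' assume s': "s' \<in> {0..}" "dist s' s < d"
    show "dist \<langle>T s' f, h\<rangle> \<langle>T s f, h\<rangle> \<le> e"
    proof (cases "s' = s")
      case False
      then show ?thesis
        using T_inner_increment[of s' s f h] d(2)[of "\<bar>s' - s\<bar>"] s s' assms by (simp add: dist_real_def)
    qed (use e in simp)
  qed
qed

lemma T_inner_DERIV:
  assumes "(f, g) \<in> G" "h \<in> l2 P" "s > 0"
  shows "((\<lambda>s. \<langle>T s f, h\<rangle>) has_real_derivative \<langle>T s g, h\<rangle>) (at s)"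
  unfolding DERIV_def
proof (rule LIM_I)
  fix e :: real assume e: "e > 0"
  note fg = generator_l2[OF assms(1)]
  define E where "E d = (\<parallel>\<lambda>x. (T d f x - f x) / d - g x\<parallel> + \<parallel>\<lambda>x. T d g x - g x\<parallel>) * \<parallel>h\<parallel>" for d
  have "(E \<longlongrightarrow> (0 + 0) * \<parallel>h\<parallel>) (at_right 0)"
    unfolding E_def using assms(1) fg generator_iff
    by (intro tendsto_mult tendsto_add T_continuous tendsto_const) blast+
  then have "(E \<longlongrightarrow> 0) (at_right 0)" by simp
  from small_at_right[OF this e] obtain d where d: "d > 0" "\<And>s. 0 < s \<Longrightarrow> s < d \<Longrightarrow> \<bar>E s\<bar> < e" by auto
  have right: "\<bar>(\<langle>T (r + k) f, h\<rangle> - \<langle>T r f, h\<rangle>) / k - \<langle>T r g, h\<rangle>\<bar> \<le> \<parallel>\<lambda>x. (T k f x - f x) / k - g x\<parallel> * \<parallel>h\<parallel>"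
    if "r \<ge> 0" "k > 0" for r k :: real
  proof -
    have l: "(\<lambda>x. (1 / k) * (T (r + k) f x - T r f x) - T r g x) \<in> l2 P"
      using that fg by (intro l2_diff l2_cmult T_l2) auto
    have "(\<langle>T (r + k) f, h\<rangle> - \<langle>T r f, h\<rangle>) / k - \<langle>T r g, h\<rangle> = \<langle>\<lambda>x. (1 / k) * (T (r + k) f x - T r f x) - T r g x, h\<rangle>"
      using that fg assms(2)
      by (simp only: l2_inner_diff_left l2_diff l2_cmult T_l2 l2_inner_cmult_left less_imp_le add_nonneg_nonneg) simp
    then have "\<bar>(\<langle>T (r + k) f, h\<rangle> - \<langle>T r f, h\<rangle>) / k - \<langle>T r g, h\<rangle>\<bar>
        \<le> \<parallel>\<lambda>x. (1 / k) * (T (r + k) f x - T r f x) - T r g x\<parallel> * \<parallel>h\<parallel>"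
      using l2_Cauchy_Schwarz[OF l assms(2)] by simp
    also have "\<dots> = \<parallel>\<lambda>x. (T (r + k) f x - T r f x) / k - T r g x\<parallel> * \<parallel>h\<parallel>" by simp
    also have "\<dots> \<le> \<parallel>\<lambda>x. (T k f x - f x) / k - g x\<parallel> * \<parallel>h\<parallel>"
      by (intro mult_right_mono T_quotient_norm that fg l2_norm_nonneg)
    finally show ?thesis .
  qed
  show "\<exists>d>0. \<forall>k. k \<noteq> 0 \<and> norm (k - 0) < d \<longrightarrow> norm ((\<langle>T (s + k) f, h\<rangle> - \<langle>T s f, h\<rangle>) / k - \<langle>T s g, h\<rangle>) < e"
  proof (intro exI[of _ "min d s"] conjI allI impI)
    show "min d s > 0" using d assms by simp
    fix k :: real assume k: "k \<noteq> 0 \<and> norm (k - 0) < min d s"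
    have nn: "\<parallel>\<lambda>x. T \<bar>k\<bar> g x - g x\<parallel> * \<parallel>h\<parallel> \<ge> 0" by (simp add: l2_norm_nonneg)
    have Ek: "E \<bar>k\<bar> < e" using d(2)[of "\<bar>k\<bar>"] k by auto
    show "norm ((\<langle>T (s + k) f, h\<rangle> - \<langle>T s f, h\<rangle>) / k - \<langle>T s g, h\<rangle>) < e"
    proof (cases "k > 0")
      case True
      then show ?thesis using right[of s k] assms(3) nn Ek by (simp add: E_def distrib_right)
    next
      case False
      with k have kn: "k < 0" "s + k > 0" by auto
      \<comment> \<open>The generator is defined by a right limit at time 0. For negative
        \<open>k\<close> the left quotient at \<open>s\<close> is a right quotient based at
        \<open>s + k\<close>, and continuity of \<open>T r g\<close> in \<open>r\<close> moves the
        base back to \<open>s\<close>.\<close>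
      have "\<bar>(\<langle>T s f, h\<rangle> - \<langle>T (s + k) f, h\<rangle>) / - k - \<langle>T (s + k) g, h\<rangle>\<bar> \<le> \<parallel>\<lambda>x. (T (- k) f x - f x) / - k - g x\<parallel> * \<parallel>h\<parallel>"
        using right[of "s + k" "- k"] kn by simp
      moreover have "\<bar>\<langle>T (s + k) g, h\<rangle> - \<langle>T s g, h\<rangle>\<bar> \<le> \<parallel>\<lambda>x. T (- k) g x - g x\<parallel> * \<parallel>h\<parallel>"
        using T_inner_increment[of "s + k" s g h] kn fg assms by simp
      moreover have "(\<langle>T (s + k) f, h\<rangle> - \<langle>T s f, h\<rangle>) / k - \<langle>T s g, h\<rangle>
         = ((\<langle>T s f, h\<rangle> - \<langle>T (s + k) f, h\<rangle>) / - k - \<langle>T (s + k) g, h\<rangle>) + (\<langle>T (s + k) g, h\<rangle> - \<langle>T s g, h\<rangle>)"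
        using kn by (simp add: field_simps)
      ultimately have "\<bar>(\<langle>T (s + k) f, h\<rangle> - \<langle>T s f, h\<rangle>) / k - \<langle>T s g, h\<rangle>\<bar> \<le> E (- k)"
        unfolding E_def distrib_right by linarith
      then show ?thesis using Ek kn by simp
    qed
  qed
qed

text \<open>For \<open>f\<close>, \<open>h\<close> in the domain, \<open>\<langle>T r f, T (s - r) h\<rangle>\<close> is constant in \<open>r\<close>: over a partition of
  \<open>[0, s]\<close> with mesh \<open>d\<close> the increments are \<open>o(d)\<close> uniformly in \<open>r\<close>.\<close>

lemma T_symmetric_domain:
  assumes s: "s \<ge> 0" and fg: "(f, g) \<in> G" and hk: "(h, k) \<in> G"
  shows "\<langle>T s f, h\<rangle> = \<langle>f, T s h\<rangle>"
proof (cases "s = 0")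
  case True
  have "\<langle>T 0 f, h\<rangle> = \<langle>f, h\<rangle>"
    using generator_l2[OF fg] generator_l2[OF hk] T_zero T_l2[of 0] l2_measurable by (intro l2_inner_cong_AE) auto
  moreover have "\<langle>f, T 0 h\<rangle> = \<langle>f, h\<rangle>"
    using generator_l2[OF fg] generator_l2[OF hk] T_zero T_l2[of 0] l2_measurable by (intro l2_inner_cong_AE) auto
  ultimately show ?thesis using True by simp
next
  case False
  with s have s: "s > 0" by simp
  note l = generator_l2[OF fg] generator_l2[OF hk]
  define D where "D r = \<langle>T r f, T (s - r) h\<rangle>" for r
  define Ef where "Ef d = \<parallel>\<lambda>x. (T d f x - f x) / d - g x\<parallel>" for d
  define Eh where "Eh d = \<parallel>\<lambda>x. (T d h x - h x) / d - k x\<parallel>" for d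
  have step: "\<bar>D (r + d) - D r\<bar> \<le> d * (Ef d * \<parallel>h\<parallel> + Eh d * \<parallel>f\<parallel>)" if r: "r \<ge> 0" "d > 0" "r + d \<le> s" for r d
  proof -
    define f' g' h' k' where "f' = T r f" and "g' = T r g" and "h' = T (s - r - d) h" and "k' = T (s - r - d) k"
    have l': "f' \<in> l2 P" "g' \<in> l2 P" "h' \<in> l2 P" "k' \<in> l2 P" "T (r + d) f \<in> l2 P" "T (s - r) h \<in> l2 P"
      using l r by (auto simp: f'_def g'_def h'_def k'_def intro!: T_l2)
    \<comment> \<open>Symmetry of the generator cancels the two first order terms in the increment
      of \<open>D\<close>; what remains is bounded through \<open>Ef\<close> and \<open>Eh\<close>
      independently of \<open>r\<close>.\<close>
    have sym: "\<langle>f', k'\<rangle> = \<langle>g', h'\<rangle>"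
      unfolding f'_def g'_def h'_def k'_def by (rule generator_symmetric; rule T_generator) (use fg hk r in auto)
    have 1: "\<bar>\<langle>\<lambda>x. (1 / d) * (T (r + d) f x - f' x) - g' x, h'\<rangle>\<bar> \<le> Ef d * \<parallel>h\<parallel>"
    proof -
      have "\<bar>\<langle>\<lambda>x. (1 / d) * (T (r + d) f x - f' x) - g' x, h'\<rangle>\<bar> \<le> \<parallel>\<lambda>x. (1 / d) * (T (r + d) f x - f' x) - g' x\<parallel> * \<parallel>h'\<parallel>"
        by (intro l2_Cauchy_Schwarz l2_diff l2_cmult l')
      also have "\<dots> \<le> Ef d * \<parallel>h\<parallel>"
        using T_quotient_norm[OF r(1,2) l(1,2)] contraction[of "s - r - d" h] r l
        by (intro mult_mono) (auto simp: Ef_def f'_def g'_def h'_def l2_norm_nonneg)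
      finally show ?thesis .
    qed
    have 2: "\<bar>\<langle>f', \<lambda>x. (1 / d) * (T (s - r) h x - h' x) - k' x\<rangle>\<bar> \<le> Eh d * \<parallel>f\<parallel>"
    proof -
      have "\<bar>\<langle>\<lambda>x. (1 / d) * (T (s - r) h x - h' x) - k' x, f'\<rangle>\<bar> \<le> \<parallel>\<lambda>x. (1 / d) * (T (s - r) h x - h' x) - k' x\<parallel> * \<parallel>f'\<parallel>"
        by (intro l2_Cauchy_Schwarz l2_diff l2_cmult l')
      also have "\<dots> \<le> Eh d * \<parallel>f\<parallel>"
        using T_quotient_norm[of "s - r - d" d h k] contraction[of r f] r l
        by (intro mult_mono) (auto simp: Eh_def f'_def k'_def h'_def l2_norm_nonneg)
      finally show ?thesis by (subst l2_inner_commute)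
    qed
    have "D (r + d) - D r = \<langle>T (r + d) f, h'\<rangle> - \<langle>f', T (s - r) h\<rangle>"
      by (simp add: D_def f'_def h'_def diff_diff_eq)
    also have "\<dots> = d * (\<langle>\<lambda>x. (1 / d) * (T (r + d) f x - f' x) - g' x, h'\<rangle> - \<langle>f', \<lambda>x. (1 / d) * (T (s - r) h x - h' x) - k' x\<rangle>)"
    proof -
      have "\<langle>\<lambda>x. (1 / d) * (T (r + d) f x - f' x) - g' x, h'\<rangle> = (1 / d) * (\<langle>T (r + d) f, h'\<rangle> - \<langle>f', h'\<rangle>) - \<langle>g', h'\<rangle>"
        using l' by (simp only: l2_inner_diff_left l2_diff l2_cmult l2_inner_cmult_left)
      moreover have "\<langle>f', \<lambda>x. (1 / d) * (T (s - r) h x - h' x) - k' x\<rangle> = (1 / d) * (\<langle>f', T (s - r) h\<rangle> - \<langle>f', h'\<rangle>) - \<langle>f', k'\<rangle>"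
        using l' by (simp only: l2_inner_diff_right l2_diff l2_cmult l2_inner_cmult_right)
      ultimately show ?thesis using r sym by (simp add: field_simps)
    qed
    finally have "\<bar>D (r + d) - D r\<bar> = d * \<bar>\<langle>\<lambda>x. (1 / d) * (T (r + d) f x - f' x) - g' x, h'\<rangle> - \<langle>f', \<lambda>x. (1 / d) * (T (s - r) h x - h' x) - k' x\<rangle>\<bar>"
      using r by (simp add: abs_mult)
    also have "\<dots> \<le> d * (Ef d * \<parallel>h\<parallel> + Eh d * \<parallel>f\<parallel>)"
      using 1 2 r by (intro mult_left_mono) linarith+
    finally show ?thesis .
  qed
  have bound: "\<bar>D s - D 0\<bar> \<le> s * (Ef (s / n) * \<parallel>h\<parallel> + Eh (s / n) * \<parallel>f\<parallel>)" if n: "n > 0" for n :: nat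
  proof -
    define d where "d = s / n"
    have d: "d > 0" "n * d = s" using s n by (auto simp: d_def)
    have "\<bar>D s - D 0\<bar> = \<bar>\<Sum>j<n. D (Suc j * d) - D (j * d)\<bar>"
      using sum_lessThan_telescope[of "\<lambda>j. D (real j * d)" n] d by simp
    also have "\<dots> \<le> (\<Sum>j<n. \<bar>D (Suc j * d) - D (j * d)\<bar>)" by (rule sum_abs)
    also have "\<dots> \<le> (\<Sum>j<n. d * (Ef d * \<parallel>h\<parallel> + Eh d * \<parallel>f\<parallel>))"
    proof (rule sum_mono)
      fix j assume "j \<in> {..<n}"
      then have "real (Suc j) * d \<le> n * d" using d by (intro mult_right_mono) auto
      then show "\<bar>D (Suc j * d) - D (j * d)\<bar> \<le> d * (Ef d * \<parallel>h\<parallel> + Eh d * \<parallel>f\<parallel>)"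
        using step[of "j * d" d] d by (simp add: algebra_simps)
    qed
    also have "\<dots> = s * (Ef d * \<parallel>h\<parallel> + Eh d * \<parallel>f\<parallel>)" using d(2) by (simp add: mult.assoc[symmetric])
    finally show ?thesis by (simp add: d_def)
  qed
  have lim: "(\<lambda>n. s * (Ef (s / Suc n) * \<parallel>h\<parallel> + Eh (s / Suc n) * \<parallel>f\<parallel>)) \<longlonglongrightarrow> 0"
  proof -
    have fl: "filterlim (\<lambda>n. s / Suc n) (at_right 0) sequentially"
      unfolding filterlim_at using s LIMSEQ_Suc[OF lim_const_over_n[of s]] by (auto intro!: always_eventually)
    have "(Ef \<longlongrightarrow> 0) (at_right 0)" "(Eh \<longlongrightarrow> 0) (at_right 0)"
      unfolding Ef_def Eh_def using fg hk generator_iff by blast+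
    then have "(\<lambda>n. Ef (s / Suc n)) \<longlonglongrightarrow> 0" "(\<lambda>n. Eh (s / Suc n)) \<longlonglongrightarrow> 0"
      using filterlim_compose[OF _ fl] by blast+
    then have "(\<lambda>n. s * (Ef (s / Suc n) * \<parallel>h\<parallel> + Eh (s / Suc n) * \<parallel>f\<parallel>)) \<longlonglongrightarrow> s * (0 * \<parallel>h\<parallel> + 0 * \<parallel>f\<parallel>)"
      by (intro tendsto_intros)
    then show ?thesis by simp
  qed
  have "\<bar>D s - D 0\<bar> \<le> 0"
    by (rule LIMSEQ_le_const[OF lim]) (use bound in \<open>auto simp del: of_nat_Suc\<close>)
  moreover have "D s = \<langle>T s f, h\<rangle>"
    unfolding D_def using l s T_zero[of h] T_l2[of 0 h] T_l2[of s f] l2_measurable by (intro l2_inner_cong_AE) auto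
  moreover have "D 0 = \<langle>f, T s h\<rangle>"
    unfolding D_def using l s T_zero[of f] T_l2[of 0 f] T_l2[of s h] l2_measurable by (intro l2_inner_cong_AE) auto
  ultimately show ?thesis by simp
qed

text \<open>Contraction makes both sides continuous in \<open>f\<close> and \<open>h\<close>, so the
  identity extends from the dense domain.\<close>

lemma T_symmetric:
  assumes s: "s \<ge> 0" and f: "f \<in> l2 P" and h: "h \<in> l2 P"
  shows "\<langle>T s f, h\<rangle> = \<langle>f, T s h\<rangle>"
proof -
  have "\<bar>\<langle>T s f, h\<rangle> - \<langle>f, T s h\<rangle>\<bar> \<le> 0 + e" if e: "e > 0" for e
  proof -
    \<comment> \<open>\<open>C\<close> collects the coefficients of the final estimate, in which
      \<open>\<parallel>u\<parallel> \<le> \<parallel>f\<parallel> + 1\<close> because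
      \<open>e' \<le> 1\<close>.\<close>
    define C where "C = 2 * \<parallel>h\<parallel> + 2 * \<parallel>f\<parallel> + 2"
    have C: "C > 0" using l2_norm_nonneg[of P f] l2_norm_nonneg[of P h] unfolding C_def by linarith
    define e' where "e' = min 1 (e / C)"
    have e': "e' > 0" "e' \<le> 1" "e' * C \<le> e" using C e by (auto simp: e'_def min_def field_simps)
    obtain u v where u: "(u, v) \<in> G" "\<parallel>\<lambda>x. u x - f x\<parallel> < e'" using generator_dense[OF f e'(1)] .
    obtain w z where w: "(w, z) \<in> G" "\<parallel>\<lambda>x. w x - h x\<parallel> < e'" using generator_dense[OF h e'(1)] .
    note l = generator_l2(1)[OF u(1)] generator_l2(1)[OF w(1)] f h
    have B: "\<bar>\<langle>T s a, b\<rangle>\<bar> \<le> \<parallel>a\<parallel> * \<parallel>b\<parallel>" "\<bar>\<langle>b, T s a\<rangle>\<bar> \<le> \<parallel>a\<parallel> * \<parallel>b\<parallel>" if "a \<in> l2 P" "b \<in> l2 P" for a b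
    proof -
      show "\<bar>\<langle>T s a, b\<rangle>\<bar> \<le> \<parallel>a\<parallel> * \<parallel>b\<parallel>"
        using l2_Cauchy_Schwarz[OF T_l2[OF s that(1)] that(2)] mult_right_mono[OF contraction[OF s that(1)] l2_norm_nonneg[of P b]] by linarith
      then show "\<bar>\<langle>b, T s a\<rangle>\<bar> \<le> \<parallel>a\<parallel> * \<parallel>b\<parallel>" by (simp add: l2_inner_commute)
    qed
    have Td: "\<langle>T s (\<lambda>x. a x - b x), q\<rangle> = \<langle>T s a, q\<rangle> - \<langle>T s b, q\<rangle>" if "a \<in> l2 P" "b \<in> l2 P" "q \<in> l2 P" for a b q
    proof -
      have "\<langle>T s (\<lambda>x. a x - b x), q\<rangle> = \<langle>\<lambda>x. T s a x - T s b x, q\<rangle>"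
        using T_diff[OF s that(1,2)] that s by (intro l2_inner_cong_AE) (auto intro!: l2_measurable T_l2 l2_diff)
      then show ?thesis using that s by (simp add: l2_inner_diff_left T_l2)
    qed
    have Td': "\<langle>q, T s (\<lambda>x. a x - b x)\<rangle> = \<langle>q, T s a\<rangle> - \<langle>q, T s b\<rangle>" if "a \<in> l2 P" "b \<in> l2 P" "q \<in> l2 P" for a b q
      using Td[OF that] by (simp only: l2_inner_commute[of P q])
    have "\<langle>T s f, h\<rangle> - \<langle>f, T s h\<rangle> = (\<langle>u, T s (\<lambda>x. w x - h x)\<rangle> - \<langle>T s u, \<lambda>x. w x - h x\<rangle>)
       + (\<langle>\<lambda>x. u x - f x, T s h\<rangle> - \<langle>T s (\<lambda>x. u x - f x), h\<rangle>)"
      using l s T_symmetric_domain[OF s u(1) w(1)]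
      by (simp add: Td Td' l2_inner_diff_left l2_inner_diff_right T_l2)
    moreover have "\<bar>\<langle>u, T s (\<lambda>x. w x - h x)\<rangle>\<bar> \<le> \<parallel>\<lambda>x. w x - h x\<parallel> * \<parallel>u\<parallel>" by (intro B l2_diff l)
    moreover have "\<bar>\<langle>T s u, \<lambda>x. w x - h x\<rangle>\<bar> \<le> \<parallel>u\<parallel> * \<parallel>\<lambda>x. w x - h x\<parallel>" by (intro B l2_diff l)
    moreover have "\<bar>\<langle>\<lambda>x. u x - f x, T s h\<rangle>\<bar> \<le> \<parallel>h\<parallel> * \<parallel>\<lambda>x. u x - f x\<parallel>" by (intro B l2_diff l)
    moreover have "\<bar>\<langle>T s (\<lambda>x. u x - f x), h\<rangle>\<bar> \<le> \<parallel>\<lambda>x. u x - f x\<parallel> * \<parallel>h\<parallel>" by (intro B l2_diff l)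
    ultimately have "\<bar>\<langle>T s f, h\<rangle> - \<langle>f, T s h\<rangle>\<bar> \<le> 2 * (\<parallel>u\<parallel> * \<parallel>\<lambda>x. w x - h x\<parallel>) + 2 * (\<parallel>h\<parallel> * \<parallel>\<lambda>x. u x - f x\<parallel>)"
      by (simp add: mult.commute)
    also have "\<dots> \<le> 2 * ((\<parallel>f\<parallel> + 1) * e') + 2 * (\<parallel>h\<parallel> * e')"
    proof -
      have "\<parallel>u\<parallel> \<le> \<parallel>f\<parallel> + 1" using l2_norm_le_diff[OF l(1) f] u(2) e'(2) by linarith
      then show ?thesis using u(2) w(2) e'(1)
        by (intro add_mono mult_left_mono mult_mono) (auto simp: l2_norm_nonneg add_nonneg_nonneg)
    qed
    also have "\<dots> = e' * C" by (simp add: C_def algebra_simps)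
    finally show ?thesis using e'(3) by simp
  qed
  then have "\<bar>\<langle>T s f, h\<rangle> - \<langle>f, T s h\<rangle>\<bar> \<le> 0" by (rule field_le_epsilon)
  then show ?thesis by simp
qed

text \<open>Half of the time is moved across the inner product. Every \<open>T s\<close> is thereby
  a positive operator, and quadratic forms become squared norms to which contraction and decay
  apply.\<close>

lemma T_inner_square:
  assumes "s \<ge> 0" "f \<in> l2 P"
  shows "\<langle>T (2 * s) f, f\<rangle> = \<parallel>T s f\<parallel>\<^sup>2"
proof -
  have "\<langle>T (2 * s) f, f\<rangle> = \<langle>T s (T s f), f\<rangle>"
    using T_add[of s s f] assms T_l2 l2_measurable by (intro l2_inner_cong_AE) auto
  also have "\<dots> = \<langle>T s f, T s f\<rangle>" by (rule T_symmetric) (use assms T_l2 in auto)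
  finally show ?thesis by (simp only: l2_norm_square)
qed

lemma T_inner_antimono:
  assumes "0 \<le> a" "a \<le> b" "f \<in> l2 P"
  shows "\<langle>T b f, f\<rangle> \<le> \<langle>T a f, f\<rangle>"
proof -
  have "\<parallel>T (b / 2) f\<parallel> = \<parallel>T ((b - a) / 2) (T (a / 2) f)\<parallel>"
    using T_add_norm[of "(b - a) / 2" "a / 2" f] assms by (simp add: field_simps)
  also have "\<dots> \<le> \<parallel>T (a / 2) f\<parallel>" using assms T_l2 by (intro contraction) auto
  finally have "\<parallel>T (b / 2) f\<parallel>\<^sup>2 \<le> \<parallel>T (a / 2) f\<parallel>\<^sup>2" by (intro power_mono l2_norm_nonneg)
  then show ?thesis using T_inner_square[of "b / 2" f] T_inner_square[of "a / 2" f] assms by simp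
qed

text \<open>Only values of the monotone function
  \<open>s \<mapsto> \<langle>T s f, f\<rangle>\<close> occur on the right, so its convergence makes
  the orbit of \<open>f\<close> Cauchy in the norm.\<close>

lemma T_diff_norm_square:
  assumes "a \<ge> 0" "b \<ge> 0" "f \<in> l2 P"
  shows "\<parallel>\<lambda>x. T a f x - T b f x\<parallel>\<^sup>2 = \<langle>T (2 * a) f, f\<rangle> - 2 * \<langle>T (a + b) f, f\<rangle> + \<langle>T (2 * b) f, f\<rangle>"
proof -
  have "\<langle>T (a + b) f, f\<rangle> = \<langle>T a (T b f), f\<rangle>"
    using T_add[of a b f] assms T_l2 l2_measurable by (intro l2_inner_cong_AE) auto
  also have "\<dots> = \<langle>T b f, T a f\<rangle>" by (rule T_symmetric) (use assms T_l2 in auto)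
  finally show ?thesis
    using l2_norm_square_diff[of "T a f" P "T b f" 1] assms
    by (simp add: T_l2 T_inner_square l2_inner_commute[of P "T b f" "T a f"])
qed

lemma generator_one: "(\<lambda>_. 1, \<lambda>_. 0) \<in> G"
proof -
  have "\<parallel>\<lambda>x. (T s (\<lambda>_. 1) x - 1) / s - 0\<parallel> = 0" if "s \<ge> 0" for s
  proof -
    have "AE x in P. (T s (\<lambda>_. 1) x - 1) / s - 0 = 0" using T_one[OF that] by auto
    moreover have "(\<lambda>x. (T s (\<lambda>_. 1) x - 1) / s - 0) \<in> l2 P"
      using l2_cmult[OF l2_diff[OF T_l2[OF that const_l2] const_l2[of 1]], of "1 / s"] by simp
    ultimately show ?thesis using l2_norm_eq_0_iff by blast
  qed
  then have "((\<lambda>s. \<parallel>\<lambda>x. (T s (\<lambda>_. 1) x - 1) / s - 0\<parallel>) \<longlongrightarrow> 0) (at_right 0)"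
    by (intro tendsto_eventually eventually_at_rightI[of 0 1]) auto
  then show ?thesis using const_l2 generator_iff by blast
qed

lemma T_mean:
  assumes s: "s \<ge> 0" and f: "f \<in> l2 P"
  shows "\<langle>T s f, \<lambda>_. 1\<rangle> = \<langle>f, \<lambda>_. 1\<rangle>"
proof -
  have "\<langle>T s f, \<lambda>_. 1\<rangle> = \<langle>f, T s (\<lambda>_. 1)\<rangle>" by (rule T_symmetric) (use s f const_l2 in auto)
  also have "\<dots> = \<langle>f, \<lambda>_. 1\<rangle>"
    using T_one[OF s] l2_measurable[OF T_l2[OF s const_l2[of 1]]] l2_measurable[OF f]
    by (intro l2_inner_cong_AE) auto
  finally show ?thesis .
qed

text \<open>Strong stability: \<open>T\<^sub>n f\<close> is a Cauchy sequence because \<open>\<langle>T\<^sub>s f, f\<rangle>\<close> decreases, and its limit lies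
  in the kernel of the generator.\<close>

lemma T_inner_tendsto_0:
  assumes ker: "\<And>g. (g, \<lambda>_. 0) \<in> G \<Longrightarrow> \<exists>c. AE x in P. g x = c"
    and f: "f \<in> l2 P" and mean: "\<langle>f, \<lambda>_. 1\<rangle> = 0"
  shows "(\<lambda>n. \<langle>T (2 * real n) f, f\<rangle>) \<longlonglongrightarrow> 0"
proof -
  define a where "a s = \<langle>T s f, f\<rangle>" for s
  have anti: "a s \<le> a r" if "0 \<le> r" "r \<le> s" for r s unfolding a_def by (rule T_inner_antimono[OF that f])
  have nonneg: "a s \<ge> 0" if "s \<ge> 0" for s
    using T_inner_square[of "s / 2" f] that f by (simp add: a_def)
  define b where "b = Inf (a ` {0..})"
  have bdd: "bdd_below (a ` {0..})" using nonneg by (auto simp: bdd_below_def)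
  have b_le: "b \<le> a s" if "s \<ge> 0" for s unfolding b_def using bdd that by (intro cInf_lower) auto
  have close: "\<exists>S\<ge>0. \<forall>s\<ge>S. a s < b + e" if e: "e > 0" for e
  proof -
    obtain y where "y \<in> a ` {0..}" "y < b + e" using cInf_lessD[of "a ` {0..}" "b + e"] e by (auto simp: b_def)
    then obtain S where S: "S \<ge> 0" "a S < b + e" by auto
    then show ?thesis using anti by (meson le_less_trans)
  qed
  have diff: "\<exists>S\<ge>0. \<forall>r\<ge>S. \<forall>s\<ge>S. \<parallel>\<lambda>x. T r f x - T s f x\<parallel> < e" if e: "e > 0" for e
  proof -
    \<comment> \<open>In \<open>a (2 * r) - 2 * a (r + s) + a (2 * s)\<close> the outer values lie
      below \<open>b + e\<^sup>2 / 2\<close> and the middle one is at least \<open>b\<close>, which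
      gives the bound \<open>e\<^sup>2\<close>.\<close>
    obtain S where S: "S \<ge> 0" "\<And>s. s \<ge> S \<Longrightarrow> a s < b + e\<^sup>2 / 2" using close[of "e\<^sup>2 / 2"] e by auto
    have "\<parallel>\<lambda>x. T r f x - T s f x\<parallel> < e" if "r \<ge> S" "s \<ge> S" for r s
    proof -
      have "\<parallel>\<lambda>x. T r f x - T s f x\<parallel>\<^sup>2 = a (2 * r) - 2 * a (r + s) + a (2 * s)"
        unfolding a_def by (rule T_diff_norm_square) (use that S f in auto)
      also have "\<dots> < e\<^sup>2" using S(2)[of "2 * r"] S(2)[of "2 * s"] b_le[of "r + s"] that S(1) by auto
      finally show ?thesis by (rule power2_less_imp_less) (use e in simp)
    qed
    then show ?thesis using S(1) by blast
  qed
  have Tn: "T (real n) f \<in> l2 P" for n by (rule T_l2) (use f in auto)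
  have "\<exists>N. \<forall>m\<ge>N. \<forall>n\<ge>N. \<parallel>\<lambda>x. T (real m) f x - T (real n) f x\<parallel> < e" if e: "e > 0" for e
  proof -
    obtain S where S: "\<And>r s. r \<ge> S \<Longrightarrow> s \<ge> S \<Longrightarrow> \<parallel>\<lambda>x. T r f x - T s f x\<parallel> < e" using diff[OF e] by blast
    obtain N :: nat where "real N \<ge> S" using real_arch_simple by blast
    then show ?thesis using S by (intro exI[of _ N]) auto
  qed
  from l2_complete[OF Tn this] obtain g where g: "g \<in> l2 P" "(\<lambda>n. \<parallel>\<lambda>x. T (real n) f x - g x\<parallel>) \<longlonglongrightarrow> 0" .
  \<comment> \<open>\<open>T s\<close> shifts the orbit by time \<open>s\<close>, and the shifted
    orbit has the same limit \<open>g\<close>.\<close>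
  have fix_g: "\<parallel>\<lambda>x. T s g x - g x\<parallel> = 0" if s: "s \<ge> 0" for s
  proof -
    have "\<parallel>\<lambda>x. T s g x - g x\<parallel> \<le> 0 + e" if e: "e > 0" for e
    proof -
      obtain S where S: "\<And>r s. r \<ge> S \<Longrightarrow> s \<ge> S \<Longrightarrow> \<parallel>\<lambda>x. T r f x - T s f x\<parallel> < e / 3" using diff[of "e / 3"] e by auto
      obtain N :: nat where N: "real N \<ge> S" using real_arch_simple by blast
      have "\<forall>\<^sub>F n in sequentially. \<parallel>\<lambda>x. T (real n) f x - g x\<parallel> < e / 3"
        by (rule order_tendstoD(2)[OF g(2)]) (use e in simp)
      then obtain n where n: "n \<ge> N" "\<parallel>\<lambda>x. T (real n) f x - g x\<parallel> < e / 3"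
        unfolding eventually_sequentially by (meson le_cases order_refl)
      have l: "T s g \<in> l2 P" "T s (T (real n) f) \<in> l2 P" by (auto intro: T_l2 s g Tn)
      have "\<parallel>\<lambda>x. T s g x - g x\<parallel> \<le> \<parallel>\<lambda>x. T s g x - T s (T (real n) f) x\<parallel> + \<parallel>\<lambda>x. T s (T (real n) f) x - g x\<parallel>"
        by (rule l2_norm_diff_triangle[OF l g(1)])
      also have "\<parallel>\<lambda>x. T s (T (real n) f) x - g x\<parallel> \<le> \<parallel>\<lambda>x. T s (T (real n) f) x - T (real n) f x\<parallel> + \<parallel>\<lambda>x. T (real n) f x - g x\<parallel>"
        by (rule l2_norm_diff_triangle[OF l(2) Tn g(1)])
      also have "\<parallel>\<lambda>x. T s (T (real n) f) x - T (real n) f x\<parallel> = \<parallel>\<lambda>x. T (s + real n) f x - T (real n) f x\<parallel>"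
        using T_add[of s "real n" f] s f l Tn T_l2[of "s + real n" f]
          by (intro l2_norm_cong_AE) (auto intro!: l2_measurable l2_diff)
      finally have "\<parallel>\<lambda>x. T s g x - g x\<parallel> \<le> \<parallel>\<lambda>x. T s g x - T s (T (real n) f) x\<parallel>
          + (\<parallel>\<lambda>x. T (s + real n) f x - T (real n) f x\<parallel> + \<parallel>\<lambda>x. T (real n) f x - g x\<parallel>)" by simp
      moreover have "\<parallel>\<lambda>x. T s g x - T s (T (real n) f) x\<parallel> < e / 3"
        using T_diff_norm[OF s g(1) Tn[of n]] n(2) l2_norm_minus_commute[of P g "T (real n) f"] by simp
      moreover have "\<parallel>\<lambda>x. T (s + real n) f x - T (real n) f x\<parallel> < e / 3"
        by (rule S) (use N n(1) s in linarith)+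
      ultimately show ?thesis using n(2) by simp
    qed
    then have "\<parallel>\<lambda>x. T s g x - g x\<parallel> \<le> 0" by (rule field_le_epsilon)
    then show ?thesis using l2_norm_nonneg[of P "\<lambda>x. T s g x - g x"] by simp
  qed
  have "\<parallel>\<lambda>x. (T s g x - g x) / s - 0\<parallel> = 0" if "s \<ge> 0" for s
    using fix_g[OF that] l2_norm_cmult[of P "1 / s" "\<lambda>x. T s g x - g x"] by simp
  then have "((\<lambda>s. \<parallel>\<lambda>x. (T s g x - g x) / s - 0\<parallel>) \<longlongrightarrow> 0) (at_right 0)"
    by (intro tendsto_eventually eventually_at_rightI[of 0 1]) auto
  then have "(g, \<lambda>_. 0) \<in> G" using g(1) const_l2 generator_iff by blast
  then obtain c where c: "AE x in P. g x = c" using ker by blast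
  \<comment> \<open>The mean is preserved along the orbit and in the limit, so the constant that
    \<open>g\<close> equals must be zero.\<close>
  have mean_n: "\<langle>T (real n) f, \<lambda>_. 1\<rangle> = 0" for n using T_mean[of "real n" f] f mean by simp
  have "(\<lambda>n. \<langle>T (real n) f, \<lambda>_. 1\<rangle>) \<longlonglongrightarrow> \<langle>g, \<lambda>_. 1\<rangle>"
    by (rule l2_tendsto_inner[OF Tn g(1) const_l2 g(2)])
  then have "\<langle>g, \<lambda>_. 1\<rangle> = 0" unfolding mean_n by (simp add: LIMSEQ_const_iff)
  moreover have "\<langle>g, \<lambda>_. 1\<rangle> = \<langle>\<lambda>_. c, \<lambda>_. 1\<rangle>"
    using c g(1) l2_measurable by (intro l2_inner_cong_AE) auto
  moreover have "\<langle>\<lambda>_. c, \<lambda>_. 1\<rangle> = c" using prob_space.prob_space[OF prob] by (simp add: l2_inner_def)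
  ultimately have "AE x in P. g x = 0" using c by simp
  then have eq: "\<parallel>\<lambda>x. T (real n) f x - g x\<parallel> = \<parallel>T (real n) f\<parallel>" for n
    using Tn[of n] g(1) l2_measurable by (intro l2_norm_cong_AE) auto
  have "(\<lambda>n. \<parallel>T (real n) f\<parallel>\<^sup>2) \<longlonglongrightarrow> 0\<^sup>2" using g(2) unfolding eq by (rule tendsto_power)
  then show ?thesis using f by (simp add: T_inner_square)
qed

lemma generator_nonpos:
  assumes "(f, g) \<in> G"
  shows "\<langle>g, f\<rangle> \<le> 0"
proof -
  note fg = generator_l2[OF assms]
  have q: "(\<lambda>x. (T s f x - f x) / s) \<in> l2 P" if "s \<ge> 0" for s
    using l2_cmult[OF l2_diff[OF T_l2[OF that fg(1)] fg(1)], of "1 / s"] by simp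
  \<comment> \<open>\<open>l2_tendsto_inner\<close> asks for membership in \<open>l2\<close> at
    every index; the default 0 at negative times provides it and does not affect the right
    limit.\<close>
  define q' where "q' s = (if s \<ge> 0 then \<lambda>x. (T s f x - f x) / s else (\<lambda>_. 0))" for s
  have q'_l2: "q' s \<in> l2 P" for s using q const_l2[of 0] by (simp add: q'_def)
  have "((\<lambda>s. \<parallel>\<lambda>x. (T s f x - f x) / s - g x\<parallel>) \<longlongrightarrow> 0) (at_right 0)"
    using assms generator_iff by blast
  then have "((\<lambda>s. \<parallel>\<lambda>x. q' s x - g x\<parallel>) \<longlongrightarrow> 0) (at_right 0)"
    by (rule Lim_transform_eventually) (rule eventually_at_rightI[of 0 1], auto simp: q'_def)
  then have "((\<lambda>s. \<langle>q' s, f\<rangle>) \<longlongrightarrow> \<langle>g, f\<rangle>) (at_right 0)"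
    by (rule l2_tendsto_inner[OF q'_l2 fg(2,1)])
  moreover have "\<langle>q' s, f\<rangle> \<le> 0" if s: "s > 0" for s
  proof -
    have "\<langle>q' s, f\<rangle> = \<langle>\<lambda>x. (1 / s) * (T s f x - f x), f\<rangle>" using s by (simp add: q'_def)
    also have "\<dots> = (1 / s) * (\<langle>T s f, f\<rangle> - \<langle>f, f\<rangle>)"
      using s fg by (simp only: l2_inner_cmult_left l2_inner_diff_left T_l2 less_imp_le)
    finally have eq: "\<langle>q' s, f\<rangle> = (1 / s) * (\<langle>T s f, f\<rangle> - \<langle>f, f\<rangle>)" .
    have "\<langle>T s f, f\<rangle> \<le> \<langle>f, f\<rangle>"
    proof -
      have "\<langle>T s f, f\<rangle> \<le> \<parallel>T s f\<parallel> * \<parallel>f\<parallel>" using l2_Cauchy_Schwarz[OF T_l2[of s f] fg(1)] s fg by simp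
      also have "\<dots> \<le> \<parallel>f\<parallel> * \<parallel>f\<parallel>" using s fg by (intro mult_right_mono contraction l2_norm_nonneg) auto
      finally show ?thesis using l2_norm_square[of P f] by (simp add: power2_eq_square)
    qed
    then show ?thesis unfolding eq using s by (intro mult_nonneg_nonpos) auto
  qed
  ultimately show ?thesis
    by (intro tendsto_upperbound[where F="at_right 0"]) (auto intro!: eventually_at_rightI[of 0 1])
qed

text \<open>\<open>resolvent_set\<close> bounds some preimage of each right-hand side; injectivity
  identifies this preimage with the given \<open>f\<close> up to a null set.\<close>

lemma resolvent_bound:
  assumes "\<nu> \<in> resolvent_set P (neg_op G)"
  obtains C where "C > 0" "\<And>f g. (f, g) \<in> G \<Longrightarrow> \<parallel>f\<parallel> \<le> C * \<parallel>\<lambda>x. g x + \<nu> * f x\<parallel>"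
proof -
  from assms obtain C where
    inj: "\<And>f. f \<in> eigenspace (neg_op G) \<nu> \<Longrightarrow> AE x in P. f x = 0" and
    C: "\<And>g. g \<in> l2 P \<Longrightarrow> \<exists>f. (f, \<lambda>x. g x + \<nu> * f x) \<in> neg_op G \<and> \<parallel>f\<parallel> \<le> C * \<parallel>g\<parallel>"
    unfolding resolvent_set_def by blast
  have "\<parallel>f\<parallel> \<le> (\<bar>C\<bar> + 1) * \<parallel>\<lambda>x. g x + \<nu> * f x\<parallel>" if fg: "(f, g) \<in> G" for f g
  proof -
    note l = generator_l2[OF fg]
    define q where "q x = (- 1) * g x + (- \<nu>) * f x" for x
    have q: "q \<in> l2 P" unfolding q_def by (rule l2_lincomb[OF l(2,1)])
    obtain f' where f': "(f', \<lambda>x. q x + \<nu> * f' x) \<in> neg_op G" "\<parallel>f'\<parallel> \<le> C * \<parallel>q\<parallel>" using C[OF q] by blast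
    from f'(1) have f'G: "(f', \<lambda>x. - (q x + \<nu> * f' x)) \<in> G" by (simp add: neg_op_iff)
    have "(\<lambda>x. 1 * f x + (-1) * f' x, \<lambda>x. 1 * g x + (-1) * - (q x + \<nu> * f' x)) \<in> G"
      by (rule generator_lincomb[OF fg f'G])
    moreover have "(\<lambda>x. 1 * g x + (-1) * - (q x + \<nu> * f' x)) = (\<lambda>x. - (\<nu> * (1 * f x + (-1) * f' x)))"
      by (simp add: q_def algebra_simps)
    ultimately have "(\<lambda>x. 1 * f x + (-1) * f' x) \<in> eigenspace (neg_op G) \<nu>"
      by (simp add: eigenspace_def neg_op_iff)
    from inj[OF this] have "AE x in P. f x = f' x" by simp
    then have "\<parallel>f\<parallel> = \<parallel>f'\<parallel>"
      using l(1) generator_l2(1)[OF f'G] l2_measurable by (intro l2_norm_cong_AE) auto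
    also have "\<dots> \<le> (\<bar>C\<bar> + 1) * \<parallel>q\<parallel>"
      using f'(2) mult_right_mono[OF abs_ge_self[of C] l2_norm_nonneg[of P q]] l2_norm_nonneg[of P q]
      unfolding distrib_right by linarith
    also have "\<parallel>q\<parallel> = \<parallel>\<lambda>x. - (g x + \<nu> * f x)\<parallel>" unfolding q_def by (rule arg_cong[where f="l2_norm P"]) auto
    also have "\<dots> = \<parallel>\<lambda>x. g x + \<nu> * f x\<parallel>" by (rule l2_norm_uminus)
    finally show ?thesis .
  qed
  then show ?thesis using that[of "\<bar>C\<bar> + 1"] by simp
qed

lemma resolvent_solve:
  assumes "\<nu> \<in> resolvent_set P (neg_op G)" "h \<in> l2 P"
  obtains f g where "(f, g) \<in> G" "\<And>x. g x + \<nu> * f x = - h x"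
proof -
  from assms obtain f where "(f, \<lambda>x. h x + \<nu> * f x) \<in> neg_op G"
    unfolding resolvent_set_def by blast
  then have "(f, \<lambda>x. - (h x + \<nu> * f x)) \<in> G" by (simp add: neg_op_iff)
  then show ?thesis using that[of f "\<lambda>x. - (h x + \<nu> * f x)"] by simp
qed

text \<open>If \<open>\<delta> = inf \<parallel>(G + \<gamma>) f\<parallel>\<close> over unit vectors were less than \<open>\<gamma>\<close>, then \<open>\<delta>\<^sup>2\<close> would be an approximate
  eigenvalue of \<open>(G + \<gamma>)\<^sup>2\<close>, so one of \<open>\<gamma> \<plusminus> \<delta>\<close> would lie in the spectrum of \<open>- G\<close>.\<close>

lemma gap_midpoint:
  assumes res: "\<And>\<nu>. 0 < \<nu> \<Longrightarrow> \<nu> < 2 * \<gamma> \<Longrightarrow> \<nu> \<in> resolvent_set P (neg_op G)"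
    and \<gamma>: "\<gamma> > 0" and fg: "(f, g) \<in> G"
  shows "\<gamma> * \<parallel>f\<parallel> \<le> \<parallel>\<lambda>x. g x + \<gamma> * f x\<parallel>"
proof (rule ccontr)
  assume "\<not> ?thesis"
  then have lt: "\<parallel>\<lambda>x. g x + \<gamma> * f x\<parallel> < \<gamma> * \<parallel>f\<parallel>" by simp
  have f_pos: "\<parallel>f\<parallel> > 0" using lt l2_norm_nonneg[of P "\<lambda>x. g x + \<gamma> * f x"] \<gamma>
    by (smt (verit) zero_less_mult_pos)
  define S where "S = {\<parallel>\<lambda>x. g x + \<gamma> * f x\<parallel> | f g. (f, g) \<in> G \<and> \<parallel>f\<parallel> = 1}"
  define \<delta> where "\<delta> = Inf S"
  have normalize: "\<exists>y\<in>S. y = \<parallel>\<lambda>x. g x + \<gamma> * f x\<parallel> / \<parallel>f\<parallel>" if "(f, g) \<in> G" "\<parallel>f\<parallel> > 0" for f g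
  proof -
    have 1: "(\<lambda>x. (1 / \<parallel>f\<parallel>) * f x, \<lambda>x. (1 / \<parallel>f\<parallel>) * g x) \<in> G"
      using generator_lincomb[OF that(1,1), of "1 / \<parallel>f\<parallel>" 0] by simp
    have 2: "\<parallel>\<lambda>x. (1 / \<parallel>f\<parallel>) * f x\<parallel> = 1" using that(2) by (subst l2_norm_cmult) simp
    have "\<parallel>\<lambda>x. (1 / \<parallel>f\<parallel>) * g x + \<gamma> * ((1 / \<parallel>f\<parallel>) * f x)\<parallel> = \<parallel>\<lambda>x. (1 / \<parallel>f\<parallel>) * (g x + \<gamma> * f x)\<parallel>"
      by (rule arg_cong[where f="l2_norm P"]) (simp add: algebra_simps)
    also have "\<dots> = \<parallel>\<lambda>x. g x + \<gamma> * f x\<parallel> / \<parallel>f\<parallel>" using that(2) by (subst l2_norm_cmult) simp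
    finally have eq: "\<parallel>\<lambda>x. (1 / \<parallel>f\<parallel>) * g x + \<gamma> * ((1 / \<parallel>f\<parallel>) * f x)\<parallel> = \<parallel>\<lambda>x. g x + \<gamma> * f x\<parallel> / \<parallel>f\<parallel>" .
    have "\<parallel>\<lambda>x. (1 / \<parallel>f\<parallel>) * g x + \<gamma> * ((1 / \<parallel>f\<parallel>) * f x)\<parallel> \<in> S"
      unfolding S_def by (intro CollectI exI conjI) (rule refl 1 2)+
    then show ?thesis using eq by (rule bexI[rotated])
  qed
  have bdd: "bdd_below S" by (auto simp: S_def bdd_below_def intro!: exI[of _ 0] l2_norm_nonneg)
  have S_ne: "S \<noteq> {}" using normalize[OF fg f_pos] by blast
  have \<delta>_lower: "\<delta> * \<parallel>f\<parallel> \<le> \<parallel>\<lambda>x. g x + \<gamma> * f x\<parallel>" if "(f, g) \<in> G" for f g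
  proof (cases "\<parallel>f\<parallel> = 0")
    case False
    then have p: "\<parallel>f\<parallel> > 0" using l2_norm_nonneg[of P f] by simp
    from normalize[OF that p] have "\<delta> \<le> \<parallel>\<lambda>x. g x + \<gamma> * f x\<parallel> / \<parallel>f\<parallel>"
      unfolding \<delta>_def using cInf_lower[OF _ bdd] by auto
    then show ?thesis using p by (simp add: field_simps)
  qed (simp add: l2_norm_nonneg)
  have \<delta>_lt: "\<delta> < \<gamma>"
    using \<delta>_lower[OF fg] lt f_pos by (smt (verit) mult_right_mono)
  obtain C where C: "C > 0" "\<And>f g. (f, g) \<in> G \<Longrightarrow> \<parallel>f\<parallel> \<le> C * \<parallel>\<lambda>x. g x + \<gamma> * f x\<parallel>"
    using resolvent_bound[OF res, of \<gamma>] \<gamma> by auto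
  \<comment> \<open>As \<open>\<gamma>\<close> itself is in the resolvent set, the infimum is
    strictly positive; together with \<open>\<delta> < \<gamma>\<close> this puts
    \<open>\<gamma> - \<delta>\<close> and \<open>\<gamma> + \<delta>\<close> in the interval where
    \<open>res\<close> applies.\<close>
  have "1 / C \<le> \<delta>"
    unfolding \<delta>_def
  proof (rule cInf_greatest[OF S_ne])
    fix y assume "y \<in> S"
    then obtain f g where "(f, g) \<in> G" "\<parallel>f\<parallel> = 1" "y = \<parallel>\<lambda>x. g x + \<gamma> * f x\<parallel>" unfolding S_def by blast
    then show "1 / C \<le> y" using C(2)[of f g] C(1) by (simp add: field_simps)
  qed
  then have \<delta>_pos: "\<delta> > 0" using C(1) by (smt (verit) divide_pos_pos)
  obtain C1 where C1: "C1 > 0" "\<And>f g. (f, g) \<in> G \<Longrightarrow> \<parallel>f\<parallel> \<le> C1 * \<parallel>\<lambda>x. g x + (\<gamma> - \<delta>) * f x\<parallel>"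
    using resolvent_bound[OF res, of "\<gamma> - \<delta>"] \<gamma> \<delta>_lt \<delta>_pos by auto
  obtain C2 where C2: "C2 > 0" "\<And>f g. (f, g) \<in> G \<Longrightarrow> \<parallel>f\<parallel> \<le> C2 * \<parallel>\<lambda>x. g x + (\<gamma> + \<delta>) * f x\<parallel>"
    using resolvent_bound[OF res, of "\<gamma> + \<delta>"] \<gamma> \<delta>_lt \<delta>_pos by auto
  \<comment> \<open>\<open>L\<close> is the total amplification by the resolvent bounds
    \<open>C1\<close> and \<open>C2\<close>. A residual of norm at most \<open>1 / (2 * L)\<close>
    will give \<open>\<parallel>f\<parallel> \<le> 1 / 2\<close> for a unit vector, and
    \<open>\<epsilon>\<close> is chosen to make the residual that small.\<close>
  define L where "L = C2 + \<delta> * (C1 * C2)"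
  have L: "L > 0" using C1(1) C2(1) \<delta>_pos by (simp add: L_def add_pos_pos)
  define \<epsilon> where "\<epsilon> = min 1 ((1 / (2 * L))\<^sup>2 / (2 * \<delta> + 1))"
  have \<epsilon>: "\<epsilon> > 0" "\<epsilon> \<le> 1" "(2 * \<delta> + 1) * \<epsilon> \<le> (1 / (2 * L))\<^sup>2"
  proof -
    have A: "(1 / (2 * L))\<^sup>2 > 0" and B: "2 * \<delta> + 1 > 0" using \<delta>_pos L by simp_all
    then have "(1 / (2 * L))\<^sup>2 / (2 * \<delta> + 1) > 0" by (rule divide_pos_pos)
    then show "\<epsilon> > 0" "\<epsilon> \<le> 1" by (simp_all add: \<epsilon>_def)
    have "(2 * \<delta> + 1) * \<epsilon> \<le> (2 * \<delta> + 1) * ((1 / (2 * L))\<^sup>2 / (2 * \<delta> + 1))"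
      using B by (intro mult_left_mono) (auto simp: \<epsilon>_def)
    also have "\<dots> = (1 / (2 * L))\<^sup>2" using B by (simp del: power_divide)
    finally show "(2 * \<delta> + 1) * \<epsilon> \<le> (1 / (2 * L))\<^sup>2" .
  qed
  obtain y where "y \<in> S" "y < \<delta> + \<epsilon>" using cInf_lessD[OF S_ne, of "\<delta> + \<epsilon>"] \<epsilon>(1) by (auto simp: \<delta>_def)
  then obtain f g where fg: "(f, g) \<in> G" "\<parallel>f\<parallel> = 1" "\<parallel>\<lambda>x. g x + \<gamma> * f x\<parallel> < \<delta> + \<epsilon>" unfolding S_def by blast
  note l = generator_l2[OF fg(1)]
  \<comment> \<open>\<open>f\<close> need not be in the domain of the square of \<open>G\<close>.
    Instead of applying \<open>G + \<gamma>\<close> twice to \<open>f\<close>, the equation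
    \<open>(G + \<gamma>) k0 = f\<close> is solved, so that \<open>r\<close> plays the role of
    \<open>(G + \<gamma>)\<^sup>2 k0\<close>.\<close>
  obtain k0 k1 where k: "(k0, k1) \<in> G" "\<And>x. k1 x + \<gamma> * k0 x = - (- f x)"
    using resolvent_solve[OF res, of \<gamma> "\<lambda>x. - f x"] \<gamma> l2_uminus[OF l(1)] by auto
  then have k1: "k1 x = f x - \<gamma> * k0 x" for x by (metis add_diff_cancel_right' minus_minus)
  note kl = generator_l2[OF k(1)]
  define r where "r x = g x + \<gamma> * f x" for x
  have r: "r \<in> l2 P" unfolding r_def by (rule l2_add[OF l(2) l2_cmult[OF l(1)]])
  \<comment> \<open>Moving \<open>G + \<gamma>\<close> from \<open>f\<close> to \<open>k0\<close>
    produces the squared norm of \<open>f\<close>. In the expansion of the squared norm of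
    \<open>r - \<delta>\<^sup>2 k0\<close> the main terms
    \<open>\<delta>\<^sup>2 - 2 \<delta>\<^sup>2 + \<delta>\<^sup>2\<close> then cancel.\<close>
  have "\<langle>r, k0\<rangle> = 1"
  proof -
    have "\<langle>r, k0\<rangle> = \<langle>g, k0\<rangle> + \<gamma> * \<langle>f, k0\<rangle>"
      unfolding r_def using l kl by (simp add: l2_inner_add_left l2_cmult l2_inner_cmult_left)
    also have "\<langle>g, k0\<rangle> = \<langle>f, k1\<rangle>" using generator_symmetric[OF fg(1) k(1)] by simp
    also have "\<langle>f, k1\<rangle> = \<langle>f, f\<rangle> - \<gamma> * \<langle>f, k0\<rangle>"
      unfolding k1[abs_def] using l kl by (simp add: l2_inner_diff_right l2_cmult l2_inner_cmult_right)
    finally show ?thesis using l2_norm_square[of P f] fg(2) by simp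
  qed
  moreover have "\<delta> * \<parallel>k0\<parallel> \<le> 1" using \<delta>_lower[OF k(1)] k(2) fg(2) by simp
  then have "(\<delta> * \<parallel>k0\<parallel>)\<^sup>2 \<le> 1"
    using \<delta>_pos by (intro power_le_one) (auto simp: l2_norm_nonneg)
  moreover have "\<parallel>r\<parallel>\<^sup>2 \<le> (\<delta> + \<epsilon>)\<^sup>2"
    using fg(3) by (intro power_mono l2_norm_nonneg) (simp add: r_def[abs_def])
  ultimately have "\<parallel>\<lambda>x. r x - \<delta>\<^sup>2 * k0 x\<parallel>\<^sup>2 \<le> (\<delta> + \<epsilon>)\<^sup>2 - 2 * \<delta>\<^sup>2 + \<delta>\<^sup>2"
  proof -
    assume a: "\<langle>r, k0\<rangle> = 1" "(\<delta> * \<parallel>k0\<parallel>)\<^sup>2 \<le> 1" "\<parallel>r\<parallel>\<^sup>2 \<le> (\<delta> + \<epsilon>)\<^sup>2"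
    have "(\<delta>\<^sup>2)\<^sup>2 * \<parallel>k0\<parallel>\<^sup>2 = \<delta>\<^sup>2 * (\<delta> * \<parallel>k0\<parallel>)\<^sup>2" by (simp add: power2_eq_square)
    also have "\<dots> \<le> \<delta>\<^sup>2 * 1" by (rule mult_left_mono[OF a(2)]) simp
    finally show ?thesis
      unfolding l2_norm_square_diff[OF r kl(1)] a(1) using a(3) by simp
  qed
  also have "\<dots> = (2 * \<delta> + \<epsilon>) * \<epsilon>" by (simp add: power2_eq_square algebra_simps)
  also have "\<dots> \<le> (2 * \<delta> + 1) * \<epsilon>" using \<epsilon> by (intro mult_right_mono) auto
  also have "\<dots> \<le> (1 / (2 * L))\<^sup>2" by (rule \<epsilon>(3))
  finally have small: "\<parallel>\<lambda>x. r x - \<delta>\<^sup>2 * k0 x\<parallel> \<le> 1 / (2 * L)" by (rule power2_le_imp_le) (use L in simp)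
  \<comment> \<open>This is the factorization of
    \<open>(G + \<gamma>)\<^sup>2 - \<delta>\<^sup>2\<close> applied to \<open>k0\<close>:
    \<open>y0\<close> is \<open>(G + \<gamma> + \<delta>) k0\<close>, and
    \<open>G + \<gamma> - \<delta>\<close> maps it to the small residual.\<close>
  define y0 y1 where "y0 x = 1 * f x + \<delta> * k0 x" and "y1 x = 1 * g x + \<delta> * k1 x" for x
  have y: "(y0, y1) \<in> G" unfolding y0_def y1_def by (rule generator_lincomb[OF fg(1) k(1)])
  note yl = generator_l2[OF y]
  have "\<parallel>y0\<parallel> \<le> C1 * \<parallel>\<lambda>x. y1 x + (\<gamma> - \<delta>) * y0 x\<parallel>" by (rule C1(2)[OF y])
  also have "(\<lambda>x. y1 x + (\<gamma> - \<delta>) * y0 x) = (\<lambda>x. r x - \<delta>\<^sup>2 * k0 x)"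
    by (rule ext) (simp add: y0_def y1_def k1 r_def algebra_simps power2_eq_square)
  finally have y_small: "\<parallel>y0\<parallel> \<le> C1 * (1 / (2 * L))" using mult_left_mono[OF small, of C1] C1(1) by simp
  have "\<parallel>k0\<parallel> \<le> C2 * \<parallel>\<lambda>x. k1 x + (\<gamma> + \<delta>) * k0 x\<parallel>" by (rule C2(2)[OF k(1)])
  also have "(\<lambda>x. k1 x + (\<gamma> + \<delta>) * k0 x) = y0"
    by (rule ext) (simp add: y0_def k1 algebra_simps)
  finally have k_small: "\<parallel>k0\<parallel> \<le> C2 * (C1 * (1 / (2 * L)))" using mult_left_mono[OF y_small, of C2] C2(1) by simp
  have "\<parallel>f\<parallel> \<le> C2 * \<parallel>\<lambda>x. g x + (\<gamma> + \<delta>) * f x\<parallel>" by (rule C2(2)[OF fg(1)])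
  also have "(\<lambda>x. g x + (\<gamma> + \<delta>) * f x) = (\<lambda>x. (r x - \<delta>\<^sup>2 * k0 x) + \<delta> * y0 x)"
    by (rule ext) (simp add: y0_def r_def algebra_simps power2_eq_square)
  also have "\<parallel>\<lambda>x. (r x - \<delta>\<^sup>2 * k0 x) + \<delta> * y0 x\<parallel> \<le> \<parallel>\<lambda>x. r x - \<delta>\<^sup>2 * k0 x\<parallel> + \<parallel>\<lambda>x. \<delta> * y0 x\<parallel>"
    by (intro l2_norm_triangle l2_diff l2_cmult r kl yl)
  also have "\<dots> \<le> 1 / (2 * L) + \<delta> * (C1 * (1 / (2 * L)))"
    unfolding l2_norm_cmult using \<delta>_pos by (intro add_mono mult_mono small y_small) (auto simp: l2_norm_nonneg)
  finally have "\<parallel>f\<parallel> \<le> C2 * (1 / (2 * L) + \<delta> * (C1 * (1 / (2 * L))))" using C2(1) by simp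
  also have "\<dots> = L * (1 / (2 * L))" unfolding L_def by (simp only: distrib_left distrib_right) (simp only: ac_simps)
  also have "\<dots> = 1 / 2" using L by simp
  finally show False using fg(2) by simp
qed

text \<open>The estimate at the midpoint \<open>\<mu> / 2\<close>, squared; the terms in
  \<open>\<parallel>f\<parallel>\<^sup>2\<close> cancel. On the spectrum of \<open>- G\<close> it
  reads \<open>x\<^sup>2 \<ge> \<mu> x\<close>, which excludes exactly the open interval from 0 to
  \<open>\<mu>\<close>.\<close>

lemma gap_inequality:
  assumes res: "\<And>\<nu>. 0 < \<nu> \<Longrightarrow> \<nu> < \<mu> \<Longrightarrow> \<nu> \<in> resolvent_set P (neg_op G)"
    and \<mu>: "\<mu> > 0" and fg: "(f, g) \<in> G"
  shows "- \<mu> * \<langle>g, f\<rangle> \<le> \<parallel>g\<parallel>\<^sup>2"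
proof -
  note l = generator_l2[OF fg]
  have "\<mu> / 2 * \<parallel>f\<parallel> \<le> \<parallel>\<lambda>x. g x + \<mu> / 2 * f x\<parallel>"
    by (rule gap_midpoint[OF _ _ fg]) (use \<mu> res in auto)
  then have "(\<mu> / 2 * \<parallel>f\<parallel>)\<^sup>2 \<le> \<parallel>\<lambda>x. g x + \<mu> / 2 * f x\<parallel>\<^sup>2"
    using \<mu> by (intro power_mono) (auto simp: l2_norm_nonneg)
  also have "\<dots> = \<parallel>g\<parallel>\<^sup>2 + \<mu> * \<langle>g, f\<rangle> + (\<mu> / 2 * \<parallel>f\<parallel>)\<^sup>2"
    using l2_norm_square_diff[OF l(2,1), of "- \<mu> / 2"] by (simp add: power_mult_distrib power_divide)
  finally show ?thesis by simp
qed

text \<open>With \<open>u(s) = \<parallel>T\<^sub>s f\<parallel>\<^sup>2\<close> and \<open>w(s) = - \<langle>G T\<^sub>s f, T\<^sub>s f\<rangle>\<close>, the gap inequality makes \<open>u - w / \<mu>\<close> nondecreasing,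
  while \<open>u(s)\<close> tends to zero.\<close>

lemma poincare_inequality:
  assumes res: "\<And>\<nu>. 0 < \<nu> \<Longrightarrow> \<nu> < \<mu> \<Longrightarrow> \<nu> \<in> resolvent_set P (neg_op G)"
    and ker: "\<And>g. (g, \<lambda>_. 0) \<in> G \<Longrightarrow> \<exists>c. AE x in P. g x = c"
    and \<mu>: "\<mu> > 0" and fg: "(f, g) \<in> G" and mean: "\<langle>f, \<lambda>_. 1\<rangle> = 0"
  shows "\<mu> * \<parallel>f\<parallel>\<^sup>2 \<le> - \<langle>g, f\<rangle>"
proof -
  note l = generator_l2[OF fg]
  \<comment> \<open>By symmetry \<open>F s\<close> is \<open>u - w / \<mu>\<close> at time
    \<open>s / 2\<close>. In this form the second vector of each inner product stays fixed, so
    \<open>T_inner_DERIV\<close> applies directly.\<close>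
  define F where "F s = \<langle>T s f, f\<rangle> + (1 / \<mu>) * \<langle>T s f, g\<rangle>" for s
  have mono: "F 0 \<le> F S" if "S \<ge> 0" for S
  proof (rule DERIV_nonneg_imp_increasing_open[OF that])
    show "continuous_on {0..S} F"
      unfolding F_def
      by (intro continuous_intros continuous_on_subset[OF continuous_T_inner[OF l(1,1)]]
          continuous_on_subset[OF continuous_T_inner[OF l(1,2)]]) auto
    fix s assume s: "0 < s" "s < S"
    have "(F has_real_derivative \<langle>T s g, f\<rangle> + (1 / \<mu>) * \<langle>T s g, g\<rangle>) (at s)"
      unfolding F_def by (intro DERIV_add DERIV_cmult T_inner_DERIV fg l s)
    moreover have "\<langle>T s g, f\<rangle> + (1 / \<mu>) * \<langle>T s g, g\<rangle> \<ge> 0"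
    proof -
      have h: "(T (s / 2) f, T (s / 2) g) \<in> G" using T_generator[OF _ fg] s by simp
      have "\<langle>T s g, f\<rangle> = \<langle>T (s / 2) (T (s / 2) g), f\<rangle>"
        using T_add[of "s / 2" "s / 2" g] s l T_l2 l2_measurable by (intro l2_inner_cong_AE) auto
      also have "\<dots> = \<langle>T (s / 2) g, T (s / 2) f\<rangle>" by (rule T_symmetric) (use s l T_l2 in auto)
      finally have 1: "\<langle>T s g, f\<rangle> = \<langle>T (s / 2) g, T (s / 2) f\<rangle>" .
      have 2: "\<langle>T s g, g\<rangle> = \<parallel>T (s / 2) g\<parallel>\<^sup>2" using T_inner_square[of "s / 2" g] s l by simp
      show ?thesis using gap_inequality[OF res \<mu> h] \<mu> unfolding 1 2 by (simp add: field_simps)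
    qed
    ultimately show "\<exists>y. (F has_real_derivative y) (at s) \<and> 0 \<le> y" by blast
  qed
  have "F (2 * real n) \<le> \<langle>T (2 * real n) f, f\<rangle>" for n
  proof -
    have h: "(T n f, T n g) \<in> G" using T_generator[OF _ fg] by simp
    have "\<langle>T (2 * real n) f, g\<rangle> = \<langle>T n (T n f), g\<rangle>"
      using T_add[of n n f] l T_l2 l2_measurable by (intro l2_inner_cong_AE) auto
    also have "\<dots> = \<langle>T n f, T n g\<rangle>" by (rule T_symmetric) (use l T_l2 in auto)
    also have "\<dots> \<le> 0" using generator_nonpos[OF h] by (simp add: l2_inner_commute)
    finally show ?thesis using \<mu> by (simp add: F_def divide_nonpos_pos)
  qed
  then have "F 0 \<le> \<langle>T (2 * real n) f, f\<rangle>" for n using mono[of "2 * real n"] order_trans by fastforce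
  then have "F 0 \<le> 0"
    by (intro LIMSEQ_le_const[OF T_inner_tendsto_0[OF ker l(1) mean]]) auto
  moreover have "\<langle>T 0 f, f\<rangle> = \<langle>f, f\<rangle>" "\<langle>T 0 f, g\<rangle> = \<langle>f, g\<rangle>"
    using T_zero[OF l(1)] l T_l2[of 0 f] l2_measurable by (intro l2_inner_cong_AE; auto)+
  ultimately have "\<parallel>f\<parallel>\<^sup>2 + (1 / \<mu>) * \<langle>g, f\<rangle> \<le> 0" unfolding F_def by (simp add: l2_norm_square l2_inner_commute[of P f g])
  then show ?thesis using \<mu> by (simp add: field_simps)
qed

text \<open>On the domain this is a Gronwall argument: the Poincare inequality makes
  \<open>exp (\<mu> * r) * \<langle>T r f, f\<rangle>\<close> nonincreasing, and at
  \<open>r = 2 * s\<close> the quadratic form is the squared norm at time \<open>s\<close>. General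
  \<open>f\<close> follow by density.\<close>

lemma decay:
  assumes res: "\<And>\<nu>. 0 < \<nu> \<Longrightarrow> \<nu> < \<mu> \<Longrightarrow> \<nu> \<in> resolvent_set P (neg_op G)"
    and ker: "\<And>g. (g, \<lambda>_. 0) \<in> G \<Longrightarrow> \<exists>c. AE x in P. g x = c"
    and \<mu>: "\<mu> > 0" and s: "s \<ge> 0" and f: "f \<in> l2 P" and mean: "\<langle>f, \<lambda>_. 1\<rangle> = 0"
  shows "\<parallel>T s f\<parallel> \<le> exp (- \<mu> * s) * \<parallel>f\<parallel>"
proof -
  have domain: "\<parallel>T s f\<parallel> \<le> exp (- \<mu> * s) * \<parallel>f\<parallel>" if fg: "(f, g) \<in> G" and mean: "\<langle>f, \<lambda>_. 1\<rangle> = 0" for f g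
  proof -
    note l = generator_l2[OF fg]
    define v where "v r = exp (\<mu> * r) * \<langle>T r f, f\<rangle>" for r
    have "v (2 * s) \<le> v 0"
    proof (rule DERIV_nonpos_imp_decreasing_open[of 0 "2 * s" v])
      show "0 \<le> 2 * s" using s by simp
      show "continuous_on {0..2 * s} v"
        unfolding v_def by (intro continuous_intros continuous_on_subset[OF continuous_T_inner[OF l(1,1)]]) auto
      fix r assume r: "0 < r" "r < 2 * s"
      have e: "((\<lambda>r. exp (\<mu> * r)) has_real_derivative \<mu> * exp (\<mu> * r)) (at r)"
        by (auto intro!: derivative_eq_intros)
      have "(v has_real_derivative (\<mu> * exp (\<mu> * r)) * \<langle>T r f, f\<rangle> + \<langle>T r g, f\<rangle> * exp (\<mu> * r)) (at r)"
        unfolding v_def by (rule DERIV_mult[OF e T_inner_DERIV[OF fg l(1) r(1)]])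
      moreover have "(\<mu> * exp (\<mu> * r)) * \<langle>T r f, f\<rangle> + \<langle>T r g, f\<rangle> * exp (\<mu> * r) \<le> 0"
      proof -
        have h: "(T (r / 2) f, T (r / 2) g) \<in> G" using T_generator[OF _ fg] r by simp
        have "\<langle>T r g, f\<rangle> = \<langle>T (r / 2) (T (r / 2) g), f\<rangle>"
          using T_add[of "r / 2" "r / 2" g] r l T_l2 l2_measurable by (intro l2_inner_cong_AE) auto
        also have "\<dots> = \<langle>T (r / 2) g, T (r / 2) f\<rangle>" by (rule T_symmetric) (use r l T_l2 in auto)
        also have "\<dots> \<le> - \<mu> * \<parallel>T (r / 2) f\<parallel>\<^sup>2"
          using poincare_inequality[OF res ker \<mu> h] T_mean[of "r / 2" f] r l mean by simp
        also have "\<parallel>T (r / 2) f\<parallel>\<^sup>2 = \<langle>T r f, f\<rangle>" using T_inner_square[of "r / 2" f] r l by simp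
        finally have "exp (\<mu> * r) * (\<mu> * \<langle>T r f, f\<rangle> + \<langle>T r g, f\<rangle>) \<le> 0"
          by (intro mult_nonneg_nonpos) auto
        then show ?thesis by (simp add: algebra_simps)
      qed
      ultimately show "\<exists>y. (v has_real_derivative y) (at r) \<and> y \<le> 0" by blast
    qed
    moreover have "\<langle>T 0 f, f\<rangle> = \<langle>f, f\<rangle>"
      using T_zero[OF l(1)] l T_l2[of 0 f] l2_measurable by (intro l2_inner_cong_AE) auto
    ultimately have "exp (\<mu> * (2 * s)) * \<parallel>T s f\<parallel>\<^sup>2 \<le> \<parallel>f\<parallel>\<^sup>2"
      unfolding v_def using T_inner_square[OF s l(1)] by (simp add: l2_norm_square)
    moreover have "exp (\<mu> * (2 * s)) = (exp (\<mu> * s))\<^sup>2" by (simp add: exp_double[symmetric] ac_simps)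
    ultimately have "(exp (\<mu> * s) * \<parallel>T s f\<parallel>)\<^sup>2 \<le> \<parallel>f\<parallel>\<^sup>2" by (simp add: power_mult_distrib)
    then have "exp (\<mu> * s) * \<parallel>T s f\<parallel> \<le> \<parallel>f\<parallel>" by (rule power2_le_imp_le) (rule l2_norm_nonneg)
    then show ?thesis by (simp add: exp_minus field_simps)
  qed
  have unit: "\<langle>\<lambda>_. c, \<lambda>_. 1\<rangle> = c" for c using prob_space.prob_space[OF prob] by (simp add: l2_inner_def)
  have "\<parallel>T s f\<parallel> \<le> exp (- \<mu> * s) * \<parallel>f\<parallel> + e" if e: "e > 0" for e
  proof -
    obtain u v where u: "(u, v) \<in> G" "\<parallel>\<lambda>x. u x - f x\<parallel> < e / 4" using generator_dense[OF f, of "e / 4"] e by auto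
    note ul = generator_l2[OF u(1)]
    define m where "m = \<langle>u, \<lambda>_. 1\<rangle>"
    \<comment> \<open>Approximants from the domain need not have mean zero. Subtracting the mean
      stays in the domain, which contains the constants, and costs at most another
      \<open>e / 4\<close>.\<close>
    define w where "w x = 1 * u x + (- m) * 1" for x
    have w: "(w, \<lambda>x. 1 * v x + (- m) * 0) \<in> G" unfolding w_def by (rule generator_lincomb[OF u(1) generator_one])
    note wl = generator_l2(1)[OF w]
    have "\<langle>w, \<lambda>_. 1\<rangle> = 0"
      unfolding w_def using l2_inner_lincomb[OF ul(1) const_l2[of 1] const_l2[of 1], of 1 "- m"] unit[of 1] by (simp add: m_def)
    from domain[OF w this] have dw: "\<parallel>T s w\<parallel> \<le> exp (- \<mu> * s) * \<parallel>w\<parallel>" .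
    have m: "\<bar>m\<bar> \<le> e / 4"
    proof -
      have "m = \<langle>\<lambda>x. u x - f x, \<lambda>_. 1\<rangle>" using mean ul f const_l2 by (simp add: m_def l2_inner_diff_left)
      then have "\<bar>m\<bar> \<le> \<parallel>\<lambda>x. u x - f x\<parallel> * \<parallel>\<lambda>_. 1\<parallel>" using l2_Cauchy_Schwarz[OF l2_diff[OF ul(1) f] const_l2[of 1]] by simp
      moreover have "\<parallel>\<lambda>_. 1\<parallel> = 1" using unit[of 1] by (simp add: l2_norm_def)
      ultimately show ?thesis using u(2) by simp
    qed
    have wf: "\<parallel>\<lambda>x. w x - f x\<parallel> \<le> e / 2"
    proof -
      have "\<parallel>\<lambda>x. w x - f x\<parallel> = \<parallel>\<lambda>x. (u x - f x) + (- m) * 1\<parallel>" by (simp add: w_def algebra_simps)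
      also have "\<dots> \<le> \<parallel>\<lambda>x. u x - f x\<parallel> + \<parallel>\<lambda>x. (- m) * 1\<parallel>"
        by (rule l2_norm_triangle[OF l2_diff[OF ul(1) f]]) (use const_l2[of "- m"] in simp)
      also have "\<parallel>\<lambda>x. (- m) * 1\<parallel> = \<bar>m\<bar>" using l2_norm_cmult[of P "- m" "\<lambda>_. 1"] unit[of 1] by (simp add: l2_norm_def)
      finally show ?thesis using u(2) m by simp
    qed
    have "\<parallel>T s f\<parallel> \<le> \<parallel>\<lambda>x. T s f x - T s w x\<parallel> + \<parallel>T s w\<parallel>" by (intro l2_norm_le_diff T_l2 s f wl)
    also have "\<parallel>\<lambda>x. T s f x - T s w x\<parallel> \<le> e / 2" using T_diff_norm[OF s f wl] wf l2_norm_minus_commute[of P f w] by simp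
    also have "\<parallel>T s w\<parallel> \<le> exp (- \<mu> * s) * (\<parallel>f\<parallel> + e / 2)"
    proof -
      have "\<parallel>w\<parallel> \<le> \<parallel>f\<parallel> + e / 2" using l2_norm_le_diff[OF wl f] wf by simp
      then show ?thesis using dw by (meson exp_ge_zero mult_left_mono order_trans)
    qed
    also have "exp (- \<mu> * s) * (\<parallel>f\<parallel> + e / 2) \<le> exp (- \<mu> * s) * \<parallel>f\<parallel> + e / 2"
      using e \<mu> s by (simp add: distrib_left mult_left_le_one_le)
    finally show ?thesis by simp
  qed
  then show ?thesis by (rule field_le_epsilon)
qed

text \<open>Extremality at \<open>t\<close> forces \<open>\<parallel>T s f\<parallel> = exp (- \<mu>
  * s) * \<parallel>f\<parallel>\<close> for \<open>0 \<le> s \<le> t / 2\<close>, since an excess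
  loss before \<open>s\<close> could not be regained afterwards. The equality case of Cauchy-Schwarz
  makes \<open>T s f\<close> the corresponding multiple of \<open>f\<close>, and the derivative at 0
  then exists.\<close>

lemma extremal_imp_eigenfunction:
  assumes decay: "\<And>s f. s \<ge> 0 \<Longrightarrow> f \<in> l2 P \<Longrightarrow> \<langle>f, \<lambda>_. 1\<rangle> = 0 \<Longrightarrow> \<parallel>T s f\<parallel> \<le> exp (- \<mu> * s) * \<parallel>f\<parallel>"
    and t: "t > 0" and f: "f \<in> l2 P" and mean: "\<langle>f, \<lambda>_. 1\<rangle> = 0"
    and ext: "\<langle>T t f, f\<rangle> \<ge> exp (- \<mu> * t) * \<parallel>f\<parallel>\<^sup>2"
  shows "(f, \<lambda>x. - \<mu> * f x) \<in> G"
proof -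
  have one: "\<langle>T s f, \<lambda>_. 1\<rangle> = 0" if "s \<ge> 0" for s using T_mean[OF that f] mean by simp
  have norm_half: "\<parallel>T (t / 2) f\<parallel> \<ge> exp (- \<mu> * (t / 2)) * \<parallel>f\<parallel>"
  proof (rule power2_le_imp_le)
    have "(exp (- \<mu> * (t / 2)))\<^sup>2 = exp (- \<mu> * t)" by (simp add: exp_double[symmetric])
    then show "(exp (- \<mu> * (t / 2)) * \<parallel>f\<parallel>)\<^sup>2 \<le> \<parallel>T (t / 2) f\<parallel>\<^sup>2"
      using ext T_inner_square[of "t / 2" f] t f by (simp add: power_mult_distrib)
  qed (rule l2_norm_nonneg)
  have eq: "\<parallel>T s f\<parallel> = exp (- \<mu> * s) * \<parallel>f\<parallel>" if s: "0 \<le> s" "s \<le> t / 2" for s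
  proof (rule antisym)
    show "\<parallel>T s f\<parallel> \<le> exp (- \<mu> * s) * \<parallel>f\<parallel>" by (rule decay[OF s(1) f mean])
    have "exp (- \<mu> * (t / 2)) * \<parallel>f\<parallel> \<le> \<parallel>T ((t / 2 - s) + s) f\<parallel>" using norm_half by simp
    also have "\<dots> = \<parallel>T (t / 2 - s) (T s f)\<parallel>" by (rule T_add_norm) (use s f in auto)
    also have "\<dots> \<le> exp (- \<mu> * (t / 2 - s)) * \<parallel>T s f\<parallel>" by (rule decay) (use s f one T_l2 in auto)
    finally have "exp (- \<mu> * (t / 2 - s)) * (exp (- \<mu> * s) * \<parallel>f\<parallel>) \<le> exp (- \<mu> * (t / 2 - s)) * \<parallel>T s f\<parallel>"
      by (simp add: mult.assoc[symmetric] exp_add[symmetric] algebra_simps)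
    then show "exp (- \<mu> * s) * \<parallel>f\<parallel> \<le> \<parallel>T s f\<parallel>" by simp
  qed
  have T_eq: "\<parallel>\<lambda>x. T s f x - exp (- \<mu> * s) * f x\<parallel> = 0" if s: "0 \<le> s" "s \<le> t / 2" for s
  proof -
    have "\<langle>T s f, f\<rangle> = \<parallel>T (s / 2) f\<parallel>\<^sup>2" using T_inner_square[of "s / 2" f] s f by simp
    also have "\<dots> = exp (- \<mu> * s) * \<parallel>f\<parallel>\<^sup>2"
      using eq[of "s / 2"] s by (simp add: power_mult_distrib exp_double[symmetric])
    finally have "\<parallel>\<lambda>x. T s f x - exp (- \<mu> * s) * f x\<parallel>\<^sup>2 = 0"
      unfolding l2_norm_square_diff[OF T_l2[OF s(1) f] f] eq[OF s] by (simp add: power_mult_distrib power2_eq_square)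
    then show ?thesis by simp
  qed
  have q: "\<parallel>\<lambda>x. (T s f x - f x) / s - - \<mu> * f x\<parallel> \<le> \<bar>(exp (- \<mu> * s) - 1) / s + \<mu>\<bar> * \<parallel>f\<parallel>" if s: "0 < s" "s \<le> t / 2" for s
  proof -
    have "AE x in P. T s f x - exp (- \<mu> * s) * f x = 0"
      using T_eq[of s] s l2_norm_eq_0_iff[OF l2_diff[OF T_l2[OF less_imp_le[OF s(1)] f] l2_cmult[OF f, of "exp (- \<mu> * s)"]]] by simp
    then have "AE x in P. (T s f x - f x) / s - - \<mu> * f x = ((exp (- \<mu> * s) - 1) / s + \<mu>) * f x"
      by eventually_elim (simp add: field_simps)
    then have "\<parallel>\<lambda>x. (T s f x - f x) / s - - \<mu> * f x\<parallel> = \<parallel>\<lambda>x. ((exp (- \<mu> * s) - 1) / s + \<mu>) * f x\<parallel>"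
      using l2_measurable[OF T_l2[of s f]] l2_measurable[OF f] f s
      by (intro l2_norm_cong_AE) (auto intro!: borel_measurable_diff borel_measurable_divide borel_measurable_times)
    then show ?thesis by (simp only: l2_norm_cmult order_refl)
  qed
  have "((\<lambda>s. \<parallel>\<lambda>x. (T s f x - f x) / s - - \<mu> * f x\<parallel>) \<longlongrightarrow> 0) (at_right 0)"
  proof (rule Lim_null_comparison)
    have "((\<lambda>s. exp (- \<mu> * s)) has_real_derivative - \<mu>) (at 0)"
      by (auto intro!: derivative_eq_intros)
    then have "((\<lambda>s. (exp (- \<mu> * s) - 1) / s) \<longlongrightarrow> - \<mu>) (at 0)" by (simp add: DERIV_def)
    then have "((\<lambda>s. (exp (- \<mu> * s) - 1) / s) \<longlongrightarrow> - \<mu>) (at_right 0)" by (rule filterlim_mono) (auto simp: at_le)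
    then have "((\<lambda>s. \<bar>(exp (- \<mu> * s) - 1) / s + \<mu>\<bar> * \<parallel>f\<parallel>) \<longlongrightarrow> \<bar>- \<mu> + \<mu>\<bar> * \<parallel>f\<parallel>) (at_right 0)"
      by (intro tendsto_intros)
    then show "((\<lambda>s. \<bar>(exp (- \<mu> * s) - 1) / s + \<mu>\<bar> * \<parallel>f\<parallel>) \<longlongrightarrow> 0) (at_right 0)" by simp
    show "\<forall>\<^sub>F s in at_right 0. norm \<parallel>\<lambda>x. (T s f x - f x) / s - - \<mu> * f x\<parallel> \<le> \<bar>(exp (- \<mu> * s) - 1) / s + \<mu>\<bar> * \<parallel>f\<parallel>"
      by (rule eventually_at_rightI[of 0 "t / 2"]) (use t q in \<open>auto simp: l2_norm_nonneg\<close>)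
  qed
  then show ?thesis using f l2_cmult[OF f, of "- \<mu>"] generator_iff by blast
qed

end

section \<open>The Langevin semigroup and the alignment loss\<close>

locale langevin = weighted_manifold M p mtype
  for M :: "(real^'d) set" and p :: "real^'d \<Rightarrow> real" and mtype :: "'m::finite itself" +
  fixes V :: "(real^'d) measure" and K :: "real \<Rightarrow> real^'d \<Rightarrow> (real^'d) measure"
  assumes M_closed: "closed M"
    and vol: "riemannian_volume TYPE('m) M V"
    and prob: "prob_space (law V p)"
    and kernels: "langevin_kernels M V p K"
    and stationary: "\<forall>s\<ge>0. law V p \<bind> K s = law V p"
    and sa: "self_adjoint (law V p) (neg_op (weighted_laplacian_op M V p))"
begin

abbreviation "P \<equiv> law V p"
abbreviation "G \<equiv> weighted_laplacian_op M V p"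
abbreviation "T \<equiv> transition_operator K"
abbreviation "MM \<equiv> restrict_space borel M"

lemma sets_V: "sets V = sets MM"
  using vol by (simp add: riemannian_volume_def)

lemma sets_P[measurable_cong]: "sets P = sets MM"
  by (simp add: law_def sets_V)

lemma space_P: "space P = M"
  using sets_eq_imp_space_eq[OF sets_P] by (simp add: space_restrict_space)

lemma measurable_P: "measurable P N = measurable MM N"
  by (rule measurable_cong_sets[OF sets_P refl])

lemma continuous_measurable:
  assumes "continuous_on M f"
  shows "f \<in> borel_measurable P"
  unfolding measurable_P by (rule borel_measurable_continuous_on_restrict[OF assms])

lemma K_prob_algebra: "s \<ge> 0 \<Longrightarrow> K s \<in> MM \<rightarrow>\<^sub>M prob_algebra MM"
  using kernels by (simp add: langevin_kernels_def)

lemma K_subprob: "s \<ge> 0 \<Longrightarrow> K s \<in> P \<rightarrow>\<^sub>M subprob_algebra P"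
proof -
  assume "s \<ge> 0"
  then have "K s \<in> MM \<rightarrow>\<^sub>M subprob_algebra MM" using K_prob_algebra measurable_prob_algebraD by blast
  moreover have "subprob_algebra MM = subprob_algebra P" by (rule subprob_algebra_cong) (simp add: sets_P)
  ultimately show ?thesis by (simp add: measurable_P)
qed

lemma K_prob: "s \<ge> 0 \<Longrightarrow> z \<in> M \<Longrightarrow> prob_space (K s z)"
  and sets_K: "s \<ge> 0 \<Longrightarrow> z \<in> M \<Longrightarrow> sets (K s z) = sets MM"
  using measurable_space[OF K_prob_algebra] by (auto simp: space_prob_algebra space_restrict_space)

lemma space_K: "s \<ge> 0 \<Longrightarrow> z \<in> M \<Longrightarrow> space (K s z) = M"
  using sets_eq_imp_space_eq[OF sets_K] by (simp add: space_restrict_space)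

lemma measurable_K: "s \<ge> 0 \<Longrightarrow> z \<in> M \<Longrightarrow> f \<in> measurable P N \<Longrightarrow> f \<in> measurable (K s z) N"
  using measurable_cong_sets[OF sets_K refl, of s z N] by (simp add: measurable_P)

lemma nn_integral_K:
  assumes "s \<ge> 0" "f \<in> borel_measurable P"
  shows "(\<integral>\<^sup>+z. (\<integral>\<^sup>+z'. f z' \<partial>K s z) \<partial>P) = (\<integral>\<^sup>+z. f z \<partial>P)"
  using nn_integral_bind[OF assms(2) K_subprob[OF assms(1)]] stationary assms(1) by simp

lemma measurable_nn_integral_K:
  assumes "s \<ge> 0" "f \<in> borel_measurable P"
  shows "(\<lambda>z. \<integral>\<^sup>+z'. f z' \<partial>K s z) \<in> borel_measurable P"
  by (rule measurable_compose[OF K_subprob[OF assms(1)] nn_integral_measurable_subprob_algebra[OF assms(2)]])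

text \<open>By stationarity a null set has average kernel mass zero. A minimizer agrees with a
  linear map only almost everywhere, and the loss evaluates it at the endpoint of the transition as
  well as at its start.\<close>

lemma AE_K:
  assumes s: "s \<ge> 0" and Q: "AE z in P. Q z"
  shows "AE z in P. AE z' in K s z. Q z'"
proof -
  obtain N where N: "N \<in> null_sets P" "{z \<in> space P. \<not> Q z} \<subseteq> N"
    using Q by (auto simp: eventually_ae_filter)
  have Ns: "N \<in> sets P" using N(1) by auto
  then have im: "(indicator N :: _ \<Rightarrow> ennreal) \<in> borel_measurable P" by (rule borel_measurable_indicator)
  have "(\<integral>\<^sup>+z. (\<integral>\<^sup>+z'. indicator N z' \<partial>K s z) \<partial>P) = emeasure P N"
    using nn_integral_K[OF s im] Ns by simp
  then have "(\<integral>\<^sup>+z. (\<integral>\<^sup>+z'. indicator N z' \<partial>K s z) \<partial>P) = 0" using N(1) by auto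
  then have "AE z in P. (\<integral>\<^sup>+z'. indicator N z' \<partial>K s z) = 0"
    by (subst (asm) nn_integral_0_iff_AE) (auto intro!: measurable_nn_integral_K s im)
  then show ?thesis
    using AE_space
  proof eventually_elim
    case (elim z)
    then have z: "z \<in> M" by (simp add: space_P)
    have "N \<in> sets (K s z)" using Ns by (simp add: sets_K[OF s z] sets_P)
    then have "N \<in> null_sets (K s z)" using elim by (auto simp: null_sets_def)
    then show ?case
      by (rule AE_I') (use N(2) in \<open>auto simp: space_K[OF s z] space_P\<close>)
  qed
qed

lemma nn_integral_l2:
  assumes "f \<in> l2 Q"
  shows "(\<integral>\<^sup>+x. ennreal ((f x)\<^sup>2) \<partial>Q) = ennreal (l2_inner Q f f)"
  using nn_integral_eq_integral[OF l2_integrable_square[OF assms]]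
  by (simp add: l2_inner_def power2_eq_square)

lemma l2_iff_nn_integral:
  "f \<in> l2 Q \<longleftrightarrow> f \<in> borel_measurable Q \<and> (\<integral>\<^sup>+x. ennreal ((f x)\<^sup>2) \<partial>Q) < \<infinity>"
  by (auto simp: l2_def integrable_iff_bounded)

lemma AE_l2_K:
  assumes s: "s \<ge> 0" and f: "f \<in> l2 P"
  shows "AE z in P. f \<in> l2 (K s z)"
proof -
  have m: "(\<lambda>z. ennreal ((f z)\<^sup>2)) \<in> borel_measurable P" using l2_measurable[OF f] by measurable
  have "(\<integral>\<^sup>+z. (\<integral>\<^sup>+z'. ennreal ((f z')\<^sup>2) \<partial>K s z) \<partial>P) \<noteq> \<infinity>"
    unfolding nn_integral_K[OF s m] nn_integral_l2[OF f] by simp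
  from nn_integral_PInf_AE[OF measurable_nn_integral_K[OF s m] this] show ?thesis
    using AE_space
  proof eventually_elim
    case (elim z)
    then show ?case
      using measurable_K[OF s _ l2_measurable[OF f], of z] by (simp add: l2_iff_nn_integral less_top space_P)
  qed
qed

lemma K_jensen:
  assumes s: "s \<ge> 0" and z: "z \<in> M" and f: "f \<in> l2 (K s z)"
  shows "(T s f z)\<^sup>2 \<le> l2_inner (K s z) f f"
proof -
  interpret Kz: prob_space "K s z" by (rule K_prob[OF s z])
  have one: "(\<lambda>_. 1) \<in> l2 (K s z)" by (simp add: l2_def)
  have "\<bar>l2_inner (K s z) f (\<lambda>_. 1)\<bar> \<le> l2_norm (K s z) f * l2_norm (K s z) (\<lambda>_. 1)"
    by (rule l2_Cauchy_Schwarz[OF f one])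
  also have "l2_norm (K s z) (\<lambda>_. 1) = 1" by (simp add: l2_norm_def l2_inner_def Kz.prob_space)
  finally have "\<bar>T s f z\<bar> \<le> l2_norm (K s z) f" by (simp add: l2_inner_def transition_operator_def)
  then have "\<bar>T s f z\<bar>\<^sup>2 \<le> (l2_norm (K s z) f)\<^sup>2" by (rule power_mono) simp
  then show ?thesis by (simp add: l2_norm_square)
qed

lemma T_in_l2: "s \<ge> 0 \<Longrightarrow> f \<in> l2 P \<Longrightarrow> T s f \<in> l2 P"
  using kernels unfolding langevin_kernels_def generates_semigroup_def by blast

text \<open>Jensen's inequality holds under almost every kernel, where \<open>AE_l2_K\<close>
  supplies square integrability; stationarity then removes the kernel from the integral.\<close>

lemma T_contraction:
  assumes s: "s \<ge> 0" and f: "f \<in> l2 P"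
  shows "l2_norm P (T s f) \<le> l2_norm P f"
proof -
  have m: "(\<lambda>z. ennreal ((f z)\<^sup>2)) \<in> borel_measurable P" using l2_measurable[OF f] by measurable
  have "ennreal (l2_inner P (T s f) (T s f)) = (\<integral>\<^sup>+z. ennreal ((T s f z)\<^sup>2) \<partial>P)"
    by (rule nn_integral_l2[OF T_in_l2[OF s f], symmetric])
  also have "\<dots> \<le> (\<integral>\<^sup>+z. (\<integral>\<^sup>+z'. ennreal ((f z')\<^sup>2) \<partial>K s z) \<partial>P)"
  proof (rule nn_integral_mono_AE, use AE_l2_K[OF s f] AE_space in eventually_elim)
    fix z assume z: "f \<in> l2 (K s z)" "z \<in> space P"
    then show "ennreal ((T s f z)\<^sup>2) \<le> (\<integral>\<^sup>+z'. ennreal ((f z')\<^sup>2) \<partial>K s z)"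
      unfolding nn_integral_l2[OF z(1)] using K_jensen[OF s _ z(1)] by (auto simp: space_P intro: ennreal_leI)
  qed
  also have "\<dots> = ennreal (l2_inner P f f)"
    unfolding nn_integral_K[OF s m] by (rule nn_integral_l2[OF f])
  finally have "l2_inner P (T s f) (T s f) \<le> l2_inner P f f"
    by (simp only: ennreal_le_iff[OF l2_inner_nonneg])
  then show ?thesis by (simp add: l2_norm_def)
qed

sublocale semigroup: selfadjoint_semigroup P G T
proof (rule selfadjoint_semigroup.intro)
  show "prob_space P" by (rule prob)
  show "generates_semigroup P G T" using kernels by (simp add: langevin_kernels_def)
  show "self_adjoint P (neg_op G)" by (rule sa)
  show "l2_norm P (T s f) \<le> l2_norm P f" if "s \<ge> 0" "f \<in> l2 P" for s f by (rule T_contraction[OF that])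
  show "AE x in P. T s (\<lambda>_. 1) x = 1" if "s \<ge> 0" for s
  proof (rule AE_I2)
    fix x assume "x \<in> space P"
    then interpret prob_space "K s x" using K_prob[OF that] by (simp add: space_P)
    show "T s (\<lambda>_. 1) x = 1" by (simp add: transition_operator_def prob_space)
  qed
qed

text \<open>Expand the square; by stationarity \<open>T\<^sub>s (f\<^sup>2)\<close> has the same mean as \<open>f\<^sup>2\<close>.\<close>

lemma nn_integral_increment:
  assumes s: "s \<ge> 0" and f: "f \<in> l2 P"
  shows "(\<integral>\<^sup>+z. (\<integral>\<^sup>+z'. ennreal ((f z' - f z)\<^sup>2) \<partial>K s z) \<partial>P)
    = ennreal (2 * l2_inner P f f - 2 * l2_inner P (T s f) f)"
proof -
  \<comment> \<open>A real version of \<open>T s\<close> applied to the square of \<open>f\<close>.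
    Passing through \<open>enn2real\<close> inherits measurability from the kernel, and the default
    where the integral is infinite concerns a null set only.\<close>
  define q where "q z = enn2real (\<integral>\<^sup>+z'. ennreal ((f z')\<^sup>2) \<partial>K s z)" for z
  have m: "(\<lambda>z. ennreal ((f z)\<^sup>2)) \<in> borel_measurable P" using l2_measurable[OF f] by measurable
  have q_meas: "q \<in> borel_measurable P"
    unfolding q_def using measurable_nn_integral_K[OF s m] by measurable
  have q_eq: "AE z in P. ennreal (q z) = (\<integral>\<^sup>+z'. ennreal ((f z')\<^sup>2) \<partial>K s z) \<and> q z = l2_inner (K s z) f f"
    using AE_l2_K[OF s f]
  proof eventually_elim
    case (elim z)
    then show ?case unfolding q_def nn_integral_l2[OF elim] using l2_inner_nonneg[of "K s z" f] by simp
  qed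
  have q_nn: "(\<integral>\<^sup>+z. ennreal (q z) \<partial>P) = ennreal (l2_inner P f f)"
  proof -
    have "(\<integral>\<^sup>+z. ennreal (q z) \<partial>P) = (\<integral>\<^sup>+z. (\<integral>\<^sup>+z'. ennreal ((f z')\<^sup>2) \<partial>K s z) \<partial>P)"
      by (rule nn_integral_cong_AE) (use q_eq in eventually_elim, blast)
    then show ?thesis unfolding nn_integral_K[OF s m] nn_integral_l2[OF f] .
  qed
  have q_int: "integrable P q"
    by (rule integrableI_nonneg[OF q_meas]) (auto simp: q_nn, simp add: q_def)
  have q_val: "(\<integral>z. q z \<partial>P) = l2_inner P f f"
  proof -
    have q0: "q z \<ge> 0" for z by (simp add: q_def)
    then have "ennreal (\<integral>z. q z \<partial>P) = ennreal (l2_inner P f f)"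
      using q_nn nn_integral_eq_integral[OF q_int] by simp
    moreover have "(\<integral>z. q z \<partial>P) \<ge> 0" by (rule integral_nonneg_AE) (simp add: q0)
    ultimately show ?thesis using l2_inner_nonneg[of P f] by simp
  qed
  define R where "R z = q z - 2 * (T s f z * f z) + f z * f z" for z
  have inner: "AE z in P. (\<integral>\<^sup>+z'. ennreal ((f z' - f z)\<^sup>2) \<partial>K s z) = ennreal (R z) \<and> R z \<ge> 0"
    using AE_l2_K[OF s f] q_eq AE_space
  proof eventually_elim
    case (elim z)
    then have z: "z \<in> M" by (simp add: space_P)
    interpret Kz: prob_space "K s z" by (rule K_prob[OF s z])
    have const: "(\<lambda>_. a) \<in> l2 (K s z)" for a by (simp add: l2_def)
    have d: "(\<lambda>z'. f z' - f z) \<in> l2 (K s z)" by (rule l2_diff[OF elim(1) const])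
    have "l2_inner (K s z) (\<lambda>z'. f z' - f z) (\<lambda>z'. f z' - f z)
        = l2_inner (K s z) f f - 2 * l2_inner (K s z) f (\<lambda>_. f z) + l2_inner (K s z) (\<lambda>_. f z) (\<lambda>_. f z)"
      using elim(1) const
      by (simp add: l2_inner_diff_left l2_inner_diff_right l2_diff l2_inner_commute[of "K s z" "\<lambda>_. f z" f])
    also have "l2_inner (K s z) f (\<lambda>_. f z) = T s f z * f z" by (simp add: l2_inner_def transition_operator_def)
    also have "l2_inner (K s z) (\<lambda>_. f z) (\<lambda>_. f z) = f z * f z" by (simp add: l2_inner_def Kz.prob_space)
    finally have "l2_inner (K s z) (\<lambda>z'. f z' - f z) (\<lambda>z'. f z' - f z) = R z" using elim(2) by (simp add: R_def)
    then show ?case using nn_integral_l2[OF d] l2_inner_nonneg[of "K s z" "\<lambda>z'. f z' - f z"] by simp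
  qed
  note Tf = T_in_l2[OF s f]
  have R_int: "integrable P R"
    unfolding R_def using q_int l2_integrable_mult[OF Tf f] l2_integrable_mult[OF f f] by simp
  have "(\<integral>\<^sup>+z. (\<integral>\<^sup>+z'. ennreal ((f z' - f z)\<^sup>2) \<partial>K s z) \<partial>P) = (\<integral>\<^sup>+z. ennreal (R z) \<partial>P)"
    by (rule nn_integral_cong_AE) (use inner in eventually_elim, simp)
  also have "\<dots> = ennreal (\<integral>z. R z \<partial>P)"
    by (rule nn_integral_eq_integral[OF R_int]) (use inner in eventually_elim, simp)
  also have "(\<integral>z. R z \<partial>P) = 2 * l2_inner P f f - 2 * l2_inner P (T s f) f"
    unfolding R_def using q_int l2_integrable_mult[OF Tf f] l2_integrable_mult[OF f f] q_val
    by (simp add: l2_inner_def)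
  finally show ?thesis .
qed

section \<open>The alignment loss of the identity and of linear maps\<close>

lemma vec_measurable: "(\<lambda>z. z) \<in> borel_measurable P"
  by (rule continuous_measurable) (rule continuous_on_id)

lemma coord_l2:
  assumes "integrable P (\<lambda>z. (norm z)\<^sup>2)"
  shows "(\<lambda>z. z $ i) \<in> l2 P"
proof -
  have m: "(\<lambda>z. z $ i) \<in> borel_measurable P" by (rule continuous_measurable) (intro continuous_intros)
  have "integrable P (\<lambda>z. (z $ i)\<^sup>2)"
  proof (rule Bochner_Integration.integrable_bound[OF assms])
    show "(\<lambda>z. (z $ i)\<^sup>2) \<in> borel_measurable P" using m by measurable
    have "(z $ i)\<^sup>2 \<le> (norm z)\<^sup>2" for z :: "real^'d"
      using power_mono[OF component_le_norm_cart[of z i], of 2] by simp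
    then show "AE z in P. norm ((z $ i)\<^sup>2) \<le> norm ((norm z)\<^sup>2)" by simp
  qed
  with m show ?thesis by (simp add: l2_def)
qed

lemma alignment_loss_id:
  assumes t: "t \<ge> 0" and sq: "integrable P (\<lambda>z. (norm z)\<^sup>2)"
  shows "alignment_loss P (K t) (\<lambda>z. z)
    = ennreal (\<Sum>i\<in>UNIV. 2 * l2_inner P (\<lambda>z. z $ i) (\<lambda>z. z $ i) - 2 * l2_inner P (T t (\<lambda>z. z $ i)) (\<lambda>z. z $ i))"
proof -
  define a where "a i = 2 * l2_inner P (\<lambda>z. z $ i) (\<lambda>z. z $ i) - 2 * l2_inner P (T t (\<lambda>z. z $ i)) (\<lambda>z. z $ i)" for i
  have m: "(\<lambda>z. z $ i) \<in> borel_measurable P" for i by (rule continuous_measurable) (intro continuous_intros)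
  have mK: "(\<lambda>z'. ennreal ((z' $ i - b)\<^sup>2)) \<in> borel_measurable (K t z)" if "z \<in> M" for z i b
    using measurable_K[OF t that m[of i]] by measurable
  have mP: "(\<lambda>z. \<integral>\<^sup>+z'. ennreal ((z' $ i - z $ i)\<^sup>2) \<partial>K t z) \<in> borel_measurable P" for i
  proof (rule nn_integral_measurable_subprob_algebra2[OF _ K_subprob[OF t]])
    have 1: "(\<lambda>x. fst x $ i) \<in> borel_measurable (P \<Otimes>\<^sub>M P)" "(\<lambda>x. snd x $ i) \<in> borel_measurable (P \<Otimes>\<^sub>M P)"
      using measurable_compose[OF measurable_fst m[of i]] measurable_compose[OF measurable_snd m[of i]] by auto
    show "(\<lambda>(z, z'). ennreal ((z' $ i - z $ i)\<^sup>2)) \<in> borel_measurable (P \<Otimes>\<^sub>M P)"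
      unfolding split_beta' using 1 by measurable
  qed
  have nn: "(\<integral>\<^sup>+z. (\<integral>\<^sup>+z'. ennreal ((z' $ i - z $ i)\<^sup>2) \<partial>K t z) \<partial>P) = ennreal (a i)" for i
    unfolding a_def by (rule nn_integral_increment[OF t coord_l2[OF sq]])
  have a_nonneg: "a i \<ge> 0" for i
  proof -
    have "l2_inner P (T t (\<lambda>z. z $ i)) (\<lambda>z. z $ i) \<le> l2_norm P (T t (\<lambda>z. z $ i)) * l2_norm P (\<lambda>z. z $ i)"
      using l2_Cauchy_Schwarz[OF T_in_l2[OF t coord_l2[OF sq]] coord_l2[OF sq], of i i] by linarith
    also have "\<dots> \<le> l2_norm P (\<lambda>z. z $ i) * l2_norm P (\<lambda>z. z $ i)"
      by (intro mult_right_mono T_contraction t coord_l2 sq l2_norm_nonneg)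
    finally show ?thesis using l2_norm_square[of P "\<lambda>z. z $ i"] by (simp add: a_def power2_eq_square)
  qed
  have "(norm (z' - z))\<^sup>2 = (\<Sum>i\<in>UNIV. (z' $ i - z $ i)\<^sup>2)" for z z' :: "real^'d"
    by (simp only: power2_norm_eq_inner inner_vec_def) (simp add: power2_eq_square)
  then have "alignment_loss P (K t) (\<lambda>z. z) = (\<integral>\<^sup>+z. (\<integral>\<^sup>+z'. (\<Sum>i\<in>UNIV. ennreal ((z' $ i - z $ i)\<^sup>2)) \<partial>K t z) \<partial>P)"
    by (simp add: alignment_loss_def sum_ennreal)
  also have "\<dots> = (\<integral>\<^sup>+z. (\<Sum>i\<in>UNIV. \<integral>\<^sup>+z'. ennreal ((z' $ i - z $ i)\<^sup>2) \<partial>K t z) \<partial>P)"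
    by (rule nn_integral_cong, rule nn_integral_sum) (use mK in \<open>simp add: space_P\<close>)
  also have "\<dots> = (\<Sum>i\<in>UNIV. ennreal (a i))"
    by (subst nn_integral_sum) (use mP nn in auto)
  also have "\<dots> = ennreal (\<Sum>i\<in>UNIV. a i)" by (rule sum_ennreal) (rule a_nonneg)
  finally show ?thesis by (simp add: a_def)
qed

text \<open>Orthogonal maps preserve the lengths of increments, and \<open>AE_K\<close> transfers
  the almost everywhere identity from the starting point to the endpoint.\<close>

lemma alignment_loss_orthogonal:
  assumes t: "t \<ge> 0" and A: "orthogonal_matrix A" and h: "AE z in P. h z = A *v z"
  shows "alignment_loss P (K t) h = alignment_loss P (K t) (\<lambda>z. z)"
  unfolding alignment_loss_def
proof (rule nn_integral_cong_AE, use h AE_K[OF t h] in eventually_elim)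
  fix z assume z: "h z = A *v z" "AE z' in K t z. h z' = A *v z'"
  have iso: "norm (A *v v) = norm v" for v
    using A orthogonal_transformation_matrix[of "(*v) A"] by (simp add: orthogonal_transformation_norm)
  show "(\<integral>\<^sup>+z'. ennreal ((norm (h z' - h z))\<^sup>2) \<partial>K t z) = (\<integral>\<^sup>+z'. ennreal ((norm (z' - z))\<^sup>2) \<partial>K t z)"
    by (rule nn_integral_cong_AE, use z(2) in eventually_elim)
       (simp add: z(1) matrix_vector_mult_diff_distrib[symmetric] iso)
qed

lemma covariance_coord:
  assumes "mean_vector P = 0" "covariance_matrix P = c *\<^sub>R mat 1"
  shows "l2_inner P (\<lambda>z. z $ i) (\<lambda>z. z $ j) = (if i = j then c else 0)"
  using arg_cong[OF assms(2), of "\<lambda>A. A $ i $ j"] assms(1)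
  by (simp add: covariance_matrix_def l2_inner_def mat_def)

lemma mean_coord:
  assumes "mean_vector P = 0" "integrable P (\<lambda>z. (norm z)\<^sup>2)"
  shows "l2_inner P (\<lambda>z. z $ i) (\<lambda>_. 1) = 0"
proof -
  interpret prob_space P by (rule prob)
  have "integrable P (\<lambda>z. norm z)"
  proof (rule Bochner_Integration.integrable_bound[of _ "\<lambda>z. 1 + (norm z)\<^sup>2"])
    have "norm z \<le> 1 + (norm z)\<^sup>2" for z :: "real^'d"
      using sum_squares_bound[of "norm z" "1"] by (simp add: power2_eq_square) (smt (verit) norm_ge_zero)
    then show "AE z in P. norm (norm z) \<le> norm (1 + (norm z)\<^sup>2)" by (simp add: add_nonneg_nonneg)
  qed (use assms vec_measurable in auto)
  then have int: "integrable P (\<lambda>z. z)" using vec_measurable by (simp add: integrable_norm_iff)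
  have "(\<integral>z. z $ i \<partial>P) = (\<integral>z. z \<partial>P) $ i"
    by (rule integral_bounded_linear[OF bounded_linear_vec_nth int])
  then show ?thesis using assms(1) by (simp add: l2_inner_def mean_vector_def)
qed

text \<open>Preserving the law preserves second moments, so conjugating \<open>c\<close> times the
  identity by \<open>A\<close> returns it; positivity of \<open>c\<close> allows
  cancellation.\<close>

lemma distribution_preserving_linear_orthogonal:
  assumes h: "distribution_preserving P h" and A: "AE z in P. h z = A *v z"
    and sq: "integrable P (\<lambda>z. (norm z)\<^sup>2)" and mean: "mean_vector P = 0"
    and cov: "covariance_matrix P = c *\<^sub>R mat 1" and c: "c > 0"
  shows "orthogonal_matrix A"
proof -
  note l2 = coord_l2[OF sq]
  have hm: "h \<in> P \<rightarrow>\<^sub>M P" "distr P P h = P" using h by (auto simp: distribution_preserving_def)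
  have "(\<Sum>k\<in>UNIV. A $ i $ k * A $ j $ k) = (if i = j then 1 else 0)" for i j
  proof -
    have m: "(\<lambda>z. z $ i * z $ j) \<in> borel_measurable P" by (rule continuous_measurable) (intro continuous_intros)
    have m': "(\<lambda>z. (A *v z) $ i * (A *v z) $ j) \<in> borel_measurable P"
      by (rule continuous_measurable) (intro continuous_intros linear_continuous_on matrix_vector_mul_bounded_linear)
    have "(if i = j then c else 0) = (\<integral>z. z $ i * z $ j \<partial>distr P P h)"
      unfolding hm(2) using covariance_coord[OF mean cov] by (simp add: l2_inner_def)
    also have "\<dots> = (\<integral>z. h z $ i * h z $ j \<partial>P)" by (rule integral_distr[OF hm(1) m])
    also have "\<dots> = (\<integral>z. (A *v z) $ i * (A *v z) $ j \<partial>P)"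
      by (rule integral_cong_AE[OF measurable_compose[OF hm(1) m] m']) (use A in eventually_elim, simp)
    also have "\<dots> = (\<integral>z. (\<Sum>k\<in>UNIV. \<Sum>l\<in>UNIV. A $ i $ k * A $ j $ l * (z $ k * z $ l)) \<partial>P)"
      by (simp add: matrix_vector_mult_def sum_product ac_simps)
    also have "\<dots> = (\<Sum>k\<in>UNIV. \<Sum>l\<in>UNIV. A $ i $ k * A $ j $ l * (if k = l then c else 0))"
      using covariance_coord[OF mean cov] l2_integrable_mult[OF l2 l2] by (simp add: l2_inner_def)
    also have "\<dots> = c * (\<Sum>k\<in>UNIV. A $ i $ k * A $ j $ k)"
      by (simp add: if_distrib[of "\<lambda>x. _ * x"] sum_distrib_left ac_simps cong: if_cong)
    finally show ?thesis using c by (auto split: if_splits)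
  qed
  then have "A ** transpose A = mat 1" by (simp add: matrix_matrix_mult_def transpose_def mat_def vec_eq_iff)
  then show ?thesis unfolding orthogonal_matrix_def using matrix_left_right_inverse by blast
qed

lemma coords_eigenfunctions:
  fixes c t \<mu> :: real
  assumes sq: "integrable P (\<lambda>z. (norm z)\<^sup>2)" and mean: "mean_vector P = 0"
    and cov: "covariance_matrix P = c *\<^sub>R mat 1" and c: "c > 0" and t: "t > 0" and \<mu>: "\<mu> > 0"
    and res: "\<And>\<nu>. 0 < \<nu> \<Longrightarrow> \<nu> < \<mu> \<Longrightarrow> \<nu> \<in> resolvent_set P (neg_op G)"
    and ker: "\<And>g. (g, \<lambda>_. 0) \<in> G \<Longrightarrow> \<exists>c. AE x in P. g x = c"
    and loss: "alignment_loss P (K t) (\<lambda>z. z) = ennreal (2 * CARD('d) * c * (1 - exp (- \<mu> * t)))"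
  shows "((\<lambda>z. z $ i), (\<lambda>z. - \<mu> * z $ i)) \<in> G"
proof -
  note l2 = coord_l2[OF sq]
  define e where "e = exp (- \<mu> * t)"
  define a where "a i = l2_inner P (T t (\<lambda>z. z $ i)) (\<lambda>z. z $ i)" for i
  have norm: "l2_inner P (\<lambda>z. z $ i) (\<lambda>z. z $ i) = c" for i using covariance_coord[OF mean cov, of i i] by simp
  have e1: "e < 1" using \<mu> t by (simp add: e_def)
  have a_le: "a i \<le> e * c" for i
  proof -
    have "a i = (l2_norm P (T (t / 2) (\<lambda>z. z $ i)))\<^sup>2"
      using semigroup.T_inner_square[of "t / 2" "\<lambda>z. z $ i"] t l2 by (simp add: a_def)
    also have "\<dots> \<le> (exp (- \<mu> * (t / 2)) * l2_norm P (\<lambda>z. z $ i))\<^sup>2"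
      by (intro power_mono l2_norm_nonneg semigroup.decay[OF res ker \<mu> _ l2 mean_coord[OF mean sq]]) (use t in auto)
    also have "\<dots> = e * c"
      by (simp add: power_mult_distrib l2_norm_square norm e_def exp_double[symmetric])
    finally show ?thesis .
  qed
  have pos: "2 * CARD('d) * c * (1 - e) \<ge> 0" using c e1 by simp
  have le: "2 * c - 2 * a i \<ge> 2 * c * (1 - e)" for i using a_le[of i] by (simp add: algebra_simps)
  moreover have "2 * c * (1 - e) > 0" using c e1 by simp
  ultimately have nonneg: "2 * c - 2 * a i \<ge> 0" for i by (meson less_imp_le order_trans)
  have "ennreal (\<Sum>i\<in>UNIV. 2 * c - 2 * a i) = ennreal (2 * CARD('d) * c * (1 - e))"
    using alignment_loss_id[OF less_imp_le[OF t] sq] loss by (simp add: norm a_def e_def)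
  then have "(\<Sum>i\<in>UNIV. 2 * c - 2 * a i) = 2 * CARD('d) * c * (1 - e)"
    using pos by (subst (asm) ennreal_inj) (auto intro: sum_nonneg nonneg)
  \<comment> \<open>Each coordinate contributes at least \<open>2 * c * (1 - e)\<close> and the
    total is \<open>CARD('d)\<close> times this, so the nonnegative excesses must all
    vanish.\<close>
  then have "(\<Sum>i\<in>(UNIV :: 'd set). (2 * c - 2 * a i) - 2 * c * (1 - e)) = 0"
    by (simp add: sum_subtractf)
  then have "(2 * c - 2 * a i) - 2 * c * (1 - e) = 0"
    using le by (subst (asm) sum_nonneg_eq_0_iff) auto
  then have "a i = e * c" by (simp add: algebra_simps)
  then have ext: "l2_inner P (T t (\<lambda>z. z $ i)) (\<lambda>z. z $ i) \<ge> exp (- \<mu> * t) * (l2_norm P (\<lambda>z. z $ i))\<^sup>2"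
    by (simp add: a_def e_def l2_norm_square norm)
  show ?thesis
    by (rule semigroup.extremal_imp_eigenfunction[OF semigroup.decay[OF res ker \<mu>] t l2 mean_coord[OF mean sq] ext])
qed

end

section \<open>Functions with vanishing gradient\<close>

lemma nn_integral_lborel_shift:
  fixes f :: "'a::euclidean_space \<Rightarrow> ennreal"
  assumes "f \<in> borel_measurable borel"
  shows "(\<integral>\<^sup>+x. f (a + x) \<partial>lborel) = (\<integral>\<^sup>+x. f x \<partial>lborel)"
  by (subst (2) lborel_distr_plus[of a, symmetric], subst nn_integral_distr) (use assms in auto)

text \<open>The fundamental theorem of calculus along the segment, put as a nonnegative integral so
  that the order of integration can be exchanged freely later.\<close>

lemma increment_le_nn_integral:
  fixes f :: "'a::euclidean_space \<Rightarrow> real"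
  assumes U: "open U" and f: "smooth_on U f"
    and seg: "\<And>s. s \<in> {0..1} \<Longrightarrow> u + s *\<^sub>R h \<in> U"
    and bound: "\<And>s. s \<in> {0..1} \<Longrightarrow> \<bar>frechet_derivative f (at (u + s *\<^sub>R h)) h\<bar> \<le> b s"
  shows "ennreal \<bar>f (u + h) - f u\<bar> \<le> (\<integral>\<^sup>+s. indicator {0..1} s * ennreal (b s) \<partial>lborel)"
proof -
  define k' where "k' s = frechet_derivative f (at (u + s *\<^sub>R h)) h" for s
  have cont: "continuous_on {0..1} k'"
    unfolding k'_def
    by (rule continuous_on_compose2[OF smooth_on_imp_continuous_on[OF smooth_on_frechet_derivative[OF f, of h]]])
       (use seg in \<open>auto intro!: continuous_intros\<close>)
  have der: "((\<lambda>s. f (u + s *\<^sub>R h)) has_vector_derivative k' s) (at s within {0..1})" if s: "s \<in> {0..1}" for s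
  proof -
    have d1: "((\<lambda>s. u + s *\<^sub>R h) has_derivative (\<lambda>s. s *\<^sub>R h)) (at s within {0..1})"
      by (auto intro!: derivative_eq_intros)
    note d = smooth_on_has_derivative[OF f U seg[OF s]]
    have "((\<lambda>s. f (u + s *\<^sub>R h)) has_derivative (\<lambda>r. frechet_derivative f (at (u + s *\<^sub>R h)) (r *\<^sub>R h))) (at s within {0..1})"
      by (rule has_derivative_compose[OF d1 d])
    then show ?thesis
      unfolding has_vector_derivative_def k'_def
      using linear_cmul[OF bounded_linear.linear[OF has_derivative_bounded_linear[OF d]]] by simp
  qed
  have int: "set_integrable lborel {0..1} k'" by (rule borel_integrable_atLeastAtMost'[OF cont])
  have "(LBINT s:{0..1}. k' s) = f (u + 1 *\<^sub>R h) - f (u + 0 *\<^sub>R h)"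
    unfolding set_lebesgue_integral_def
    by (rule integral_FTC_atLeastAtMost[OF _ der cont]) auto
  then have "\<bar>f (u + h) - f u\<bar> = norm (\<integral>s. indicator {0..1} s *\<^sub>R k' s \<partial>lborel)"
    by (simp add: set_lebesgue_integral_def)
  also have "ennreal \<dots> \<le> (\<integral>\<^sup>+s. norm (indicator {0..1} s *\<^sub>R k' s) \<partial>lborel)"
    by (rule integral_norm_bound_ennreal) (use int in \<open>simp add: set_integrable_def\<close>)
  also have "\<dots> \<le> (\<integral>\<^sup>+s. indicator {0..1} s * ennreal (b s) \<partial>lborel)"
    by (intro nn_integral_mono) (use bound in \<open>auto simp: indicator_def k'_def intro!: ennreal_leI\<close>)
  finally show ?thesis .
qed

text \<open>A local Poincare inequality in the form of translations: averaging \<open>\<bar>g (u + h) - g u\<bar>\<close> over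
  \<open>u\<close> and \<open>h\<close> is controlled by the integral of the gradients, because translations preserve \<open>lborel\<close>.\<close>

lemma constant_of_vanishing_gradients:
  fixes g :: "'a::euclidean_space \<Rightarrow> real" and gn Gn :: "nat \<Rightarrow> 'a \<Rightarrow> real"
  assumes U: "open U" and B: "cball u0 (2 * r) \<subseteq> U" and r: "r > 0"
    and smooth: "\<And>n. smooth_on U (gn n)"
    and grad: "\<And>n u w. u \<in> cball u0 (2 * r) \<Longrightarrow> \<bar>frechet_derivative (gn n) (at u) w\<bar> \<le> Gn n u * norm w"
    and Gn_nonneg: "\<And>n u. Gn n u \<ge> 0"
    and Gn_meas: "\<And>n. Gn n \<in> borel_measurable borel" and g_meas: "g \<in> borel_measurable borel"
    and lim_g: "(\<lambda>n. \<integral>\<^sup>+u. indicator (cball u0 (2 * r)) u * ennreal \<bar>gn n u - g u\<bar> \<partial>lborel) \<longlonglongrightarrow> 0"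
    and lim_G: "(\<lambda>n. \<integral>\<^sup>+u. indicator (cball u0 (2 * r)) u * ennreal (Gn n u) \<partial>lborel) \<longlonglongrightarrow> 0"
  shows "\<exists>c. AE u in lborel. u \<in> ball u0 (r / 2) \<longrightarrow> g u = c"
proof -
  note [measurable] = Gn_meas g_meas
  define B where "B = cball u0 (2 * r)"
  have [measurable]: "B \<in> sets borel" by (simp add: B_def)
  \<comment> \<open>The two windows of radius \<open>r\<close> keep the whole segment from
    \<open>u\<close> to \<open>u + h\<close> inside \<open>B\<close>, whose radius is
    \<open>2 * r\<close>.\<close>
  define iD :: "'a \<Rightarrow> ennreal" where "iD = indicator (ball u0 r)"
  define iH :: "'a \<Rightarrow> ennreal" where "iH = indicator (ball 0 r)"
  have [measurable]: "iD \<in> borel_measurable borel" "iH \<in> borel_measurable borel" unfolding iD_def iH_def by (auto intro!: borel_measurable_indicator)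
  define E where "E n u = indicator B u * ennreal \<bar>gn n u - g u\<bar>" for n u
  define \<Gamma> where "\<Gamma> n u = indicator B u * ennreal (Gn n u)" for n u
  have E_meas[measurable]: "E n \<in> borel_measurable borel" for n
  proof -
    have "continuous_on B (gn n)"
      using continuous_on_subset[OF smooth_on_imp_continuous_on[OF smooth]] B by (simp add: B_def)
    then have "(\<lambda>u. indicator B u *\<^sub>R gn n u) \<in> borel_measurable borel"
      by (intro borel_measurable_continuous_on_indicator) measurable
    moreover define k where "k u = indicator B u *\<^sub>R gn n u" for u
    ultimately have [measurable]: "k \<in> borel_measurable borel" by (simp add: k_def[abs_def])
    have "E n = (\<lambda>u. indicator B u * ennreal \<bar>k u - g u\<bar>)"
      by (auto simp: E_def k_def indicator_def)
    also have "\<dots> \<in> borel_measurable borel" by measurable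
    finally show ?thesis .
  qed
  have \<Gamma>_meas[measurable]: "\<Gamma> n \<in> borel_measurable borel" for n unfolding \<Gamma>_def by measurable
  define a where "a n = (\<integral>\<^sup>+u. E n u \<partial>lborel)" for n
  define b where "b n = (\<integral>\<^sup>+u. \<Gamma> n u \<partial>lborel)" for n
  define L where "L = (\<integral>\<^sup>+h. iH h \<partial>lborel)"
  have L: "L < \<infinity>" using emeasure_bounded_finite[of "ball (0::'a) r"] by (simp add: L_def iH_def)
  \<comment> \<open>The double average of increments of the limit \<open>g\<close> does not depend
    on \<open>n\<close>, while its upper bound below tends to zero with \<open>n\<close>.\<close>
  define \<Phi> where "\<Phi> = (\<integral>\<^sup>+u. (\<integral>\<^sup>+h. iD u * iH h * ennreal \<bar>g (u + h) - g u\<bar> \<partial>lborel) \<partial>lborel)"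
  have bound: "\<Phi> \<le> L * (ennreal r * b n) + (L * a n + L * a n)" for n
  proof -
    define F1 where "F1 u h = iH h * (\<integral>\<^sup>+s. indicator {0..1} s * (ennreal r * \<Gamma> n (u + s *\<^sub>R h)) \<partial>lborel)" for u h
    have [measurable]: "(\<lambda>x. F1 (fst x) (snd x)) \<in> borel_measurable (borel \<Otimes>\<^sub>M borel)"
      unfolding F1_def by measurable
    have m1: "F1 u \<in> borel_measurable borel" for u unfolding F1_def by measurable
    have m2: "(\<lambda>u. \<integral>\<^sup>+h. F1 u h \<partial>lborel) \<in> borel_measurable borel" unfolding F1_def by measurable
    have m3: "(\<lambda>u. \<integral>\<^sup>+h. iH h * E n (u + h) \<partial>lborel) \<in> borel_measurable borel"
      "(\<lambda>u. \<integral>\<^sup>+h. iH h * E n u \<partial>lborel) \<in> borel_measurable borel" by measurable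
    have pt: "iD u * iH h * ennreal \<bar>g (u + h) - g u\<bar> \<le> F1 u h + (iH h * E n (u + h) + iH h * E n u)" for u h
    proof (cases "u \<in> ball u0 r \<and> h \<in> ball 0 r")
      case True
      have seg: "u + s *\<^sub>R h \<in> B" if "s \<in> {0..1}" for s
      proof -
        have "norm (s *\<^sub>R h) \<le> norm h" using that by (simp add: mult_left_le_one_le)
        then have "dist u0 (u + s *\<^sub>R h) < 2 * r"
          using True norm_triangle_ineq4[of "u0 - u" "s *\<^sub>R h"] by (simp add: dist_norm algebra_simps)
        then show ?thesis by (simp add: B_def)
      qed
      from seg[of 0] seg[of 1] have uB: "u \<in> B" "u + h \<in> B" by simp_all
      have "ennreal \<bar>gn n (u + h) - gn n u\<bar> \<le> (\<integral>\<^sup>+s. indicator {0..1} s * ennreal (r * Gn n (u + s *\<^sub>R h)) \<partial>lborel)"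
      proof (rule increment_le_nn_integral[OF U smooth])
        fix s :: real assume s: "s \<in> {0..1}"
        show "u + s *\<^sub>R h \<in> U" using seg[OF s] B by (auto simp: B_def)
        have "\<bar>frechet_derivative (gn n) (at (u + s *\<^sub>R h)) h\<bar> \<le> Gn n (u + s *\<^sub>R h) * norm h"
          using grad seg[OF s] by (simp add: B_def)
        also have "\<dots> \<le> Gn n (u + s *\<^sub>R h) * r" using True by (intro mult_left_mono Gn_nonneg) simp
        finally show "\<bar>frechet_derivative (gn n) (at (u + s *\<^sub>R h)) h\<bar> \<le> r * Gn n (u + s *\<^sub>R h)" by (simp add: mult.commute)
      qed
      also have "\<dots> = (\<integral>\<^sup>+s. indicator {0..1} s * (ennreal r * \<Gamma> n (u + s *\<^sub>R h)) \<partial>lborel)"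
        by (rule nn_integral_cong) (use seg r Gn_nonneg in \<open>auto simp: indicator_def \<Gamma>_def ennreal_mult\<close>)
      finally have 1: "ennreal \<bar>gn n (u + h) - gn n u\<bar> \<le> F1 u h" using True by (simp add: F1_def iH_def)
      have "\<bar>g (u + h) - g u\<bar> \<le> \<bar>gn n (u + h) - gn n u\<bar> + (\<bar>gn n (u + h) - g (u + h)\<bar> + \<bar>gn n u - g u\<bar>)" by linarith
      then have "ennreal \<bar>g (u + h) - g u\<bar> \<le> ennreal (\<bar>gn n (u + h) - gn n u\<bar> + (\<bar>gn n (u + h) - g (u + h)\<bar> + \<bar>gn n u - g u\<bar>))"
        by (rule ennreal_leI)
      also have "\<dots> = ennreal \<bar>gn n (u + h) - gn n u\<bar> + (E n (u + h) + E n u)"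
        using uB by (simp add: E_def ennreal_plus)
      also have "\<dots> \<le> F1 u h + (E n (u + h) + E n u)" by (intro add_mono 1 order_refl)
      finally show ?thesis using True by (simp add: iD_def iH_def)
    qed (auto simp: iD_def iH_def)
    have "\<Phi> \<le> (\<integral>\<^sup>+u. (\<integral>\<^sup>+h. F1 u h + (iH h * E n (u + h) + iH h * E n u) \<partial>lborel) \<partial>lborel)"
      unfolding \<Phi>_def by (intro nn_integral_mono pt)
    also have "\<dots> = (\<integral>\<^sup>+u. (\<integral>\<^sup>+h. F1 u h \<partial>lborel) \<partial>lborel)
        + ((\<integral>\<^sup>+u. (\<integral>\<^sup>+h. iH h * E n (u + h) \<partial>lborel) \<partial>lborel) + (\<integral>\<^sup>+u. (\<integral>\<^sup>+h. iH h * E n u \<partial>lborel) \<partial>lborel))"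
      using m1 m2 m3 by (simp add: nn_integral_add)
    also have "(\<integral>\<^sup>+u. (\<integral>\<^sup>+h. iH h * E n u \<partial>lborel) \<partial>lborel) = L * a n"
      by (simp add: nn_integral_multc nn_integral_cmult L_def a_def)
    also have "(\<integral>\<^sup>+u. (\<integral>\<^sup>+h. iH h * E n (u + h) \<partial>lborel) \<partial>lborel) = (\<integral>\<^sup>+h. (\<integral>\<^sup>+u. iH h * E n (u + h) \<partial>lborel) \<partial>lborel)"
      by (rule lborel_pair.Fubini'[symmetric]) (simp add: split_beta')
    also have "\<dots> = (\<integral>\<^sup>+h. iH h * a n \<partial>lborel)"
      by (simp add: nn_integral_cmult nn_integral_lborel_shift[OF E_meas] a_def add.commute[of _ "_ :: 'a"])
    also have "\<dots> = L * a n" by (simp add: nn_integral_multc L_def)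
    also have "(\<integral>\<^sup>+u. (\<integral>\<^sup>+h. F1 u h \<partial>lborel) \<partial>lborel) = (\<integral>\<^sup>+h. (\<integral>\<^sup>+u. F1 u h \<partial>lborel) \<partial>lborel)"
      by (rule lborel_pair.Fubini'[symmetric]) (simp add: split_beta')
    also have "\<dots> = (\<integral>\<^sup>+h. iH h * (ennreal r * b n) \<partial>lborel)"
    proof (rule nn_integral_cong)
      \<comment> \<open>For fixed \<open>h\<close> and \<open>s\<close> the integral of
        \<open>\<Gamma> n\<close> over \<open>u\<close> is unchanged by the translation
        \<open>s *\<^sub>R h\<close>, so every \<open>s\<close> contributes the same
        \<open>b n\<close>.\<close>
      fix h :: 'a
      have "(\<integral>\<^sup>+u. F1 u h \<partial>lborel) = iH h * (\<integral>\<^sup>+u. (\<integral>\<^sup>+s. indicator {0..1} s * (ennreal r * \<Gamma> n (u + s *\<^sub>R h)) \<partial>lborel) \<partial>lborel)"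
        unfolding F1_def by (rule nn_integral_cmult) measurable
      also have "(\<integral>\<^sup>+u. (\<integral>\<^sup>+s. indicator {0..1} s * (ennreal r * \<Gamma> n (u + s *\<^sub>R h)) \<partial>lborel) \<partial>lborel)
          = (\<integral>\<^sup>+s. (\<integral>\<^sup>+u. indicator {0..1} s * (ennreal r * \<Gamma> n (u + s *\<^sub>R h)) \<partial>lborel) \<partial>lborel)"
        by (rule lborel_pair.Fubini'[symmetric]) (simp add: split_beta')
      also have "\<dots> = (\<integral>\<^sup>+s. indicator {0..1} s * (ennreal r * b n) \<partial>(lborel :: real measure))"
        by (simp add: nn_integral_cmult nn_integral_lborel_shift[OF \<Gamma>_meas] b_def add.commute[of _ "_ *\<^sub>R h"])
      also have "\<dots> = ennreal r * b n" by (simp add: nn_integral_multc)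
      finally show "(\<integral>\<^sup>+u. F1 u h \<partial>lborel) = iH h * (ennreal r * b n)" .
    qed
    also have "\<dots> = L * (ennreal r * b n)" by (simp add: nn_integral_multc L_def)
    finally show ?thesis .
  qed
  have "(\<lambda>n. L * (ennreal r * b n) + (L * a n + L * a n)) \<longlonglongrightarrow> L * (ennreal r * 0) + (L * 0 + L * 0)"
    using lim_g lim_G L unfolding a_def b_def E_def \<Gamma>_def B_def
    by (intro tendsto_add ennreal_tendsto_cmult) (auto simp: less_top[symmetric])
  then have "(\<lambda>n. L * (ennreal r * b n) + (L * a n + L * a n)) \<longlonglongrightarrow> 0" by simp
  then have "\<Phi> \<le> 0" by (rule LIMSEQ_le_const) (use bound in blast)
  then have "\<Phi> = 0" by simp
  then have "AE u in lborel. (\<integral>\<^sup>+h. iD u * iH h * ennreal \<bar>g (u + h) - g u\<bar> \<partial>lborel) = 0"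
    unfolding \<Phi>_def by (subst (asm) nn_integral_0_iff_AE) auto
  \<comment> \<open>The ball of radius \<open>r / 2\<close> is not null, so it contains a base point
    \<open>u1\<close> with vanishing inner integral. Every \<open>v\<close> in the ball lies within
    \<open>r\<close> of \<open>u1\<close> and is therefore seen by the window
    \<open>iH\<close>.\<close>
  moreover have "\<not> (AE u in lborel. u \<notin> ball u0 (r / 2))"
  proof
    assume "AE u in lborel. u \<notin> ball u0 (r / 2)"
    then have "emeasure lborel {u \<in> space lborel. \<not> u \<notin> ball u0 (r / 2)} = 0"
      by (subst (asm) AE_iff_measurable) auto
    moreover have "{u \<in> space lborel. \<not> u \<notin> ball u0 (r / 2)} = ball u0 (r / 2)"
      unfolding space_lborel space_borel by blast
    ultimately have "measure lborel (ball u0 (r / 2)) = 0" by (simp only: measure_def) simp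
    then show False using content_ball_pos[of "r / 2" u0] r by simp
  qed
  ultimately have "\<exists>u1. u1 \<in> ball u0 (r / 2) \<and> (\<integral>\<^sup>+h. iD u1 * iH h * ennreal \<bar>g (u1 + h) - g u1\<bar> \<partial>lborel) = 0"
    by (metis (mono_tags, lifting) AE_mp AE_I2)
  then obtain u1 where u1: "u1 \<in> ball u0 (r / 2)" "(\<integral>\<^sup>+h. iD u1 * iH h * ennreal \<bar>g (u1 + h) - g u1\<bar> \<partial>lborel) = 0"
    by blast
  have iD1: "iD u1 = 1" using u1(1) r by (simp add: iD_def)
  have "(\<integral>\<^sup>+v. iH (v - u1) * ennreal \<bar>g v - g u1\<bar> \<partial>lborel) = (\<integral>\<^sup>+h. iH ((u1 + h) - u1) * ennreal \<bar>g (u1 + h) - g u1\<bar> \<partial>lborel)"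
    by (rule nn_integral_lborel_shift[symmetric]) measurable
  also have "\<dots> = 0" using u1(2) by (simp add: iD1)
  finally have "AE v in lborel. iH (v - u1) * ennreal \<bar>g v - g u1\<bar> = 0"
    by (subst (asm) nn_integral_0_iff_AE) auto
  then have "AE v in lborel. v \<in> ball u0 (r / 2) \<longrightarrow> g v = g u1"
  proof eventually_elim
    case (elim v)
    show ?case
    proof
      assume v: "v \<in> ball u0 (r / 2)"
      have "norm (v - u1) < r"
        using v u1(1) dist_triangle2[of v u1 u0] by (simp add: dist_norm norm_minus_commute)
      then show "g v = g u1" using elim by (simp add: iH_def)
    qed
  qed
  then show ?thesis by blast
qed

section \<open>The kernel of the generator and regularity of smooth eigenfunctions\<close>

context langevin
begin

section \<open>Comparison of the law with Lebesgue measure in charts\<close>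

lemma sets_MM: "A \<in> sets P \<longleftrightarrow> A \<in> sets borel \<and> A \<subseteq> M"
  using M_closed by (auto simp: sets_P sets_restrict_space_iff)

lemma measurable_to_P: "measurable N P = measurable N MM"
  by (rule measurable_cong_sets[OF refl sets_P])

lemma chart_measurable:
  assumes c: "chart M (U :: (real^'m) set) \<psi>" and B: "B \<in> sets borel" "B \<subseteq> U"
  shows "\<psi> \<in> restrict_space lborel B \<rightarrow>\<^sub>M P"
proof -
  interpret chart M U \<psi> by (rule c)
  have cont: "continuous_on B \<psi>" by (rule continuous_on_subset[OF smooth_on_imp_continuous_on[OF smooth_psi] B(2)])
  have "sets (restrict_space lborel B) = sets (restrict_space borel B)"
    by (rule sets_restrict_space_cong) simp
  from measurable_cong_sets[OF this refl] have "\<psi> \<in> borel_measurable (restrict_space lborel B)"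
    using borel_measurable_continuous_on_restrict[OF cont] by blast
  then show ?thesis
    unfolding measurable_to_P
    by (rule measurable_restrict_space2[rotated]) (use B psi_in_M in \<open>auto simp: space_restrict_space\<close>)
qed

lemma p_meas: "p \<in> borel_measurable V"
  using continuous_measurable[OF continuous_smooth_function[OF p_smooth]]
  by (simp add: measurable_P measurable_cong_sets[OF sets_V refl])

lemma volume_chart:
  assumes "chart M (U :: (real^'m) set) \<psi>" "A \<in> sets V" "A \<subseteq> \<psi> ` U"
  shows "emeasure V A = (\<integral>\<^sup>+u\<in>{u\<in>U. \<psi> u \<in> A}. ennreal (sqrt (det (gram_matrix \<psi> u))) \<partial>lborel)"
  by (rule conjunct2[OF vol[unfolded riemannian_volume_def], rule_format])
     (use assms in \<open>auto simp: chart_def\<close>)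

text \<open>On a compact piece of a chart the volume factor and the density attain positive minima
  \<open>s0\<close> and \<open>p0\<close>, so Lebesgue measure there is at most
  \<open>1 / (p0 * s0)\<close> times the law. Convergence under \<open>P\<close> thereby becomes
  convergence in the chart.\<close>

lemma chart_measure_bound:
  assumes c: "chart M (U :: (real^'m) set) \<psi>" and B: "compact B" "B \<subseteq> U"
  obtains \<kappa> :: real where "\<kappa> > 0"
    "\<And>F. F \<in> borel_measurable P \<Longrightarrow> (\<integral>\<^sup>+u. indicator B u * F (\<psi> u) \<partial>lborel) \<le> ennreal \<kappa> * (\<integral>\<^sup>+x. F x \<partial>P)"
proof (cases "B = {}")
  case True
  then show ?thesis using that[of 1] by simp
next
  case False
  interpret chart M U \<psi> by (rule c)
  have Bb: "B \<in> sets borel" using B(1) by (simp add: borel_compact)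
  define w where "w u = sqrt (det (gram_matrix \<psi> u))" for u
  have "continuous_on B w"
    unfolding w_def
    by (intro continuous_intros continuous_on_subset[OF smooth_on_imp_continuous_on[OF smooth_on_det[OF open_U smooth_gram]] B(2)])
  from continuous_attains_inf[OF B(1) False this] obtain u1 where u1: "u1 \<in> B" "\<And>u. u \<in> B \<Longrightarrow> w u1 \<le> w u" by blast
  have "continuous_on B (\<lambda>u. p (\<psi> u))"
    by (rule continuous_on_subset[OF smooth_on_imp_continuous_on[OF smooth_function_chart[OF p_smooth]] B(2)])
  from continuous_attains_inf[OF B(1) False this] obtain u2 where u2: "u2 \<in> B" "\<And>u. u \<in> B \<Longrightarrow> p (\<psi> u2) \<le> p (\<psi> u)" by blast
  define s0 p0 where "s0 = w u1" and "p0 = p (\<psi> u2)"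
  have pos: "s0 > 0" "p0 > 0"
    using det_gram_pos[of u1] u1(1) u2(1) B(2) psi_in_M p_pos by (auto simp: s0_def p0_def w_def)
  define N where "N = restrict_space lborel B"
  have meas: "\<psi> \<in> N \<rightarrow>\<^sub>M P" unfolding N_def by (rule chart_measurable[OF c Bb B(2)])
  define \<kappa> where "\<kappa> = 1 / (p0 * s0)"
  have img: "\<psi> ` B \<in> sets borel"
    by (intro borel_compact compact_continuous_image B(1) continuous_on_subset[OF smooth_on_imp_continuous_on[OF smooth_psi] B(2)])
  have key: "ennreal (p0 * s0) * emeasure lborel (\<psi> -` A \<inter> B) \<le> emeasure P A" if A: "A \<in> sets P" for A
  proof -
    define S where "S = A \<inter> \<psi> ` B"
    have S: "S \<in> sets P" "S \<subseteq> \<psi> ` U" using A img B(2) psi_in_M by (auto simp: S_def sets_MM)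
    have SV: "S \<in> sets V" using S(1) by (simp add: sets_P sets_V)
    have Y: "\<psi> -` A \<inter> B \<in> sets lborel"
      using measurable_sets[OF meas A] Bb by (simp add: N_def space_restrict_space sets_restrict_space_iff)
    have "ennreal s0 * emeasure lborel (\<psi> -` A \<inter> B) = (\<integral>\<^sup>+u. ennreal s0 * indicator (\<psi> -` A \<inter> B) u \<partial>lborel)"
      using Y by (simp add: nn_integral_cmult_indicator)
    also have "\<dots> \<le> (\<integral>\<^sup>+u\<in>{u\<in>U. \<psi> u \<in> S}. ennreal (sqrt (det (gram_matrix \<psi> u))) \<partial>lborel)"
      by (intro nn_integral_mono) (use u1(2) B(2) in \<open>auto simp: indicator_def S_def s0_def w_def intro!: ennreal_leI\<close>)
    also have "\<dots> = emeasure V S"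
      by (rule volume_chart[OF c SV S(2), symmetric])
    finally have 1: "ennreal s0 * emeasure lborel (\<psi> -` A \<inter> B) \<le> emeasure V S" .
    have "ennreal (p0 * s0) * emeasure lborel (\<psi> -` A \<inter> B) = ennreal p0 * (ennreal s0 * emeasure lborel (\<psi> -` A \<inter> B))"
      using pos by (simp add: ennreal_mult mult.assoc)
    also have "\<dots> \<le> ennreal p0 * emeasure V S" by (rule mult_left_mono[OF 1]) simp
    also have "\<dots> = (\<integral>\<^sup>+x. ennreal p0 * indicator S x \<partial>V)" using SV by (simp add: nn_integral_cmult_indicator)
    also have "\<dots> \<le> (\<integral>\<^sup>+x. ennreal (p x) * indicator A x \<partial>V)"
      by (intro nn_integral_mono) (use u2(2) in \<open>auto simp: indicator_def S_def p0_def intro!: ennreal_leI\<close>)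
    also have "\<dots> = emeasure P A"
      unfolding law_def using A p_meas by (subst emeasure_density) (auto simp: sets_P sets_V)
    finally show ?thesis .
  qed
  \<comment> \<open>\<open>riemannian_volume\<close> prescribes masses of sets; an inequality of
    measures carries the estimate over to integrals.\<close>
  have "distr N P \<psi> \<le> scale_measure (ennreal \<kappa>) P"
  proof (subst le_measure)
    show "\<forall>A\<in>sets (distr N P \<psi>). emeasure (distr N P \<psi>) A \<le> emeasure (scale_measure (ennreal \<kappa>) P) A"
    proof
      fix A assume "A \<in> sets (distr N P \<psi>)"
      then have A: "A \<in> sets P" by simp
      have "emeasure (distr N P \<psi>) A = emeasure lborel (\<psi> -` A \<inter> B)"
        using A meas Bb by (simp add: emeasure_distr N_def space_restrict_space emeasure_restrict_space)
      also have "\<dots> = ennreal \<kappa> * (ennreal (p0 * s0) * emeasure lborel (\<psi> -` A \<inter> B))"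
        using pos by (simp add: \<kappa>_def mult.assoc[symmetric] ennreal_mult[symmetric])
      also have "\<dots> \<le> ennreal \<kappa> * emeasure P A" by (rule mult_left_mono[OF key[OF A]]) simp
      finally show "emeasure (distr N P \<psi>) A \<le> emeasure (scale_measure (ennreal \<kappa>) P) A" by simp
    qed
  qed simp
  then have mono: "nn_integral (distr N P \<psi>) F \<le> nn_integral (scale_measure (ennreal \<kappa>) P) F" for F
    by (rule nn_integral_mono_measure[rotated]) simp
  show ?thesis
  proof (rule that[of \<kappa>])
    show "\<kappa> > 0" using pos by (simp add: \<kappa>_def)
    fix F :: "real^'d \<Rightarrow> ennreal" assume F: "F \<in> borel_measurable P"
    have "(\<integral>\<^sup>+u. indicator B u * F (\<psi> u) \<partial>lborel) = (\<integral>\<^sup>+u. F (\<psi> u) \<partial>N)"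
      unfolding N_def using Bb by (subst nn_integral_restrict_space) (auto simp: mult.commute)
    also have "\<dots> = nn_integral (distr N P \<psi>) F" using meas F by (subst nn_integral_distr) simp_all
    also have "\<dots> \<le> ennreal \<kappa> * (\<integral>\<^sup>+x. F x \<partial>P)" using mono[of F] by (simp add: nn_integral_scale_measure[OF F])
    finally show "(\<integral>\<^sup>+u. indicator B u * F (\<psi> u) \<partial>lborel) \<le> ennreal \<kappa> * (\<integral>\<^sup>+x. F x \<partial>P)" .
  qed
qed

text \<open>The transfer opposite to \<open>chart_measure_bound\<close>: the volume formula
  integrates over a Lebesgue null set, and the density adds no mass.\<close>

lemma chart_null:
  assumes c: "chart M (U :: (real^'m) set) \<psi>" and A: "A \<in> sets P" "A \<subseteq> \<psi> ` U"
    and null: "AE u in lborel. u \<in> U \<longrightarrow> \<psi> u \<notin> A"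
  shows "A \<in> null_sets P"
proof -
  interpret chart M U \<psi> by (rule c)
  have AV: "A \<in> sets V" using A(1) by (simp add: sets_P sets_V)
  have "emeasure V A = (\<integral>\<^sup>+u\<in>{u\<in>U. \<psi> u \<in> A}. ennreal (sqrt (det (gram_matrix \<psi> u))) \<partial>lborel)"
    by (rule volume_chart[OF c AV A(2)])
  also have "\<dots> = (\<integral>\<^sup>+u. 0 \<partial>(lborel :: (real^'m) measure))"
    by (rule nn_integral_cong_AE, use null in eventually_elim) auto
  finally have "A \<in> null_sets V" using AV by (auto simp: null_sets_def)
  then have "A \<in> null_sets (density V (\<lambda>z. ennreal (p z)))"
    using null_sets_density_iff[of "\<lambda>z. ennreal (p z)" V A] p_meas AE_not_in[of A V] AV by auto
  then show ?thesis by (simp add: law_def)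
qed

lemma openin_sets_P: "openin (top_of_set M) W \<Longrightarrow> W \<in> sets P"
  using M_closed by (auto simp: sets_MM openin_open)

text \<open>A closed ball in a chart is mapped into \<open>W\<close>, and its positive Lebesgue
  measure is dominated by the mass of \<open>W\<close>. This serves to compare local constants and
  to pass from almost everywhere to pointwise identities.\<close>

lemma open_positive:
  assumes W: "openin (top_of_set M) W" "W \<noteq> {}"
  shows "\<not> (AE x in P. x \<notin> W)"
proof
  assume null: "AE x in P. x \<notin> W"
  obtain W' where W': "open W'" "W = M \<inter> W'" using W(1) by (auto simp: openin_open)
  obtain x where x: "x \<in> W" using W(2) by blast
  then have "x \<in> M" using W' by simp
  from chart_at[OF emb this] obtain U :: "(real^'m) set" and \<psi> u where c: "chart M U \<psi>" "u \<in> U" "x = \<psi> u" .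
  interpret chart M U \<psi> by (rule c(1))
  have "open (U \<inter> \<psi> -` W')" "u \<in> U \<inter> \<psi> -` W'" using open_vimage[OF W'(1)] c x W' by auto
  then obtain r where r: "r > 0" "cball u r \<subseteq> U \<inter> \<psi> -` W'" by (meson open_contains_cball)
  have sub: "cball u r \<subseteq> U" using r(2) by blast
  obtain \<kappa> where "\<kappa> > 0" and k: "\<And>F. F \<in> borel_measurable P \<Longrightarrow> (\<integral>\<^sup>+u'. indicator (cball u r) u' * F (\<psi> u') \<partial>lborel) \<le> ennreal \<kappa> * (\<integral>\<^sup>+x. F x \<partial>P)"
    using chart_measure_bound[OF c(1) compact_cball sub] by blast
  have WP: "W \<in> sets P" by (rule openin_sets_P[OF W(1)])
  have "emeasure lborel (cball u r) = (\<integral>\<^sup>+u'. indicator (cball u r) u' * indicator W (\<psi> u') \<partial>lborel)"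
  proof -
    have "emeasure lborel (cball u r) = (\<integral>\<^sup>+u'. indicator (cball u r) u' \<partial>lborel)" by simp
    also have "\<dots> = (\<integral>\<^sup>+u'. indicator (cball u r) u' * indicator W (\<psi> u') \<partial>lborel)"
    proof (rule nn_integral_cong)
      fix u'
      show "(indicator (cball u r) u' :: ennreal) = indicator (cball u r) u' * indicator W (\<psi> u')"
        using r(2) W'(2) psi_in_M by (cases "u' \<in> cball u r") (auto simp: subset_iff)
    qed
    finally show ?thesis .
  qed
  also have "\<dots> \<le> ennreal \<kappa> * (\<integral>\<^sup>+x. indicator W x \<partial>P)"
    by (rule k) (use WP in \<open>rule borel_measurable_indicator\<close>)
  also have "(\<integral>\<^sup>+x. indicator W x \<partial>P) = (\<integral>\<^sup>+x. 0 \<partial>P)"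
    by (rule nn_integral_cong_AE, use null in eventually_elim) simp
  finally have "measure lborel (cball u r) = 0" by (simp add: measure_def)
  moreover have "measure lborel (cball u r) > 0" using content_cball_pos[OF r(1)] by simp
  ultimately show False by simp
qed

section \<open>Test functions, their energy, and the kernel of the generator\<close>

lemma bounded_l2:
  assumes cont: "continuous_on M g" and C: "compact C" "C \<subseteq> M" "\<And>x. x \<in> M - C \<Longrightarrow> g x = 0"
  shows "g \<in> l2 P"
proof -
  interpret prob_space P by (rule prob)
  have "compact (g ` C)" by (intro compact_continuous_image continuous_on_subset[OF cont C(2)] C(1))
  then obtain b where b: "\<And>x. x \<in> C \<Longrightarrow> norm (g x) \<le> b" using compact_imp_bounded bounded_iff by (metis imageI)
  have bound: "norm (g x) \<le> \<bar>b\<bar>" if "x \<in> M" for x using b[of x] C(3)[of x] that by (cases "x \<in> C") auto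
  have m: "g \<in> borel_measurable P" by (rule continuous_measurable[OF cont])
  have "integrable P (\<lambda>x. (g x)\<^sup>2)"
  proof (rule integrable_const_bound[of _ "\<bar>b\<bar>\<^sup>2"])
    show "AE x in P. norm ((g x)\<^sup>2) \<le> \<bar>b\<bar>\<^sup>2"
    proof (rule AE_I2)
      fix x assume "x \<in> space P"
      then have "\<bar>g x\<bar> \<le> \<bar>b\<bar>" using bound by (simp add: space_P)
      then show "norm ((g x)\<^sup>2) \<le> \<bar>b\<bar>\<^sup>2" by (simp add: abs_le_square_iff)
    qed
  qed (use m in measurable)
  with m show ?thesis by (simp add: l2_def)
qed

text \<open>The complement of the support is relatively open, so locality makes the weighted
  Laplacian vanish there too.\<close>

lemma test_function_support:
  assumes "test_function M \<phi>"
  shows "\<exists>C. compact C \<and> C \<subseteq> M \<and> (\<forall>x\<in>M - C. \<phi> x = 0 \<and> weighted_laplacian M p \<phi> x = 0)"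
proof -
  from assms obtain C where C: "smooth_function M \<phi>" "compact C" "C \<subseteq> M" "\<forall>x\<in>M - C. \<phi> x = 0"
    unfolding test_function_def by blast
  have "weighted_laplacian M p \<phi> x = 0" if x: "x \<in> M - C" for x
  proof -
    have "weighted_laplacian M p \<phi> x = weighted_laplacian M p (\<lambda>_. 0) x"
      by (rule weighted_laplacian_local[OF C(1) smooth_function_ambient[OF smooth_on_const], of "- C"])
         (use x C(2,4) compact_imp_closed in auto)
    then show ?thesis using weighted_laplacian_const x by simp
  qed
  with C show ?thesis by blast
qed

lemma test_l2:
  assumes "test_function M \<phi>"
  shows "\<phi> \<in> l2 P" "weighted_laplacian M p \<phi> \<in> l2 P"
proof -
  obtain C where C: "compact C" "C \<subseteq> M" "\<forall>x\<in>M - C. \<phi> x = 0 \<and> weighted_laplacian M p \<phi> x = 0"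
    using test_function_support[OF assms] by blast
  have sm: "smooth_function M \<phi>" using assms by (simp add: test_function_def)
  show "\<phi> \<in> l2 P"
    by (rule bounded_l2[OF continuous_smooth_function[OF sm] C(1,2)]) (use C(3) in blast)
  show "weighted_laplacian M p \<phi> \<in> l2 P"
    by (rule bounded_l2[OF continuous_weighted_laplacian[OF sm] C(1,2)]) (use C(3) in blast)
qed

lemma test_generator:
  assumes "test_function M \<phi>"
  shows "(\<phi>, weighted_laplacian M p \<phi>) \<in> G"
proof -
  have "(\<lambda>n::nat. l2_norm P (\<lambda>x. g x - g x)) \<longlonglongrightarrow> 0" for g by (simp add: l2_norm_def l2_inner_def)
  then show ?thesis
    unfolding weighted_laplacian_op_def l2_closure_def
    using test_l2[OF assms] assms
    by (intro CollectI case_prodI conjI exI[of _ "\<lambda>_. \<phi>"] exI[of _ "\<lambda>_. weighted_laplacian M p \<phi>"]) auto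
qed

lemma test_square:
  assumes "test_function M \<phi>"
  shows "test_function M (\<lambda>x. \<phi> x * \<phi> x)"
  using assms smooth_function_mult[of M \<phi> \<phi>] unfolding test_function_def by auto

text \<open>Integrating \<open>D\<^sub>p(\<phi>\<^sup>2) = 2 \<phi> D\<^sub>p\<phi> + 2 \<bar>grad \<phi>\<bar>\<^sup>2\<close>, whose left side has mean zero by symmetry of
  the generator, which annihilates constants.\<close>

lemma test_energy:
  assumes \<phi>: "test_function M \<phi>"
  shows "(\<integral>\<^sup>+x. ennreal (norm (grad_on M \<phi> x)) \<partial>P) \<le> ennreal (sqrt (- l2_inner P (weighted_laplacian M p \<phi>) \<phi>))"
proof -
  have sm: "smooth_function M \<phi>" using \<phi> by (simp add: test_function_def)
  note l = test_l2[OF \<phi>] and l2 = test_l2[OF test_square[OF \<phi>]]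
  have one: "(\<lambda>_. 1) \<in> l2 P" by (rule semigroup.const_l2)
  have mean: "l2_inner P (weighted_laplacian M p (\<lambda>x. \<phi> x * \<phi> x)) (\<lambda>_. 1) = 0"
    using semigroup.generator_symmetric[OF test_generator[OF test_square[OF \<phi>]] semigroup.generator_one]
    by (simp add: l2_inner_def)
  define n where "n x = norm (grad_on M \<phi> x)" for x
  have n_meas: "n \<in> borel_measurable P"
    unfolding n_def by (intro continuous_measurable continuous_on_norm continuous_grad_on sm)
  have sq: "(n x)\<^sup>2 = (1 / 2) * weighted_laplacian M p (\<lambda>x. \<phi> x * \<phi> x) x - \<phi> x * weighted_laplacian M p \<phi> x"
    if "x \<in> M" for x
    using weighted_laplacian_square[OF sm that] by (simp add: n_def field_simps)
  have int1: "integrable P (weighted_laplacian M p (\<lambda>x. \<phi> x * \<phi> x))"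
    using l2_integrable_mult[OF l2(2) one] by simp
  have int2: "integrable P (\<lambda>x. \<phi> x * weighted_laplacian M p \<phi> x)" by (rule l2_integrable_mult[OF l])
  have int: "integrable P (\<lambda>x. (1 / 2) * weighted_laplacian M p (\<lambda>x. \<phi> x * \<phi> x) x - \<phi> x * weighted_laplacian M p \<phi> x)"
    using int1 int2 by simp
  have "integrable P (\<lambda>x. (n x)\<^sup>2)"
    by (rule Bochner_Integration.integrable_cong[THEN iffD1, OF refl _ int]) (simp add: sq space_P)
  then have n_l2: "n \<in> l2 P" using n_meas by (simp add: l2_def)
  have "(\<integral>x. (n x)\<^sup>2 \<partial>P) = (\<integral>x. (1 / 2) * weighted_laplacian M p (\<lambda>x. \<phi> x * \<phi> x) x - \<phi> x * weighted_laplacian M p \<phi> x \<partial>P)"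
    by (rule Bochner_Integration.integral_cong[OF refl]) (simp add: sq space_P)
  also have "\<dots> = - l2_inner P (weighted_laplacian M p \<phi>) \<phi>"
    using int1 int2 mean by (simp add: l2_inner_def mult.commute)
  finally have nn: "(l2_norm P n)\<^sup>2 = - l2_inner P (weighted_laplacian M p \<phi>) \<phi>"
    unfolding l2_norm_square by (simp add: l2_inner_def power2_eq_square)
  have "(\<integral>\<^sup>+x. ennreal (n x) \<partial>P) = ennreal (l2_inner P n (\<lambda>_. 1))"
    using l2_integrable_mult[OF n_l2 one] by (simp add: l2_inner_def nn_integral_eq_integral n_def)
  also have "\<dots> \<le> ennreal (l2_norm P n * l2_norm P (\<lambda>_. 1))"
    using l2_Cauchy_Schwarz[OF n_l2 one] by (intro ennreal_leI) simp
  also have "l2_norm P (\<lambda>_. 1) = 1" using prob_space.prob_space[OF prob] by (simp add: l2_norm_def l2_inner_def)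
  also have "l2_norm P n * 1 = sqrt (- l2_inner P (weighted_laplacian M p \<phi>) \<phi>)"
    unfolding nn[symmetric] by (simp add: l2_norm_nonneg)
  finally show ?thesis by (simp add: n_def)
qed

text \<open>Test functions \<open>\<phi> n\<close> approximate \<open>f\<close> while their images
  tend to zero, so by \<open>test_energy\<close> their gradients vanish in mean. In a chart this is
  the situation of \<open>constant_of_vanishing_gradients\<close>.\<close>

lemma kernel_locally_constant:
  assumes f: "(f, \<lambda>_. 0) \<in> G" and x: "x \<in> M"
  shows "\<exists>W c. openin (top_of_set M) W \<and> x \<in> W \<and> (AE y in P. y \<in> W \<longrightarrow> f y = c)"
proof -
  from f obtain \<phi> v where fl: "f \<in> l2 P"
    and uv: "\<And>n::nat. (\<phi> n, v n) \<in> {(\<phi>, weighted_laplacian M p \<phi>) | \<phi>. test_function M \<phi>}"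
    and lim: "(\<lambda>n. l2_norm P (\<lambda>x. \<phi> n x - f x)) \<longlonglongrightarrow> 0" "(\<lambda>n. l2_norm P (\<lambda>x. v n x - 0)) \<longlonglongrightarrow> 0"
    unfolding weighted_laplacian_op_def l2_closure_def by blast
  have test: "test_function M (\<phi> n)" and v: "v n = weighted_laplacian M p (\<phi> n)" for n using uv[of n] by auto
  note \<phi>l = test_l2[OF test]
  have sm: "smooth_function M (\<phi> n)" for n using test[of n] by (simp add: test_function_def)
  have energy: "(\<lambda>n. \<integral>\<^sup>+x. ennreal (norm (grad_on M (\<phi> n) x)) \<partial>P) \<longlonglongrightarrow> 0"
  proof (rule tendsto_sandwich[OF always_eventually always_eventually])
    show "\<forall>n. 0 \<le> (\<integral>\<^sup>+x. ennreal (norm (grad_on M (\<phi> n) x)) \<partial>P)" by simp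
    show "\<forall>n. (\<integral>\<^sup>+x. ennreal (norm (grad_on M (\<phi> n) x)) \<partial>P) \<le> ennreal (sqrt (- l2_inner P (v n) (\<phi> n)))"
      using test_energy[OF test] by (simp add: v)
    have "(\<lambda>n. l2_norm P (v n) * (l2_norm P (\<lambda>x. \<phi> n x - f x) + l2_norm P f)) \<longlonglongrightarrow> 0 * (0 + l2_norm P f)"
      using lim by (intro tendsto_mult tendsto_add tendsto_const) simp_all
    then have b: "(\<lambda>n. l2_norm P (v n) * (l2_norm P (\<lambda>x. \<phi> n x - f x) + l2_norm P f)) \<longlonglongrightarrow> 0" by simp
    have "(\<lambda>n. l2_inner P (v n) (\<phi> n)) \<longlonglongrightarrow> 0"
    proof (rule Lim_null_comparison[OF always_eventually b], intro allI)
      fix n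
      have "norm (l2_inner P (v n) (\<phi> n)) \<le> l2_norm P (v n) * l2_norm P (\<phi> n)"
        using l2_Cauchy_Schwarz[OF \<phi>l(2)[of n] \<phi>l(1)[of n]] by (simp add: v)
      also have "\<dots> \<le> l2_norm P (v n) * (l2_norm P (\<lambda>x. \<phi> n x - f x) + l2_norm P f)"
        by (intro mult_left_mono l2_norm_le_diff \<phi>l fl l2_norm_nonneg)
      finally show "norm (l2_inner P (v n) (\<phi> n)) \<le> l2_norm P (v n) * (l2_norm P (\<lambda>x. \<phi> n x - f x) + l2_norm P f)" .
    qed
    then have "(\<lambda>n. ennreal (sqrt (- l2_inner P (v n) (\<phi> n)))) \<longlonglongrightarrow> ennreal (sqrt (- 0))" by (intro tendsto_intros)
    then show "(\<lambda>n. ennreal (sqrt (- l2_inner P (v n) (\<phi> n)))) \<longlonglongrightarrow> 0" by simp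
  qed simp
  from chart_at[OF emb x] obtain U :: "(real^'m) set" and \<psi> u0 where c: "chart M U \<psi>" "u0 \<in> U" "x = \<psi> u0" .
  interpret chart M U \<psi> by (rule c(1))
  obtain r' where r': "r' > 0" "cball u0 r' \<subseteq> U" using open_U c(2) open_contains_cball by blast
  define r where "r = r' / 2"
  define B where "B = cball u0 (2 * r)"
  have r: "r > 0" and BU: "B \<subseteq> U" using r' by (auto simp: r_def B_def)
  have Bc: "compact B" and Bb: "B \<in> sets borel" by (simp_all add: B_def)
  obtain \<kappa> where \<kappa>: "\<kappa> > 0" "\<And>F. F \<in> borel_measurable P \<Longrightarrow> (\<integral>\<^sup>+u. indicator B u * F (\<psi> u) \<partial>lborel) \<le> ennreal \<kappa> * (\<integral>\<^sup>+x. F x \<partial>P)"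
    using chart_measure_bound[OF c(1) Bc BU] by blast
  \<comment> \<open>\<open>j u\<close> dominates the operator norm of the Jacobian and so converts
    gradients on \<open>M\<close> into derivatives in the chart.\<close>
  define j where "j u = (\<Sum>k\<in>UNIV. norm (J u (axis k 1)))" for u
  have j_cont: "continuous_on B j"
    unfolding j_def
    by (intro continuous_on_sum continuous_on_norm
        continuous_on_subset[OF smooth_on_imp_continuous_on[OF smooth_on_frechet_derivative[OF smooth_psi]] BU])
  have J_le: "norm (J u w) \<le> j u * norm w" if "u \<in> U" for u w
  proof -
    have "norm (J u w) \<le> (\<Sum>k\<in>UNIV. norm ((w $ k) *\<^sub>R J u (axis k 1)))"
      by (subst J_expand[OF that]) (rule norm_sum)
    also have "\<dots> \<le> (\<Sum>k\<in>UNIV. norm (J u (axis k 1)) * norm w)"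
      by (rule sum_mono) (simp add: mult.commute[of "norm (J u _)"] mult_right_mono component_le_norm_cart)
    finally show ?thesis by (simp add: j_def sum_distrib_right)
  qed
  obtain jm where jm: "jm \<ge> 0" "\<And>u. u \<in> B \<Longrightarrow> j u \<le> jm"
  proof -
    have "compact (j ` B)" by (rule compact_continuous_image[OF j_cont Bc])
    then obtain b where "\<forall>y\<in>j ` B. norm y \<le> b" using compact_imp_bounded bounded_iff by metis
    then show ?thesis using that[of "\<bar>b\<bar>"] by force
  qed
  have j_nonneg: "j u \<ge> 0" for u by (simp add: j_def sum_nonneg)
  \<comment> \<open>Only on \<open>B\<close> is \<open>f \<circ> \<psi>\<close> known to be
    measurable; extension by zero gives a Borel function on the whole space.\<close>
  define g where "g u = indicator B u *\<^sub>R f (\<psi> u)" for u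
  define gn where "gn n u = \<phi> n (\<psi> u)" for n u
  define Gn where "Gn n u = indicator B u *\<^sub>R (norm (grad_on M (\<phi> n) (\<psi> u)) * j u)" for n u
  have gn_smooth: "smooth_on U (gn n)" for n unfolding gn_def[abs_def] by (rule smooth_function_chart[OF sm])
  have gm: "(\<lambda>x. ennreal \<bar>\<phi> n x - f x\<bar>) \<in> borel_measurable P" for n
    using l2_measurable[OF \<phi>l(1)[of n]] l2_measurable[OF fl] by measurable
  have gradm: "(\<lambda>x. ennreal (norm (grad_on M (\<phi> n) x))) \<in> borel_measurable P" for n
  proof -
    have "(\<lambda>x. norm (grad_on M (\<phi> n) x)) \<in> borel_measurable P"
      by (intro continuous_measurable continuous_on_norm continuous_grad_on sm)
    then show ?thesis by measurable
  qed
  have "\<exists>c. AE u in lborel. u \<in> ball u0 (r / 2) \<longrightarrow> g u = c"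
  proof (rule constant_of_vanishing_gradients[OF open_U _ r gn_smooth])
    show "cball u0 (2 * r) \<subseteq> U" using BU by (simp add: B_def)
    show "Gn n u \<ge> 0" for n u by (simp add: Gn_def j_nonneg)
    show "\<bar>frechet_derivative (gn n) (at u) w\<bar> \<le> Gn n u * norm w" if u: "u \<in> cball u0 (2 * r)" for n u w
    proof -
      have uB: "u \<in> B" "u \<in> U" using u BU by (auto simp: B_def)
      have "frechet_derivative (gn n) (at u) w = grad_on M (\<phi> n) (\<psi> u) \<bullet> J u w"
        using grad_on_eq[OF uB(2), of "\<phi> n"] cgrad_inner_J[OF uB(2) gn_smooth] gn_smooth by (simp add: gn_def[abs_def])
      also have "\<bar>\<dots>\<bar> \<le> norm (grad_on M (\<phi> n) (\<psi> u)) * norm (J u w)" by (rule Cauchy_Schwarz_ineq2)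
      also have "\<dots> \<le> norm (grad_on M (\<phi> n) (\<psi> u)) * (j u * norm w)" by (intro mult_left_mono J_le uB) simp
      finally show ?thesis using uB by (simp add: Gn_def mult.assoc)
    qed
    show "Gn n \<in> borel_measurable borel" for n
    proof -
      have "continuous_on U (\<lambda>u. grad_on M (\<phi> n) (\<psi> u))"
        by (rule continuous_on_compose2[OF continuous_grad_on[OF sm] smooth_on_imp_continuous_on[OF smooth_psi] image_subset])
      then have "continuous_on B (\<lambda>u. norm (grad_on M (\<phi> n) (\<psi> u)) * j u)"
        by (intro continuous_intros continuous_on_subset[OF _ BU] j_cont)
      then show ?thesis unfolding Gn_def by (rule borel_measurable_continuous_on_indicator[OF Bb])
    qed
    show "g \<in> borel_measurable borel"
    proof -
      have "(\<lambda>u. f (\<psi> u)) \<in> borel_measurable (restrict_space lborel B)"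
        by (rule measurable_compose[OF chart_measurable[OF c(1) Bb BU] l2_measurable[OF fl]])
      then have "(\<lambda>u. indicator B u *\<^sub>R f (\<psi> u)) \<in> borel_measurable lborel"
        by (subst (asm) borel_measurable_restrict_space_iff) (use Bb in auto)
      then show ?thesis by (simp add: g_def[abs_def])
    qed
    show "(\<lambda>n. \<integral>\<^sup>+u. indicator (cball u0 (2 * r)) u * ennreal \<bar>gn n u - g u\<bar> \<partial>lborel) \<longlonglongrightarrow> 0"
    proof (rule tendsto_sandwich[OF always_eventually always_eventually tendsto_const])
      show "\<forall>n. 0 \<le> (\<integral>\<^sup>+u. indicator (cball u0 (2 * r)) u * ennreal \<bar>gn n u - g u\<bar> \<partial>lborel)" by simp
      show "\<forall>n. (\<integral>\<^sup>+u. indicator (cball u0 (2 * r)) u * ennreal \<bar>gn n u - g u\<bar> \<partial>lborel)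
          \<le> ennreal (\<kappa> * l2_norm P (\<lambda>x. \<phi> n x - f x))"
      proof
        fix n
        have one: "(\<lambda>_. 1) \<in> l2 P" by (rule semigroup.const_l2)
        have d: "(\<lambda>x. \<phi> n x - f x) \<in> l2 P" by (rule l2_diff[OF \<phi>l(1) fl])
        then have ad: "(\<lambda>x. \<bar>\<phi> n x - f x\<bar>) \<in> l2 P" unfolding l2_def by (auto intro: borel_measurable_abs)
        have "(\<integral>\<^sup>+u. indicator (cball u0 (2 * r)) u * ennreal \<bar>gn n u - g u\<bar> \<partial>lborel)
            = (\<integral>\<^sup>+u. indicator B u * ennreal \<bar>\<phi> n (\<psi> u) - f (\<psi> u)\<bar> \<partial>lborel)"
          unfolding B_def[symmetric] by (rule nn_integral_cong) (simp add: g_def gn_def indicator_def)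
        also have "\<dots> \<le> ennreal \<kappa> * (\<integral>\<^sup>+x. ennreal \<bar>\<phi> n x - f x\<bar> \<partial>P)" by (rule \<kappa>(2)[OF gm])
        also have "(\<integral>\<^sup>+x. ennreal \<bar>\<phi> n x - f x\<bar> \<partial>P) = ennreal (l2_inner P (\<lambda>x. \<bar>\<phi> n x - f x\<bar>) (\<lambda>_. 1))"
          using l2_integrable_mult[OF ad one] by (simp add: l2_inner_def nn_integral_eq_integral)
        also have "\<dots> \<le> ennreal (l2_norm P (\<lambda>x. \<bar>\<phi> n x - f x\<bar>) * l2_norm P (\<lambda>_. 1))"
          using l2_Cauchy_Schwarz[OF ad one] by (intro ennreal_leI) simp
        also have "l2_norm P (\<lambda>_. 1) = 1" using prob_space.prob_space[OF prob] by (simp add: l2_norm_def l2_inner_def)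
        also have "l2_norm P (\<lambda>x. \<bar>\<phi> n x - f x\<bar>) = l2_norm P (\<lambda>x. \<phi> n x - f x)" by (simp add: l2_norm_def l2_inner_def)
        finally show "(\<integral>\<^sup>+u. indicator (cball u0 (2 * r)) u * ennreal \<bar>gn n u - g u\<bar> \<partial>lborel)
            \<le> ennreal (\<kappa> * l2_norm P (\<lambda>x. \<phi> n x - f x))"
          using \<kappa>(1) by (simp add: mult_left_mono ennreal_mult' l2_norm_nonneg)
      qed
      have "(\<lambda>n. ennreal (\<kappa> * l2_norm P (\<lambda>x. \<phi> n x - f x))) \<longlonglongrightarrow> ennreal (\<kappa> * 0)"
        by (intro tendsto_intros lim)
      then show "(\<lambda>n. ennreal (\<kappa> * l2_norm P (\<lambda>x. \<phi> n x - f x))) \<longlonglongrightarrow> 0" by simp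
    qed
    show "(\<lambda>n. \<integral>\<^sup>+u. indicator (cball u0 (2 * r)) u * ennreal (Gn n u) \<partial>lborel) \<longlonglongrightarrow> 0"
    proof (rule tendsto_sandwich[OF always_eventually always_eventually tendsto_const])
      show "\<forall>n. 0 \<le> (\<integral>\<^sup>+u. indicator (cball u0 (2 * r)) u * ennreal (Gn n u) \<partial>lborel)" by simp
      show "\<forall>n. (\<integral>\<^sup>+u. indicator (cball u0 (2 * r)) u * ennreal (Gn n u) \<partial>lborel)
          \<le> ennreal \<kappa> * (ennreal jm * (\<integral>\<^sup>+x. ennreal (norm (grad_on M (\<phi> n) x)) \<partial>P))"
      proof
        fix n
        have "(\<integral>\<^sup>+u. indicator (cball u0 (2 * r)) u * ennreal (Gn n u) \<partial>lborel)
            \<le> (\<integral>\<^sup>+u. indicator B u * (ennreal jm * ennreal (norm (grad_on M (\<phi> n) (\<psi> u)))) \<partial>lborel)"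
          unfolding B_def[symmetric]
        proof (rule nn_integral_mono)
          fix u
          show "indicator B u * ennreal (Gn n u) \<le> indicator B u * (ennreal jm * ennreal (norm (grad_on M (\<phi> n) (\<psi> u))))"
          proof (cases "u \<in> B")
            case True
            have "norm (grad_on M (\<phi> n) (\<psi> u)) * j u \<le> jm * norm (grad_on M (\<phi> n) (\<psi> u))"
              by (subst mult.commute) (intro mult_right_mono jm True norm_ge_zero)
            then show ?thesis using True jm(1) by (simp add: Gn_def ennreal_mult'[symmetric] ennreal_leI)
          qed simp
        qed
        also have "\<dots> \<le> ennreal \<kappa> * (\<integral>\<^sup>+x. ennreal jm * ennreal (norm (grad_on M (\<phi> n) x)) \<partial>P)"
          by (rule \<kappa>(2)) (use gradm in measurable)
        also have "(\<integral>\<^sup>+x. ennreal jm * ennreal (norm (grad_on M (\<phi> n) x)) \<partial>P) = ennreal jm * (\<integral>\<^sup>+x. ennreal (norm (grad_on M (\<phi> n) x)) \<partial>P)"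
          by (rule nn_integral_cmult[OF gradm])
        finally show "(\<integral>\<^sup>+u. indicator (cball u0 (2 * r)) u * ennreal (Gn n u) \<partial>lborel)
          \<le> ennreal \<kappa> * (ennreal jm * (\<integral>\<^sup>+x. ennreal (norm (grad_on M (\<phi> n) x)) \<partial>P))" .
      qed
      have "(\<lambda>n. ennreal \<kappa> * (ennreal jm * (\<integral>\<^sup>+x. ennreal (norm (grad_on M (\<phi> n) x)) \<partial>P))) \<longlonglongrightarrow> ennreal \<kappa> * (ennreal jm * 0)"
        by (intro ennreal_tendsto_cmult energy) auto
      then show "(\<lambda>n. ennreal \<kappa> * (ennreal jm * (\<integral>\<^sup>+x. ennreal (norm (grad_on M (\<phi> n) x)) \<partial>P))) \<longlonglongrightarrow> 0" by simp
    qed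
  qed
  then obtain a where a: "AE u in lborel. u \<in> ball u0 (r / 2) \<longrightarrow> g u = a" by blast
  have ballU: "ball u0 (r / 2) \<subseteq> B" using r by (auto simp: B_def)
  define W where "W = \<psi> ` ball u0 (r / 2)"
  obtain \<phi>' where hom: "homeomorphism U (\<psi> ` U) \<psi> \<phi>'" using lp by (auto simp: local_param_def)
  have "openin (top_of_set U) (ball u0 (r / 2))" using ballU BU open_U by (simp add: openin_open_eq)
  from homeomorphism_imp_open_map[OF hom this] have "openin (top_of_set (\<psi> ` U)) W" by (simp add: W_def)
  then have W: "openin (top_of_set M) W" using openin_trans openin_image by blast
  \<comment> \<open>The exceptional points of \<open>W\<close>. Injectivity of \<open>\<psi>\<close>
    brings their parameters back to the small ball, where \<open>g\<close> equals \<open>a\<close>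
    off a Lebesgue null set.\<close>
  define A where "A = {y \<in> space P. y \<in> W \<and> f y \<noteq> a}"
  have "A \<in> sets P"
  proof -
    have [measurable]: "f \<in> borel_measurable P" "W \<in> sets P" using l2_measurable[OF fl] openin_sets_P[OF W] by auto
    show ?thesis unfolding A_def by measurable
  qed
  moreover have "A \<subseteq> \<psi> ` U" using ballU BU by (auto simp: A_def W_def)
  moreover have "AE u in lborel. u \<in> U \<longrightarrow> \<psi> u \<notin> A"
    using a
  proof eventually_elim
    case (elim u)
    show ?case
    proof (intro impI notI)
      assume u: "u \<in> U" "\<psi> u \<in> A"
      then obtain u' where u': "u' \<in> ball u0 (r / 2)" "\<psi> u = \<psi> u'" by (auto simp: A_def W_def)
      have "u' \<in> U" using u' ballU BU by blast
      then have "u = u'" using hom u u' unfolding homeomorphism_def by metis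
      then have "f (\<psi> u) = a" using elim u' ballU by (auto simp: g_def)
      then show False using u(2) by (simp add: A_def)
    qed
  qed
  ultimately have "A \<in> null_sets P" by (rule chart_null[OF c(1)])
  then have "AE y in P. y \<in> W \<longrightarrow> f y = a" by (rule AE_I') (auto simp: A_def)
  moreover have "x \<in> W" using c(3) r by (simp add: W_def)
  ultimately show ?thesis using W by blast
qed

text \<open>Two local constants at one point agree, because their neighbourhoods meet in an open set
  of positive mass. So the local constant \<open>k\<close> is a function of the point, and it is
  locally constant by construction.\<close>

lemma kernel_constant:
  assumes f: "(f, \<lambda>_. 0) \<in> G" and conn: "connected M"
  shows "\<exists>c. AE x in P. f x = c"
proof -
  define Q where "Q x W c \<longleftrightarrow> openin (top_of_set M) W \<and> x \<in> W \<and> (AE y in P. y \<in> W \<longrightarrow> f y = c)" for x W c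
  have ex: "\<exists>c W. Q x W c" if "x \<in> M" for x unfolding Q_def using kernel_locally_constant[OF f that] by blast
  define k where "k x = (SOME c. \<exists>W. Q x W c)" for x
  have k: "\<exists>W. Q x W (k x)" if "x \<in> M" for x unfolding k_def by (rule someI_ex[OF ex[OF that]])
  have unique: "c = c'" if "Q x W c" "Q x W' c'" for x W W' c c'
  proof (rule ccontr)
    assume ne: "c \<noteq> c'"
    have "openin (top_of_set M) (W \<inter> W')" "W \<inter> W' \<noteq> {}" using that by (auto simp: Q_def)
    moreover have "AE y in P. y \<notin> W \<inter> W'"
    proof -
      have "AE y in P. y \<in> W \<longrightarrow> f y = c" "AE y in P. y \<in> W' \<longrightarrow> f y = c'" using that by (auto simp: Q_def)
      then show ?thesis by eventually_elim (use ne in auto)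
    qed
    ultimately show False using open_positive by blast
  qed
  have "k constant_on M"
  proof (rule locally_constant_imp_constant[OF conn])
    fix x assume x: "x \<in> M"
    then obtain W where W: "Q x W (k x)" using k by blast
    have const: "k y = k x" if y: "y \<in> W" for y
    proof -
      have "Q y W (k x)" using W y by (simp add: Q_def)
      moreover have "y \<in> M" using W y openin_imp_subset unfolding Q_def by blast
      ultimately show ?thesis using k unique by blast
    qed
    show "\<exists>T. openin (top_of_set M) T \<and> x \<in> T \<and> (\<forall>y\<in>T. k y = k x)"
      using W unfolding Q_def by (intro exI[of _ W] conjI ballI const) simp_all
  qed
  then obtain c where c: "\<And>x. x \<in> M \<Longrightarrow> k x = c" by (auto simp: constant_on_def)
  define \<W> where "\<W> = {W. openin (top_of_set M) W \<and> (AE y in P. y \<in> W \<longrightarrow> f y = c)}"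
  have cover: "M \<subseteq> \<Union>\<W>" using k c unfolding \<W>_def Q_def by blast
  \<comment> \<open>The cover may be uncountable; the exceptional null sets can be combined only
    over a countable subcover.\<close>
  obtain \<W>' where W': "\<W>' \<subseteq> \<W>" "countable \<W>'" "\<Union>\<W>' = \<Union>\<W>"
    using Lindelof_openin[of \<W> M] by (auto simp: \<W>_def)
  have "AE y in P. \<forall>W\<in>\<W>'. y \<in> W \<longrightarrow> f y = c"
    using W' by (subst AE_ball_countable) (auto simp: \<W>_def)
  then have "AE y in P. f y = c" using AE_space
  proof eventually_elim
    case (elim y)
    then show ?case using cover W'(3) by (auto simp: space_P)
  qed
  then show ?thesis by blast
qed

text \<open>Compact support comes from closedness of \<open>M\<close>: its intersection with a
  closed ball is compact.\<close>

lemma test_function_cutoff: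
  assumes f: "smooth_function M f" and cutoff: "smooth_on UNIV cutoff" "\<And>x. norm (x - a) \<ge> R \<Longrightarrow> cutoff x = 0"
  shows "test_function M (\<lambda>x. cutoff x * f x)"
  unfolding test_function_def
proof (intro conjI exI[of _ "M \<inter> cball a R"] ballI)
  show "smooth_function M (\<lambda>x. cutoff x * f x)"
    by (rule smooth_function_mult[OF smooth_function_ambient[OF cutoff(1)] f])
  show "compact (M \<inter> cball a R)" using M_closed by (simp add: closed_Int_compact)
  show "cutoff x * f x = 0" if "x \<in> M - M \<inter> cball a R" for x
    using that cutoff(2)[of x] by (auto simp: dist_norm norm_minus_commute)
qed auto

text \<open>Testing with cutoffs: symmetry of the generator serves as integration by parts.\<close>

lemma weak_eigenfunction_pointwise:
  assumes f: "smooth_function M f" and eig: "(f, \<lambda>x. - \<mu> * f x) \<in> G" and x0: "x0 \<in> M"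
  shows "weighted_laplacian M p f x0 = - \<mu> * f x0"
proof (rule ccontr)
  assume ne: "\<not> ?thesis"
  define q where "q x = weighted_laplacian M p f x + \<mu> * f x" for x
  have q_cont: "continuous_on M q"
    unfolding q_def by (intro continuous_intros continuous_weighted_laplacian continuous_smooth_function f)
  have q0: "q x0 \<noteq> 0" using ne by (simp add: q_def)
  have "\<exists>\<rho>>0. \<forall>x\<in>M. dist x x0 < \<rho> \<longrightarrow> dist (q x) (q x0) < \<bar>q x0\<bar>"
    using q_cont x0 q0 unfolding continuous_on_iff by (meson zero_less_abs_iff)
  then obtain \<rho> where \<rho>: "\<rho> > 0" "\<And>x. x \<in> M \<Longrightarrow> dist x x0 < \<rho> \<Longrightarrow> dist (q x) (q x0) < \<bar>q x0\<bar>" by blast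
  have q_pos: "q x * sgn (q x0) > 0" if "x \<in> M" "dist x x0 < \<rho>" for x
    using \<rho>(2)[OF that] by (auto simp: dist_real_def sgn_if abs_if split: if_splits)
  \<comment> \<open>A bump positive exactly on the ball of radius \<open>\<rho>\<close>, where
    \<open>q\<close> keeps the sign of \<open>q x0\<close>.\<close>
  define \<eta> where "\<eta> x = bump (\<rho>\<^sup>2 + (-1) * ((x + - x0) \<bullet> (x + - x0)))" for x
  have \<eta>_smooth: "smooth_on UNIV \<eta>"
    unfolding \<eta>_def[abs_def]
    by (rule smooth_on_bump[OF open_UNIV smooth_on_add[OF open_UNIV smooth_on_const smooth_on_mult[OF open_UNIV smooth_on_const
        smooth_on_inner[OF open_UNIV smooth_on_add[OF open_UNIV smooth_on_id[OF open_UNIV] smooth_on_const]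
          smooth_on_add[OF open_UNIV smooth_on_id[OF open_UNIV] smooth_on_const]]]]])
  have \<eta>_0: "\<eta> x = 0" if "norm (x - x0) \<ge> \<rho>" for x
  proof -
    have "\<rho>\<^sup>2 \<le> (norm (x - x0))\<^sup>2" using that \<rho>(1) by (intro power_mono) auto
    then show ?thesis by (simp add: \<eta>_def bump_eq_0 power2_norm_eq_inner)
  qed
  have \<eta>_pos: "\<eta> x > 0" if "norm (x - x0) < \<rho>" for x
  proof -
    have "(norm (x - x0))\<^sup>2 < \<rho>\<^sup>2" using that by (intro power_strict_mono) auto
    then show ?thesis by (simp add: \<eta>_def bump_pos_iff power2_norm_eq_inner)
  qed
  have \<eta>_nonneg: "\<eta> x \<ge> 0" for x by (simp add: \<eta>_def bump_nonneg)
  have test: "test_function M \<eta>"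
    using test_function_cutoff[OF smooth_function_ambient[OF smooth_on_const, of M 1] \<eta>_smooth \<eta>_0] by simp
  obtain C where C: "compact C" "C \<subseteq> M" "\<forall>x\<in>M - C. \<eta> x = 0 \<and> weighted_laplacian M p \<eta> x = 0"
    using test_function_support[OF test] by blast
  obtain R where R: "R > 0" "\<And>x. x \<in> C \<Longrightarrow> norm x < R"
    using compact_imp_bounded[OF C(1)] unfolding bounded_pos_less by blast
  obtain cutoff :: "real^'d \<Rightarrow> real" where cutoff: "smooth_on UNIV cutoff" "\<And>x. norm x \<le> R \<Longrightarrow> cutoff x = 1" "\<And>x. norm x \<ge> 2 * R \<Longrightarrow> cutoff x = 0"
    using smooth_cutoff[OF R(1)] by blast
  define \<zeta> where "\<zeta> x = cutoff x * f x" for x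
  have test_\<zeta>: "test_function M \<zeta>"
    unfolding \<zeta>_def by (rule test_function_cutoff[where a=0 and R="2 * R", OF f cutoff(1)]) (use cutoff(3) in simp)
  have \<zeta>_smooth: "smooth_function M \<zeta>" using test_\<zeta> by (simp add: test_function_def)
  have wl: "weighted_laplacian M p \<zeta> x = weighted_laplacian M p f x" if x: "x \<in> C" for x
    by (rule weighted_laplacian_local[OF \<zeta>_smooth f, of "ball 0 R"])
       (use x C(2) R(2) cutoff(2) in \<open>auto simp: \<zeta>_def\<close>)
  note l = test_l2[OF test] test_l2[OF test_\<zeta>] and fl = semigroup.generator_l2(1)[OF eig]
  have "l2_inner P f (weighted_laplacian M p \<eta>) = l2_inner P (\<lambda>x. - \<mu> * f x) \<eta>"
    by (rule semigroup.generator_symmetric[OF eig test_generator[OF test]])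
  moreover have "l2_inner P f (weighted_laplacian M p \<eta>) = l2_inner P \<zeta> (weighted_laplacian M p \<eta>)"
    unfolding l2_inner_def
  proof (rule Bochner_Integration.integral_cong[OF refl])
    fix x assume "x \<in> space P"
    then show "f x * weighted_laplacian M p \<eta> x = \<zeta> x * weighted_laplacian M p \<eta> x"
      using C(3) R(2)[of x] cutoff(2)[of x] by (cases "x \<in> C") (auto simp: \<zeta>_def space_P)
  qed
  moreover have "l2_inner P \<zeta> (weighted_laplacian M p \<eta>) = l2_inner P (weighted_laplacian M p \<zeta>) \<eta>"
    by (rule semigroup.generator_symmetric[OF test_generator[OF test_\<zeta>] test_generator[OF test]])
  ultimately have eq: "l2_inner P (weighted_laplacian M p \<zeta>) \<eta> - l2_inner P (\<lambda>x. - \<mu> * f x) \<eta> = 0" by simp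
  have d: "(\<lambda>x. weighted_laplacian M p \<zeta> x - - \<mu> * f x) \<in> l2 P" by (rule l2_diff[OF l(4) l2_cmult[OF fl]])
  have prod: "(weighted_laplacian M p \<zeta> x - - \<mu> * f x) * \<eta> x = q x * \<eta> x" if "x \<in> M" for x
    using wl[of x] C(3) that by (cases "x \<in> C") (auto simp: q_def)
  have "(\<integral>x. (weighted_laplacian M p \<zeta> x - - \<mu> * f x) * \<eta> x \<partial>P) = 0"
    using eq l2_inner_diff_left[OF l(4) l2_cmult[OF fl, of "- \<mu>"] l(1)] by (simp add: l2_inner_def)
  then have int0: "(\<integral>x. sgn (q x0) * ((weighted_laplacian M p \<zeta> x - - \<mu> * f x) * \<eta> x) \<partial>P) = 0" by simp
  have int: "integrable P (\<lambda>x. sgn (q x0) * ((weighted_laplacian M p \<zeta> x - - \<mu> * f x) * \<eta> x))"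
    using l2_integrable_mult[OF d l(1)] by (rule integrable_mult_right)
  have nonneg: "sgn (q x0) * (q x * \<eta> x) \<ge> 0" if "x \<in> M" for x
  proof (cases "dist x x0 < \<rho>")
    case True
    have "0 \<le> (q x * sgn (q x0)) * \<eta> x" using q_pos[OF that True] \<eta>_nonneg by simp
    then show ?thesis by (simp add: ac_simps)
  qed (use \<eta>_0 in \<open>simp add: dist_norm\<close>)
  \<comment> \<open>The integrand has one sign and integral zero, yet it is strictly positive on the
    ball around \<open>x0\<close>, a set of positive mass.\<close>
  have "AE x in P. sgn (q x0) * ((weighted_laplacian M p \<zeta> x - - \<mu> * f x) * \<eta> x) = 0"
  proof (subst integral_nonneg_eq_0_iff_AE[OF int, symmetric])
    show "AE x in P. 0 \<le> sgn (q x0) * ((weighted_laplacian M p \<zeta> x - - \<mu> * f x) * \<eta> x)"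
      by (rule AE_I2, subst prod) (use nonneg in \<open>simp_all add: space_P\<close>)
  qed (rule int0)
  then have "AE x in P. x \<notin> M \<inter> ball x0 \<rho>"
    using AE_space
  proof eventually_elim
    case (elim x)
    show ?case
    proof
      assume x: "x \<in> M \<inter> ball x0 \<rho>"
      then have "dist x x0 < \<rho>" by (simp add: dist_commute)
      then have "(q x * sgn (q x0)) * \<eta> x > 0" using q_pos[of x] \<eta>_pos[of x] x by (simp add: dist_norm)
      moreover have "sgn (q x0) * (q x * \<eta> x) = 0" using elim(1) prod[of x] x by (simp only: IntD1)
      ultimately show False by auto
    qed
  qed
  moreover have "openin (top_of_set M) (M \<inter> ball x0 \<rho>)" by (rule openin_open_Int) simp
  moreover have "M \<inter> ball x0 \<rho> \<noteq> {}" using x0 \<rho>(1) centre_in_ball by blast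
  ultimately show False using open_positive by blast
qed

end

section \<open>The main theorem\<close>

text \<open>Linear algebra modulo null sets: independence gives the transpose of the matrix
  \<open>C\<close> that expresses \<open>e\<close> through the basis a trivial kernel. Hence
  \<open>C\<close> is invertible and its inverse expresses the basis through
  \<open>e\<close>.\<close>

lemma ae_span_eqI:
  fixes e :: "'i::finite \<Rightarrow> 'a \<Rightarrow> real"
  assumes dim: "has_ae_dim P S CARD('i)" and e: "\<And>i. e i \<in> S"
    and indep: "\<And>a. (AE x in P. (\<Sum>i\<in>UNIV. a i * e i x) = 0) \<Longrightarrow> \<forall>i. a i = 0"
  shows "S = ae_span P UNIV e"
proof -
  from dim obtain b :: "nat \<Rightarrow> 'a \<Rightarrow> real" where b: "\<And>j. j < CARD('i) \<Longrightarrow> b j \<in> l2 P"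
    and S: "S = ae_span P {..<CARD('i)} b"
    unfolding has_ae_dim_def by blast
  \<comment> \<open>\<open>has_ae_dim\<close> numbers a basis by naturals; the bijection moves the
    indices to \<open>'i\<close>, so that both families are related by a square matrix.\<close>
  obtain \<beta> :: "'i \<Rightarrow> nat" where \<beta>: "bij_betw \<beta> UNIV {..<CARD('i)}"
    using finite_same_card_bij[of "UNIV :: 'i set" "{..<CARD('i)}"] by auto
  define B where "B j = b (\<beta> j)" for j
  have reindex: "(\<Sum>j<CARD('i). a j * b j x) = (\<Sum>j\<in>UNIV. a (\<beta> j) * B j x)" for a x
    using sum.reindex_bij_betw[OF \<beta>, of "\<lambda>j. a j * b j x"] by (simp add: B_def)
  have B_l2: "B j \<in> l2 P" for j using \<beta> b by (auto simp: B_def bij_betw_def)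
  have S_iff: "f \<in> S \<longleftrightarrow> f \<in> l2 P \<and> (\<exists>a. AE x in P. f x = (\<Sum>j\<in>UNIV. a j * B j x))" for f
  proof
    assume "f \<in> S"
    then obtain a where "f \<in> l2 P" "AE x in P. f x = (\<Sum>j<CARD('i). a j * b j x)" by (auto simp: S ae_span_def)
    then show "f \<in> l2 P \<and> (\<exists>a. AE x in P. f x = (\<Sum>j\<in>UNIV. a j * B j x))"
      unfolding reindex by (intro conjI exI[of _ "\<lambda>j. a (\<beta> j)"]) auto
  next
    assume "f \<in> l2 P \<and> (\<exists>a. AE x in P. f x = (\<Sum>j\<in>UNIV. a j * B j x))"
    then obtain a where a: "f \<in> l2 P" "AE x in P. f x = (\<Sum>j\<in>UNIV. a j * B j x)" by blast
    have "inj \<beta>" using \<beta> by (simp add: bij_betw_def)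
    then have "(\<Sum>j<CARD('i). a (inv \<beta> j) * b j x) = (\<Sum>j\<in>UNIV. a j * B j x)" for x
      unfolding reindex[of "\<lambda>j. a (inv \<beta> j)"] by simp
    then show "f \<in> S" using a by (auto simp: S ae_span_def intro!: exI[of _ "\<lambda>j. a (inv \<beta> j)"])
  qed
  have "\<exists>a. AE x in P. e i x = (\<Sum>j\<in>UNIV. a j * B j x)" for i using e[of i] S_iff by blast
  then obtain c where c: "\<And>i. AE x in P. e i x = (\<Sum>j\<in>UNIV. c i j * B j x)" by metis
  define C :: "real^'i^'i" where "C = (\<chi> i j. c i j)"
  have all: "AE x in P. \<forall>i. e i x = (\<Sum>j\<in>UNIV. C $ i $ j * B j x)"
    using c by (subst AE_all_countable) (simp add: C_def)
  have "v = 0" if v: "transpose C *v v = 0" for v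
  proof -
    have "AE x in P. (\<Sum>i\<in>UNIV. v $ i * e i x) = 0"
      using all
    proof eventually_elim
      case (elim x)
      have "(\<Sum>i\<in>UNIV. v $ i * e i x) = (\<Sum>i\<in>UNIV. \<Sum>j\<in>UNIV. v $ i * (C $ i $ j * B j x))"
        by (simp add: elim sum_distrib_left)
      also have "\<dots> = (\<Sum>j\<in>UNIV. (transpose C *v v) $ j * B j x)"
        by (subst sum.swap) (simp add: matrix_vector_mult_def transpose_def sum_distrib_right sum_distrib_left ac_simps)
      also have "\<dots> = 0" unfolding v by simp
      finally show ?case .
    qed
    then have "\<forall>i. v $ i = 0" by (rule indep)
    then show ?thesis by (simp add: vec_eq_iff)
  qed
  then have "\<exists>D'. D' ** transpose C = mat 1" using matrix_left_invertible_ker by blast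
  then obtain D' where "D' ** transpose C = mat 1" by blast
  then have "transpose (D' ** transpose C) = transpose (mat 1)" by simp
  then have "C ** transpose D' = mat 1" by (simp add: matrix_transpose_mul transpose_mat)
  then have "transpose D' ** C = mat 1" by (simp add: matrix_left_right_inverse)
  then obtain D where D: "D ** C = mat 1" by blast
  have B_eq: "AE x in P. \<forall>k. B k x = (\<Sum>i\<in>UNIV. D $ k $ i * e i x)"
    using all
  proof eventually_elim
    case (elim x)
    show ?case
    proof
      fix k
      have "(\<Sum>i\<in>UNIV. D $ k $ i * e i x) = (\<Sum>i\<in>UNIV. \<Sum>j\<in>UNIV. D $ k $ i * (C $ i $ j * B j x))"
        by (simp add: elim sum_distrib_left)
      also have "\<dots> = (\<Sum>j\<in>UNIV. (D ** C) $ k $ j * B j x)"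
        by (subst sum.swap) (simp add: matrix_matrix_mult_def sum_distrib_right mult.assoc)
      also have "\<dots> = (\<Sum>j\<in>UNIV. if j = k then B j x else 0)"
        unfolding D by (rule sum.cong) (auto simp: mat_def)
      finally show "B k x = (\<Sum>i\<in>UNIV. D $ k $ i * e i x)" by simp
    qed
  qed
  show ?thesis
  proof (intro equalityI subsetI)
    fix f assume "f \<in> S"
    then obtain a where a: "f \<in> l2 P" "AE x in P. f x = (\<Sum>j\<in>UNIV. a j * B j x)" using S_iff by blast
    have "AE x in P. f x = (\<Sum>i\<in>UNIV. (\<Sum>j\<in>UNIV. a j * D $ j $ i) * e i x)"
      using a(2) B_eq
    proof eventually_elim
      case (elim x)
      have "f x = (\<Sum>j\<in>UNIV. \<Sum>i\<in>UNIV. a j * (D $ j $ i * e i x))"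
        using elim by (simp add: sum_distrib_left)
      also have "\<dots> = (\<Sum>i\<in>UNIV. (\<Sum>j\<in>UNIV. a j * D $ j $ i) * e i x)"
        by (subst sum.swap) (simp add: sum_distrib_right mult.assoc)
      finally show ?case .
    qed
    then show "f \<in> ae_span P UNIV e" using a(1) unfolding ae_span_def by (intro CollectI conjI exI)
  next
    fix f assume "f \<in> ae_span P UNIV e"
    then obtain a where a: "f \<in> l2 P" "AE x in P. f x = (\<Sum>i\<in>UNIV. a i * e i x)" by (auto simp: ae_span_def)
    have "AE x in P. f x = (\<Sum>j\<in>UNIV. (\<Sum>i\<in>UNIV. a i * C $ i $ j) * B j x)"
      using a(2) all
    proof eventually_elim
      case (elim x)
      have "f x = (\<Sum>i\<in>UNIV. \<Sum>j\<in>UNIV. a i * (C $ i $ j * B j x))"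
        using elim by (simp add: sum_distrib_left)
      also have "\<dots> = (\<Sum>j\<in>UNIV. (\<Sum>i\<in>UNIV. a i * C $ i $ j) * B j x)"
        by (subst sum.swap) (simp add: sum_distrib_right mult.assoc)
      finally show ?case .
    qed
    then have "\<exists>a. AE x in P. f x = (\<Sum>j\<in>UNIV. a j * B j x)"
      by (intro exI[of _ "\<lambda>j. \<Sum>i\<in>UNIV. a i * C $ i $ j"])
    then show "f \<in> S" using a(1) S_iff by blast
  qed
qed

theorem theorem4p2:
  fixes M :: "(real^'d) set" and V :: "(real^'d) measure" and p :: "real^'d \<Rightarrow> real"
    and K :: "real \<Rightarrow> real^'d \<Rightarrow> (real^'d) measure" and c t \<mu>\<^sub>1 :: real
  assumes "properly_embedded_submanifold TYPE('m::finite) M"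
    and "connected M"
    and "riemannian_volume TYPE('m) M V"
    and "smooth_function M p"
    and "\<forall>z\<in>M. p z > 0"
    and "prob_space (law V p)"
    and "langevin_kernels M V p K"
    and "\<forall>s\<ge>0. law V p \<bind> K s = law V p"
    and "integrable (law V p) (\<lambda>z. (norm z)\<^sup>2)"
    and "mean_vector (law V p) = 0"
    and "covariance_matrix (law V p) = c *\<^sub>R mat 1"
    and "c > 0"
    and "self_adjoint (law V p) (neg_op (weighted_laplacian_op M V p))"
    and "discrete_spectrum (law V p) (neg_op (weighted_laplacian_op M V p))"
    and "t > 0"
    and "smallest_nonzero_eigenvalue (law V p) (neg_op (weighted_laplacian_op M V p)) \<mu>\<^sub>1"
    and "\<mu>\<^sub>1 > 0"
    and "has_ae_dim (law V p) (eigenspace (neg_op (weighted_laplacian_op M V p)) \<mu>\<^sub>1) CARD('d)"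
    and "\<exists>h. distribution_preserving (law V p) h \<and>
           alignment_loss (law V p) (K t) h = ennreal (2 * CARD('d) * c * (1 - exp (- \<mu>\<^sub>1 * t)))"
    and "\<forall>h. distribution_preserving (law V p) h \<longrightarrow>
           ennreal (2 * CARD('d) * c * (1 - exp (- \<mu>\<^sub>1 * t))) \<le> alignment_loss (law V p) (K t) h"
    and "\<forall>h. is_arg_min (alignment_loss (law V p) (K t)) (distribution_preserving (law V p)) h \<longrightarrow>
           (\<exists>A :: real^'d^'d. AE z in law V p. h z = A *v z)"
  shows "linearly_admissible M V p \<mu>\<^sub>1"
proof -
  have emb: "embedded_submanifold TYPE('m) M" and proper: "proper_map (top_of_set M) euclidean (\<lambda>x. x)"
    using assms(1) by (simp_all add: properly_embedded_submanifold_def)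
  have "closed M"
  proof -
    \<comment> \<open>Proper maps are closed, and the inclusion maps \<open>M\<close> onto
      itself.\<close>
    have "closedin euclidean ((\<lambda>x. x) ` M)"
      using proper unfolding proper_map_def closed_map_def by (metis closedin_topspace topspace_euclidean_subtopology)
    then show ?thesis by simp
  qed
  then interpret langevin M p "TYPE('m)" V K
    using emb assms unfolding langevin_def weighted_manifold_def langevin_axioms_def by blast
  \<comment> \<open>Discreteness makes every spectral point an eigenvalue, and none lies strictly
    between 0 and \<open>\<mu>\<^sub>1\<close>.\<close>
  have res: "\<nu> \<in> resolvent_set P (neg_op G)" if "0 < \<nu>" "\<nu> < \<mu>\<^sub>1" for \<nu>
  proof (rule ccontr)
    assume "\<nu> \<notin> resolvent_set P (neg_op G)"
    then have "eigenvalue P (neg_op G) \<nu>" using assms(14) by (auto simp: discrete_spectrum_def spectrum_def)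
    then show False using assms(16) that by (force simp: smallest_nonzero_eigenvalue_def)
  qed
  have ker: "\<exists>c. AE x in P. g x = c" if "(g, \<lambda>_. 0) \<in> G" for g by (rule kernel_constant[OF that assms(2)])
  obtain h where h: "distribution_preserving P h" "alignment_loss P (K t) h = ennreal (2 * CARD('d) * c * (1 - exp (- \<mu>\<^sub>1 * t)))"
    using assms(19) by blast
  have "is_arg_min (alignment_loss P (K t)) (distribution_preserving P) h"
    using h assms(20) by (auto simp: is_arg_min_def not_less)
  then obtain A :: "real^'d^'d" where A: "AE z in P. h z = A *v z" using assms(21) by blast
  have "orthogonal_matrix A"
    by (rule distribution_preserving_linear_orthogonal[OF h(1) A assms(9,10,11,12)])
  from alignment_loss_orthogonal[OF less_imp_le[OF assms(15)] this A]
  have "alignment_loss P (K t) (\<lambda>z. z) = ennreal (2 * CARD('d) * c * (1 - exp (- \<mu>\<^sub>1 * t)))" using h(2) by simp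
  note eig = coords_eigenfunctions[OF assms(9,10,11,12,15,17) res ker this]
  have coord_smooth: "smooth_function M (\<lambda>z. z $ i)" for i
    by (rule smooth_function_ambient[OF smooth_on_vec_nth[OF open_UNIV smooth_on_id[OF open_UNIV]]])
  have pointwise: "weighted_laplacian M p (\<lambda>z. z $ i) x = - \<mu>\<^sub>1 * x $ i" if "x \<in> M" for i x
    by (rule weak_eigenfunction_pointwise[OF coord_smooth eig that])
  note split = laplacian_coords_split[OF pointwise]
  have "eigenspace (neg_op G) \<mu>\<^sub>1 = ae_span P UNIV (\<lambda>i z. z $ i)"
  proof (rule ae_span_eqI[OF assms(18)])
    show "(\<lambda>z. z $ i) \<in> eigenspace (neg_op G) \<mu>\<^sub>1" for i
      using eig[of i] by (simp add: eigenspace_def semigroup.neg_op_iff)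
    fix a :: "'d \<Rightarrow> real" assume a: "AE z in P. (\<Sum>i\<in>UNIV. a i * z $ i) = 0"
    show "\<forall>j. a j = 0"
    proof
      fix j
      \<comment> \<open>Pairing the linear relation with \<open>z $ j\<close> isolates
        \<open>a j\<close>, since the coordinates are orthogonal in L2 with squared norm
        \<open>c\<close>.\<close>
      have "0 = (\<integral>z. (\<Sum>i\<in>UNIV. a i * z $ i) * z $ j \<partial>P)"
        by (subst integral_eq_zero_AE) (use a in \<open>auto elim: eventually_mono\<close>)
      also have "\<dots> = (\<integral>z. (\<Sum>i\<in>UNIV. a i * (z $ i * z $ j)) \<partial>P)" by (simp add: sum_distrib_right mult.assoc)
      also have "\<dots> = (\<Sum>i\<in>UNIV. a i * l2_inner P (\<lambda>z. z $ i) (\<lambda>z. z $ j))"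
        using l2_integrable_mult[OF coord_l2[OF assms(9)] coord_l2[OF assms(9)]] by (simp add: l2_inner_def)
      also have "\<dots> = a j * c"
        by (simp add: covariance_coord[OF assms(10,11)] if_distrib[of "\<lambda>x. _ * x"] cong: if_cong)
      finally show "a j = 0" using assms(12) by simp
    qed
  qed
  moreover have "\<exists>C>0. \<forall>z\<in>M. p z = C * exp (- (\<mu>\<^sub>1 / 2) * (norm z)\<^sup>2)"
    by (rule density_gaussian[OF split(1) assms(2)])
  ultimately show ?thesis
    unfolding linearly_admissible_def using split(2) assms(16,17) by blast
qed

end
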